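(* Let $\alpha\in(0,1]$ and let $\rho^\varepsilon$ be the smooth semigeostrophic branch, i.e. the classical solution of $$\partial_t\rho^\varepsilon+\nabla^\perp\psi^\varepsilon\cdot\nabla\rho^\varepsilon=0,\qquad \det(I+\varepsilon D^2\psi^\varepsilon)=1+\varepsilon\rho^\varepsilon,\qquad \int_{\mathbb{T}^2}\rho^\varepsilon dx=\int_{\mathbb{T}^2}\psi^\varepsilon dx=0,$$ issued from an initial datum $\rho_0\in C^{1,\alpha}(\mathbb{T}^2)$ (independent of $\varepsilon$) with $\int_{\mathbb{T}^2}\rho_0\,dx=0$, on its classical interval of existence, and set $M_0:=\|\rho_0\|_{L^\infty}$, $G_0:=\|\nabla\rho_0\|_{L^\infty}$. Let $T_\varepsilon$ be the maximal time $t$, within the classical interval of existence, on which $\varepsilon\|D^2\psi^\varepsilon\|_{L^\infty}\le\eta_0$ holds. If $M_0=0$, then $\rho^\varepsilon\equiv0$ and $T_\varepsilon=+\infty$. If $M_0>0$, then, for all sufficiently small $\varepsilon>0$, the condition $\varepsilon\|D^2\psi^\varepsilon\|_{L^\infty}\le\eta_0$ cannot fail before $$T_\varepsilon\ge\frac{c}{M_0}\log\frac1\varepsilon-C,$$ where $c,C>0$ depend only on $\alpha$, the universal ellipticity constants, and $1+\log^+(G_0/M_0)$. Equivalently, the corresponding physical time $S_\varepsilon=T_\varepsilon/\varepsilon$ satisfies $$S_\varepsilon\ge\frac{c}{\varepsilon M_0}\log\frac1\varepsilon-\frac C\varepsilon.$$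
   Context: $\mathbb{T}^2=\mathbb{R}^2/\mathbb{Z}^2$ with unit volume; $\nabla^\perp f=(-\partial_2f,\partial_1f)$; $\log^+s=\max\{\log s,0\}$. $\eta_0>0$ is a fixed, sufficiently small universal constant. Slow time $t$ and physical time $s$ are related by $t=\varepsilon s$. Standing assumption (standard smooth local theory for the transport--Monge--Ampère system): for smooth data with $1+\varepsilon\rho_0>0$ a unique classical branch exists and continues as long as the physical density $1+\varepsilon\rho^\varepsilon$ remains positive, the relevant transported smooth norms remain finite, and the Monge--Ampère potential $\frac{|x|^2}{2}+\varepsilon\psi^\varepsilon$ stays in the uniformly elliptic branch. Thus $T_\varepsilon$ is the perturbative classical lifespan: the first time along the classical branch at which the bound $\varepsilon\|D^2\psi^\varepsilon\|_{L^\infty}\le\eta_0$ can fail. "Universal ellipticity constants" are absolute numerical constants (ellipticity bounds of $A\mapsto\log\det(I+A)$ for symmetric $2\times2$ matrices $|A|\le 2\eta_0$). *)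

theory Defs
  imports "HOL-Analysis.Analysis"
begin

text \<open>
  Functions on the torus \<open>R^2/Z^2\<close> are represented by their \<open>Z^2\<close>-periodic lifts to
  \<^typ>\<open>real^2\<close>; integrals over the torus are integrals over the unit cell.
\<close>

definition periodic :: "(real^2 \<Rightarrow> 'b) \<Rightarrow> bool" where
  "periodic f \<longleftrightarrow> (\<forall>x i. f (x + axis i 1) = f x)"

definition torus_integral :: "(real^2 \<Rightarrow> real) \<Rightarrow> real" where
  "torus_integral f = integral (cbox 0 1) f"

definition grad :: "(real^2 \<Rightarrow> real) \<Rightarrow> real^2 \<Rightarrow> real^2" where
  "grad f x = (\<chi> i. frechet_derivative f (at x) (axis i 1))"

definition perp_grad :: "(real^2 \<Rightarrow> real) \<Rightarrow> real^2 \<Rightarrow> real^2" where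
  "perp_grad f x = vector [- (grad f x $ 2), grad f x $ 1]"

definition hess :: "(real^2 \<Rightarrow> real) \<Rightarrow> real^2 \<Rightarrow> real^2^2" where
  "hess f x = jacobian (grad f) (at x)"

text \<open>
  The supremum is taken in \<^typ>\<open>real\<close>, so it is meaningful for bounded functions only; it is
  used below only for continuous periodic ones. On matrices \<^const>\<open>norm\<close> is the Frobenius norm.
\<close>

definition sup_norm :: "(real^2 \<Rightarrow> 'b::real_normed_vector) \<Rightarrow> real" where
  "sup_norm f = (SUP x. norm (f x))"

definition log_plus :: "real \<Rightarrow> real" where
  "log_plus s = max (ln s) 0"

definition C1 :: "(real^2 \<Rightarrow> real) \<Rightarrow> bool" where
  "C1 f \<longleftrightarrow> f differentiable_on UNIV \<and> continuous_on UNIV (grad f)"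

definition C2 :: "(real^2 \<Rightarrow> real) \<Rightarrow> bool" where
  "C2 f \<longleftrightarrow> C1 f \<and> grad f differentiable_on UNIV \<and> continuous_on UNIV (hess f)"

text \<open>
  \<open>C1_holder_bound \<alpha> K f\<close>: each of \<open>\<parallel>f\<parallel>\<close>, \<open>\<parallel>\<nabla>f\<parallel>\<close> (sup norms) and the \<open>\<alpha>\<close>-Hoelder seminorm of
  \<open>\<nabla>f\<close> is at most \<open>K\<close>. For periodic \<open>f\<close> the Hoelder seminorms on the plane and on the torus agree.
\<close>

definition C1_holder_bound :: "real \<Rightarrow> real \<Rightarrow> (real^2 \<Rightarrow> real) \<Rightarrow> bool" where
  "C1_holder_bound \<alpha> K f \<longleftrightarrow>
     (\<forall>x. \<bar>f x\<bar> \<le> K) \<and> (\<forall>x. norm (grad f x) \<le> K) \<and>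
     (\<forall>x y. norm (grad f x - grad f y) \<le> K * dist x y powr \<alpha>)"

definition torus_C1_holder :: "real \<Rightarrow> (real^2 \<Rightarrow> real) \<Rightarrow> bool" where
  "torus_C1_holder \<alpha> f \<longleftrightarrow> periodic f \<and> C1 f \<and> (\<exists>K. C1_holder_bound \<alpha> K f)"

definition uniformly_elliptic :: "real \<Rightarrow> real^2^2 \<Rightarrow> bool" where
  "uniformly_elliptic \<kappa> A \<longleftrightarrow>
     (\<forall>v. \<kappa> * (v \<bullet> v) \<le> v \<bullet> (A *v v) \<and> v \<bullet> (A *v v) \<le> (1 / \<kappa>) * (v \<bullet> v))"

definition time_interval :: "ereal \<Rightarrow> real set" where
  "time_interval T = {t. 0 \<le> t \<and> ereal t < T}"

text \<open>
  \<open>(\<rho>, \<psi>)\<close> is a classical solution on \<open>[0,T)\<close>, \<open>T \<in> (0,\<infinity>]\<close>, with initial datum \<open>\<rho>0\<close>. The solution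
  lives in the regularity class of the datum: \<open>\<rho>(t)\<close> is \<open>C^{1,\<alpha>}\<close>, uniformly on compact time
  intervals. Ellipticity is the condition that \<open>I + \<epsilon> D^2\<psi>\<close>, the Hessian of
  \<open>|x|^2/2 + \<epsilon>\<psi>\<close>, is positive definite. At \<open>t = 0\<close> the time derivative is one-sided.
\<close>

definition sg_classical_solution ::
  "real \<Rightarrow> real \<Rightarrow> (real^2 \<Rightarrow> real) \<Rightarrow> ereal \<Rightarrow> (real \<Rightarrow> real^2 \<Rightarrow> real) \<Rightarrow> (real \<Rightarrow> real^2 \<Rightarrow> real) \<Rightarrow> bool"
  where
  "sg_classical_solution \<alpha> \<epsilon> \<rho>0 T \<rho> \<psi> \<longleftrightarrow>
     0 < T \<and> \<rho> 0 = \<rho>0 \<and>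
     (\<forall>t\<in>time_interval T. periodic (\<rho> t) \<and> C1 (\<rho> t) \<and> periodic (\<psi> t) \<and> C2 (\<psi> t)) \<and>
     (\<forall>\<tau>\<in>time_interval T. \<exists>K. \<forall>t\<in>{0..\<tau>}. C1_holder_bound \<alpha> K (\<rho> t)) \<and>
     continuous_on (time_interval T \<times> UNIV) (\<lambda>(t, x). \<rho> t x) \<and>
     continuous_on (time_interval T \<times> UNIV) (\<lambda>(t, x). grad (\<rho> t) x) \<and>
     continuous_on (time_interval T \<times> UNIV) (\<lambda>(t, x). \<psi> t x) \<and>
     continuous_on (time_interval T \<times> UNIV) (\<lambda>(t, x). grad (\<psi> t) x) \<and>
     continuous_on (time_interval T \<times> UNIV) (\<lambda>(t, x). hess (\<psi> t) x) \<and>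
     (\<forall>t\<in>time_interval T. \<forall>x. \<exists>\<rho>\<^sub>t.
        ((\<lambda>s. \<rho> s x) has_real_derivative \<rho>\<^sub>t) (at t within time_interval T) \<and>
        \<rho>\<^sub>t + perp_grad (\<psi> t) x \<bullet> grad (\<rho> t) x = 0) \<and>
     (\<forall>t\<in>time_interval T. \<forall>x. det (mat 1 + \<epsilon> *\<^sub>R hess (\<psi> t) x) = 1 + \<epsilon> * \<rho> t x) \<and>
     (\<forall>t\<in>time_interval T. \<forall>x v. v \<noteq> 0 \<longrightarrow> 0 < v \<bullet> ((mat 1 + \<epsilon> *\<^sub>R hess (\<psi> t) x) *v v)) \<and>
     (\<forall>t\<in>time_interval T. torus_integral (\<rho> t) = 0 \<and> torus_integral (\<psi> t) = 0)"

text \<open>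
  The classical branch: a classical solution that has no classical extension beyond \<open>T\<close>, so that
  \<open>[0,T)\<close> is its classical interval of existence.
\<close>

definition sg_branch ::
  "real \<Rightarrow> real \<Rightarrow> (real^2 \<Rightarrow> real) \<Rightarrow> ereal \<Rightarrow> (real \<Rightarrow> real^2 \<Rightarrow> real) \<Rightarrow> (real \<Rightarrow> real^2 \<Rightarrow> real) \<Rightarrow> bool"
  where
  "sg_branch \<alpha> \<epsilon> \<rho>0 T \<rho> \<psi> \<longleftrightarrow>
     sg_classical_solution \<alpha> \<epsilon> \<rho>0 T \<rho> \<psi> \<and>
     \<not> (\<exists>T' \<rho>' \<psi>'. T < T' \<and> sg_classical_solution \<alpha> \<epsilon> \<rho>0 T' \<rho>' \<psi>' \<and>
          (\<forall>t\<in>time_interval T. \<rho>' t = \<rho> t \<and> \<psi>' t = \<psi> t))"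

text \<open>
  The perturbative lifespan \<open>T_\<epsilon>\<close> of a branch with existence interval \<open>[0,T)\<close>. It is \<open>-\<infinity>\<close> if the
  bound already fails at time \<open>0\<close>.
\<close>

definition perturbative_lifespan ::
  "real \<Rightarrow> real \<Rightarrow> ereal \<Rightarrow> (real \<Rightarrow> real^2 \<Rightarrow> real) \<Rightarrow> ereal" where
  "perturbative_lifespan \<eta>0 \<epsilon> T \<psi> =
     Sup {ereal t | t. t \<in> time_interval T \<and> (\<forall>s\<in>{0..t}. \<epsilon> * sup_norm (hess (\<psi> s)) \<le> \<eta>0)}"

text \<open>
  The standard local theory, which is presupposed and not part of the claim: local existence,
  uniqueness, and continuation past a finite time as long as the physical density stays bounded
  below, the transported \<open>C^{1,\<alpha>}\<close> norm stays bounded and \<open>I + \<epsilon> D^2\<psi>\<close> stays uniformly elliptic.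
\<close>

definition sg_local_theory :: bool where
  "sg_local_theory \<longleftrightarrow>
     (\<forall>\<alpha> \<epsilon> \<rho>0. 0 < \<alpha> \<and> \<alpha> \<le> 1 \<and> 0 < \<epsilon> \<and> torus_C1_holder \<alpha> \<rho>0 \<and> torus_integral \<rho>0 = 0 \<and>
        (\<forall>x. 0 < 1 + \<epsilon> * \<rho>0 x) \<longrightarrow>
        (\<exists>T \<rho> \<psi>. sg_classical_solution \<alpha> \<epsilon> \<rho>0 T \<rho> \<psi>) \<and>
        (\<forall>T1 \<rho>1 \<psi>1 T2 \<rho>2 \<psi>2.
           sg_classical_solution \<alpha> \<epsilon> \<rho>0 T1 \<rho>1 \<psi>1 \<and> sg_classical_solution \<alpha> \<epsilon> \<rho>0 T2 \<rho>2 \<psi>2 \<longrightarrow>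
           (\<forall>t\<in>time_interval (min T1 T2). \<rho>1 t = \<rho>2 t \<and> \<psi>1 t = \<psi>2 t)) \<and>
        (\<forall>T \<rho> \<psi>.
           sg_classical_solution \<alpha> \<epsilon> \<rho>0 T \<rho> \<psi> \<and> T < \<infinity> \<and>
           (\<exists>\<delta>>0. \<forall>t\<in>time_interval T. \<forall>x. \<delta> \<le> 1 + \<epsilon> * \<rho> t x) \<and>
           (\<exists>K. \<forall>t\<in>time_interval T. C1_holder_bound \<alpha> K (\<rho> t)) \<and>
           (\<exists>\<kappa>>0. \<forall>t\<in>time_interval T. \<forall>x. uniformly_elliptic \<kappa> (mat 1 + \<epsilon> *\<^sub>R hess (\<psi> t) x)) \<longrightarrow>
           (\<exists>T' \<rho>' \<psi>'. T < T' \<and> sg_classical_solution \<alpha> \<epsilon> \<rho>0 T' \<rho>' \<psi>' \<and>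
              (\<forall>t\<in>time_interval T. \<rho>' t = \<rho> t \<and> \<psi>' t = \<psi> t))))"

end

theory Submission
  imports Defs
begin

text \<open>
  Write $f = \Delta\psi$, so that $f + \varepsilon \det D^2\psi = \rho$. As long as $\varepsilon$ times
  the square of a logarithm is small, this equation is solved by Picard iteration in the set of
  potentials with $|D^2\psi| \lesssim M_0 (1 + \log(1 + G/M_0))$ and $[D^2\psi]_{C^\gamma} \lesssim G + M_0$,
  which the linear logarithmic and Schauder estimates for the Laplacian leave invariant; the
  iteration contracts in $L^2$, where $\|D^2 u\|_2 = \|\Delta u\|_2$. A convex solution is unique because the mixed
  determinant inequality integrates to an equality on the torus, so the logarithmic bound holds
  for every convex solution. The density keeps its sup norm and its Lipschitz constant $G(t)$ grows at
  the rate $\|D^2\psi\|_\infty$; with $Y = \log(G/M_0)$ this gives $Y' \lesssim M_0 Y$, so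
  $\varepsilon \|D^2\psi\|_\infty$ stays small up to times of order $M_0^{-1}\log(1/\varepsilon)$. On that time interval the
  $C^{1,\alpha}$ norm of the density cannot blow up either, hence the branch exists there.
\<close>

section \<open>Calculus on the torus\<close>

text \<open>No elliptic existence theory is invoked. Poisson's equation is solved explicitly for
  trigonometric polynomials, and a general right-hand side is first replaced by one of these up to a
  uniform error. Each Picard step is therefore only approximate, which is harmless because the
  bounds on second derivatives are a priori: they hold for every C^2 potential and see the
  right-hand side only through its sup norm and Hoelder seminorm. They are obtained by writing a
  second derivative as an average at scale 1/6 minus an integral over all smaller scales, in which
  only the trace of the Hessian occurs. The \<alpha>-Hoelder bound on the gradient of \<rho> is
  therefore obtained through a Lipschitz bound on the Hessian of \<psi>. That bound may be huge, as
  it only has to exclude blow-up; the quantitative rate comes from the logarithmic estimate alone.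
  Quantities that reappear on the right of their own estimate are finite by hypothesis, so they are
  absorbed instead of being handled by Gronwall.\<close>

definition lattice_vec :: "real^2 \<Rightarrow> bool" where
  "lattice_vec w \<longleftrightarrow> (\<exists>m n::int. w = axis 1 (of_int m) + axis 2 (of_int n))"

lemma vec2_eq_iff: "(x::'a^2) = y \<longleftrightarrow> x $ 1 = y $ 1 \<and> x $ 2 = y $ 2"
  by (simp add: vec_eq_iff forall_2)

lemma axis2_nth [simp]:
  "(axis 1 a :: 'a::zero^2) $ 1 = a" "(axis 1 a :: 'a^2) $ 2 = 0"
  "(axis 2 a :: 'a^2) $ 1 = 0" "(axis 2 a :: 'a^2) $ 2 = a"
  by (simp_all add: axis_def)

lemma inner2: "(x::real^2) \<bullet> y = x $ 1 * y $ 1 + x $ 2 * y $ 2"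
  by (simp add: inner_vec_def sum_2)

lemma axis_add: "axis i (a + b :: 'a::monoid_add) = axis i a + axis i b"
  by (simp add: axis_def vec_eq_iff)

lemma periodic_shift_int:
  assumes "periodic f"
  shows "f (x + axis i (of_int n)) = f x"
proof (induct n arbitrary: x rule: int_induct[where k=0])
  case base
  have "axis i (of_int 0 :: real) = (0::real^2)" by (simp add: axis_def vec_eq_iff)
  then show ?case by (simp only: add_0_right)
next
  case (step1 n)
  have "x + axis i (of_int (n + 1)) = (x + axis i (of_int n)) + axis i 1"
    by (simp add: axis_add)
  with step1 assms show ?case by (metis periodic_def)
next
  case (step2 n)
  have "x + axis i (of_int n) = (x + axis i (of_int (n - 1))) + axis i 1"
    using axis_add[of i "of_int (n-1)" "1::real"] by simp
  with step2 assms show ?case by (metis periodic_def)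
qed

lemma periodic_lattice: "periodic f \<Longrightarrow> lattice_vec w \<Longrightarrow> f (x + w) = f x"
  unfolding lattice_vec_def by (metis add.assoc periodic_shift_int)

lemma lattice_rep: "\<exists>w. lattice_vec w \<and> x + w \<in> cbox 0 1"
proof -
  let ?w = "axis 1 (of_int (- \<lfloor>x $ 1\<rfloor>)) + axis 2 (of_int (- \<lfloor>x $ 2\<rfloor>))"
  have "lattice_vec ?w" unfolding lattice_vec_def by blast
  moreover have "x + ?w \<in> cbox 0 1"
    by (simp add: mem_box_cart forall_2) linarith
  ultimately show ?thesis by blast
qed

lemma periodic_compose: "periodic f \<Longrightarrow> periodic (\<lambda>x. F (f x))"
  by (simp add: periodic_def)
lemma periodic_compose2: "periodic f \<Longrightarrow> periodic g \<Longrightarrow> periodic (\<lambda>x. F (f x) (g x))"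
  by (simp add: periodic_def)
lemma periodic_shift: "periodic f \<Longrightarrow> periodic (\<lambda>x. f (x + a))"
  by (simp add: periodic_def) (metis add.commute add.left_commute)

lemma cont_shift:
  fixes f :: "real^2 \<Rightarrow> 'b::topological_space"
  assumes "continuous_on UNIV f" "continuous_on S h"
  shows "continuous_on S (\<lambda>x. f (h x))"
  using continuous_on_compose2[OF assms] by simp

lemma integrable_cont [simp]:
  fixes f :: "real^2 \<Rightarrow> real"
  shows "continuous_on UNIV f \<Longrightarrow> f integrable_on cbox a b"
  by (rule integrable_continuous) (erule continuous_on_subset, simp)

text \<open>The shifted cell is cut along the hyperplane x_i = 1; the part beyond it is moved back
  by one period and fills the slab 0 \<le> x_i \<le> t that the shift left uncovered.\<close>

lemma torus_shift_aux:
  fixes f :: "real^2 \<Rightarrow> real"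
  assumes per: "periodic f" and cont: "continuous_on UNIV f" and t: "0 \<le> t" "t \<le> 1"
  shows "integral (cbox 0 1) (\<lambda>x. f (x + axis i t)) = integral (cbox 0 1) f"
proof -
  let ?e = "axis i (1::real)"
  have eB: "?e \<in> Basis" by (simp add: axis_in_Basis_iff)
  have ie: "x \<bullet> ?e = x $ i" for x by (simp add: inner_axis)
  have "integral (cbox 0 1) (\<lambda>x. f (x + axis i t)) = integral (cbox (0 + axis i t) (1 + axis i t)) f"
    using integral_shift_cbox_plus[of 0 1 f "axis i t"] by (simp add: o_def add.commute)
  also have "\<dots> = integral (cbox (0 + axis i t) (1 + axis i t) \<inter> {x. x \<bullet> ?e \<le> 1}) f
               + integral (cbox (0 + axis i t) (1 + axis i t) \<inter> {x. x \<bullet> ?e \<ge> 1}) f"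
    by (rule integral_split) (use cont eB in auto)
  also have "cbox (0 + axis i t) (1 + axis i t) \<inter> {x. x \<bullet> ?e \<le> 1} = cbox 0 1 \<inter> {x. x \<bullet> ?e \<ge> t}"
    unfolding ie using t by (auto simp: mem_box_cart axis_def split: if_splits)
      (smt (verit))+
  also have "cbox (0 + axis i t) (1 + axis i t) \<inter> {x. x \<bullet> ?e \<ge> 1} = cbox (0 + ?e) ((1 + axis i (t - 1)) + ?e)"
    unfolding ie using t by (auto simp: mem_box_cart axis_def split: if_splits)
      (smt (verit))+
  also have "integral (cbox (0 + ?e) ((1 + axis i (t - 1)) + ?e)) f
      = integral (cbox 0 (1 + axis i (t - 1))) (\<lambda>x. f (x + ?e))"
    using integral_shift_cbox_plus[of 0 "1 + axis i (t - 1)" f ?e] by (simp add: o_def add.commute)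
  also have "(\<lambda>x. f (x + ?e)) = f" using per by (simp add: periodic_def)
  also have "cbox 0 (1 + axis i (t - 1)) = cbox 0 1 \<inter> {x. x \<bullet> ?e \<le> t}"
    unfolding ie using t by (auto simp: mem_box_cart axis_def split: if_splits)
      (smt (verit))+
  also have "integral (cbox 0 1 \<inter> {x. x \<bullet> ?e \<ge> t}) f + integral (cbox 0 1 \<inter> {x. x \<bullet> ?e \<le> t}) f
     = integral (cbox 0 1) f"
    by (subst integral_split[where k="?e" and c=t]) (use cont eB in auto)
  finally show ?thesis .
qed

lemma torus_shift:
  assumes per: "periodic f" and cont: "continuous_on UNIV f"
  shows "torus_integral (\<lambda>x. f (x + h)) = torus_integral f"
proof -
  have one: "torus_integral (\<lambda>x. q (x + axis i s)) = torus_integral q"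
    if q: "periodic q" "continuous_on UNIV q" for q i s
  proof -
    \<comment> \<open>Only the fractional part of a shift matters, which brings it into the range of
      \<open>torus_shift_aux\<close>.\<close>
    have "q (x + axis i s) = q (x + axis i (frac s))" for x
    proof -
      have "x + axis i s = (x + axis i (frac s)) + axis i (of_int \<lfloor>s\<rfloor>)"
        by (simp add: frac_def axis_add[symmetric] add.assoc)
      then show ?thesis using periodic_shift_int[OF q(1)] by metis
    qed
    then show ?thesis
      unfolding torus_integral_def
      using torus_shift_aux[OF q, of "frac s" i] by (simp add: frac_ge_0 less_imp_le[OF frac_lt_1])
  qed
  have h: "h = axis 2 (h $ 2) + axis 1 (h $ 1)" by (simp add: vec2_eq_iff)
  have "torus_integral (\<lambda>x. f (x + h)) = torus_integral (\<lambda>x. f ((x + axis 2 (h $ 2)) + axis 1 (h $ 1)))"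
    by (subst h) (simp add: add.assoc)
  also have "\<dots> = torus_integral (\<lambda>x. f (x + axis 1 (h $ 1)))"
    by (rule one[of "\<lambda>x. f (x + axis 1 (h $ 1))"])
      (auto intro!: periodic_shift per cont_shift[OF cont] continuous_intros)
  also have "\<dots> = torus_integral f" by (rule one[OF per cont])
  finally show ?thesis .
qed

text \<open>The gradient is carried as an explicit second argument, so that it can be a formula, a
  row of a Hessian field, a limit, or \<open>grad\<close> itself.\<close>

definition c1 :: "(real^2 \<Rightarrow> real) \<Rightarrow> (real^2 \<Rightarrow> real^2) \<Rightarrow> bool" where
  "c1 p P \<longleftrightarrow> (\<forall>x. (p has_derivative (\<lambda>h. P x \<bullet> h)) (at x)) \<and> continuous_on UNIV P"

lemma c1_cont: "c1 p P \<Longrightarrow> continuous_on UNIV p"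
  unfolding c1_def by (meson continuous_at_imp_continuous_on has_derivative_continuous)

lemma c1_line:
  assumes "c1 p P"
  shows "((\<lambda>s. p (x + s *\<^sub>R v)) has_real_derivative P (x + s *\<^sub>R v) \<bullet> v) (at s within S)"
proof -
  have "((\<lambda>s. p (x + s *\<^sub>R v)) has_derivative (\<lambda>h. P (x + s *\<^sub>R v) \<bullet> (h *\<^sub>R v))) (at s within S)"
    by (rule has_derivative_compose[where f="\<lambda>s. x + s *\<^sub>R v" and g=p])
      (use assms in \<open>auto simp: c1_def intro!: derivative_eq_intros\<close>)
  then show ?thesis
    by (simp add: has_field_derivative_def mult.commute[of _ "P (x + s *\<^sub>R v) \<bullet> v"] fun_eq_iff)
qed

lemma c1_unique: "c1 p P \<Longrightarrow> c1 p P' \<Longrightarrow> P = P'"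
  unfolding c1_def by (metis (no_types, opaque_lifting) has_derivative_unique vector_eq_ldot inner_commute ext)

lemma c1_shift:
  assumes "c1 p P" shows "c1 (\<lambda>x. p (x + a)) (\<lambda>x. P (x + a))"
  unfolding c1_def
proof (intro conjI allI)
  fix x
  have "((\<lambda>x. p (x + a)) has_derivative (\<lambda>h. P (x + a) \<bullet> h)) (at x)"
    by (rule has_derivative_compose[where f="\<lambda>x. x + a" and g=p])
      (use assms in \<open>auto simp: c1_def intro!: derivative_eq_intros\<close>)
  then show "((\<lambda>x. p (x + a)) has_derivative (\<lambda>h. P (x + a) \<bullet> h)) (at x)" .
  show "continuous_on UNIV (\<lambda>x. P (x + a))"
    by (rule cont_shift) (use assms in \<open>auto simp: c1_def intro!: continuous_intros\<close>)
qed

lemma c1_periodic: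
  assumes "c1 p P" "periodic p" shows "periodic P"
proof -
  have "(\<lambda>x. p (x + axis i 1)) = p" for i using assms(2) by (simp add: periodic_def)
  then have "(\<lambda>x. P (x + axis i 1)) = P" for i
    using c1_shift[OF assms(1), of "axis i 1"] c1_unique[OF assms(1)] by metis
  then show ?thesis unfolding periodic_def by metis
qed

lemma c1_diff: "c1 p P \<Longrightarrow> c1 q Q \<Longrightarrow> c1 (\<lambda>x. p x - q x) (\<lambda>x. P x - Q x)"
  unfolding c1_def by (auto simp: inner_diff_left intro!: derivative_eq_intros continuous_intros)

lemma c1_mean_value:
  assumes "c1 p P"
  shows "\<exists>s. 0 < s \<and> s < 1 \<and> p (x + v) - p x = P (x + s *\<^sub>R v) \<bullet> v"
  using MVT2[of 0 1 "\<lambda>s. p (x + s *\<^sub>R v)" "\<lambda>s. P (x + s *\<^sub>R v) \<bullet> v"] c1_line[OF assms, of x v _ UNIV]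
  by auto

text \<open>The subtracted multiple of \<open>p\<close> is constant in \<open>s\<close>: c = 0 gives
  plain translates, c = 1 the increments that occur in \<open>torus_diff_swap\<close>.\<close>

lemma torus_leibniz:
  assumes p: "c1 p P" and W: "continuous_on UNIV W"
  shows "((\<lambda>s. torus_integral (\<lambda>x. (p (x + s *\<^sub>R v) - c * p x) * W x)) has_real_derivative
           torus_integral (\<lambda>x. (P x \<bullet> v) * W x)) (at 0)"
proof -
  have c: "continuous_on UNIV p" using c1_cont p .
  have cP: "continuous_on UNIV P" using p by (simp add: c1_def)
  have "((\<lambda>s. integral (cbox 0 1) (\<lambda>x. (p (x + s *\<^sub>R v) - c * p x) * W x)) has_real_derivative
           integral (cbox 0 1) (\<lambda>x. (P (x + 0 *\<^sub>R v) \<bullet> v) * W x)) (at 0 within UNIV)"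
  proof (rule leibniz_rule_field_derivative[where fx="\<lambda>s x. (P (x + s *\<^sub>R v) \<bullet> v) * W x"])
    show "((\<lambda>s. (p (t + s *\<^sub>R v) - c * p t) * W t) has_real_derivative P (t + s *\<^sub>R v) \<bullet> v * W t) (at s within UNIV)" for s t
      by (auto intro!: derivative_eq_intros c1_line[OF p])
    show "continuous_on (UNIV \<times> cbox 0 1) (\<lambda>(s, x). (P (x + s *\<^sub>R v) \<bullet> v) * W x)"
      unfolding split_beta
      by (intro continuous_intros cont_shift[OF cP] cont_shift[OF W])
    show "(\<lambda>x. (p (x + s *\<^sub>R v) - c * p x) * W x) integrable_on cbox 0 1" for s
      by (intro integrable_cont continuous_intros cont_shift[OF c] W)
  qed auto
  then show ?thesis by (simp add: torus_integral_def)
qed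

lemma torus_integral_add: "continuous_on UNIV f \<Longrightarrow> continuous_on UNIV g \<Longrightarrow>
  torus_integral (\<lambda>x. f x + g x) = torus_integral f + torus_integral g"
  unfolding torus_integral_def by (intro integral_add integrable_cont)
lemma torus_integral_diff: "continuous_on UNIV f \<Longrightarrow> continuous_on UNIV g \<Longrightarrow>
  torus_integral (\<lambda>x. f x - g x) = torus_integral f - torus_integral g"
  unfolding torus_integral_def by (intro integral_diff integrable_cont)
lemma torus_integral_cmult: "torus_integral (\<lambda>x. c * f x) = c * torus_integral f"
  unfolding torus_integral_def by simp
lemma torus_integral_const: "torus_integral (\<lambda>x. c) = c"
proof -
  have "(0::real^2) \<in> cbox 0 1" by (simp add: mem_box_cart)
  then have "cbox 0 (1::real^2) \<noteq> {}" by blast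
  then show ?thesis unfolding torus_integral_def by (simp add: content_cbox_if_cart)
qed
lemma torus_integral_mono: "continuous_on UNIV f \<Longrightarrow> continuous_on UNIV g \<Longrightarrow>
  (\<And>x. f x \<le> g x) \<Longrightarrow> torus_integral f \<le> torus_integral g"
  unfolding torus_integral_def by (intro integral_le integrable_cont) auto

text \<open>By translation invariance the integral of the translates of \<open>p\<close> along
  \<open>v\<close> is constant in the parameter; its derivative is the integral in question.\<close>

lemma torus_integral_deriv_zero:
  assumes p: "c1 p P" "periodic p"
  shows "torus_integral (\<lambda>x. P x \<bullet> v) = 0"
proof -
  have "((\<lambda>s. torus_integral (\<lambda>x. (p (x + s *\<^sub>R v) - 0 * p x) * 1)) has_real_derivative
           torus_integral (\<lambda>x. (P x \<bullet> v) * 1)) (at 0)"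
    by (rule torus_leibniz[OF p(1)]) auto
  moreover have "torus_integral (\<lambda>x. (p (x + s *\<^sub>R v) - 0 * p x) * 1) = torus_integral p" for s
    using torus_shift[OF p(2) c1_cont[OF p(1)]] by simp
  ultimately show ?thesis
    using DERIV_unique[OF _ DERIV_const] by fastforce
qed

text \<open>The integral of p(x + c) q(x + d) depends on c - d only, and after expansion both sides
  show the same four differences. This is a discrete form of two integrations by parts.\<close>

lemma torus_diff_swap:
  assumes p: "periodic p" "continuous_on UNIV p" and q: "periodic q" "continuous_on UNIV q"
  shows "torus_integral (\<lambda>x. (p (x + a) - p x) * (q (x + b) - q x))
       = torus_integral (\<lambda>x. (p (x - b) - p x) * (q (x - a) - q x))"
proof -
  note sh = cont_shift[OF p(2)] cont_shift[OF q(2)]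
  have s: "torus_integral (\<lambda>x. p (x + c) * q (x + d)) = torus_integral (\<lambda>x. p (x + (c + e)) * q (x + (d + e)))" for c d e
  proof -
    have "periodic (\<lambda>x. p (x + c) * q (x + d))"
      by (rule periodic_compose2) (intro periodic_shift p q)+
    moreover have "continuous_on UNIV (\<lambda>x. p (x + c) * q (x + d))"
      by (intro continuous_intros sh)
    ultimately show ?thesis
      using torus_shift[of "\<lambda>x. p (x + c) * q (x + d)" e] by (simp add: add_ac)
  qed
  have ex: "torus_integral (\<lambda>x. (p (x + a) - p x) * (q (x + b) - q x)) =
      (torus_integral (\<lambda>x. p (x + a) * q (x + b)) - torus_integral (\<lambda>x. p (x + a) * q (x + 0)))
      - (torus_integral (\<lambda>x. p (x + 0) * q (x + b)) - torus_integral (\<lambda>x. p (x + 0) * q (x + 0)))" for a b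
    by (subst torus_integral_diff[symmetric]; (intro continuous_intros sh)?)+ (simp add: algebra_simps)
  show ?thesis
    using ex[of a b] ex[of "- b" "- a"] s[of a b "- a - b"] s[of a 0 "- a"] s[of 0 b "- b"]
    by (simp add: algebra_simps)
qed

text \<open>
  Two integrations by parts without third derivatives: only first derivatives of the translates
  \<open>p (x + s v)\<close> and \<open>q (x + t w)\<close> are taken, one parameter at a time.
\<close>

lemma torus_null:
  assumes p: "c1 p P" "periodic p" and q: "c1 q Q" "periodic q"
  shows "torus_integral (\<lambda>x. (P x \<bullet> v) * (Q x \<bullet> w)) = torus_integral (\<lambda>x. (P x \<bullet> w) * (Q x \<bullet> v))"
proof -
  note cp = c1_cont[OF p(1)] and cq = c1_cont[OF q(1)]
  have cP: "continuous_on UNIV P" and cQ: "continuous_on UNIV Q" using p q by (auto simp: c1_def)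
  \<comment> \<open>The derivative at s = 0 of \<open>torus_diff_swap\<close>, with the increment in
    direction \<open>w\<close> still finite.\<close>
  have A: "torus_integral (\<lambda>x. (P x \<bullet> v) * (q (x + t *\<^sub>R w) - q x)) =
        torus_integral (\<lambda>x. (Q x \<bullet> (- v)) * (p (x - t *\<^sub>R w) - p x))" for t
  proof -
    have 1: "((\<lambda>s. torus_integral (\<lambda>x. (p (x + s *\<^sub>R v) - 1 * p x) * (q (x + t *\<^sub>R w) - q x))) has_real_derivative
           torus_integral (\<lambda>x. (P x \<bullet> v) * (q (x + t *\<^sub>R w) - q x))) (at 0)"
      by (rule torus_leibniz[OF p(1)]) (intro continuous_intros cq cont_shift[OF cq])
    have 2: "((\<lambda>s. torus_integral (\<lambda>x. (q (x + s *\<^sub>R (-v)) - 1 * q x) * (p (x - t *\<^sub>R w) - p x))) has_real_derivative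
           torus_integral (\<lambda>x. (Q x \<bullet> (-v)) * (p (x - t *\<^sub>R w) - p x))) (at 0)"
      by (rule torus_leibniz[OF q(1)]) (intro continuous_intros cp cont_shift[OF cp])
    have "torus_integral (\<lambda>x. (p (x + s *\<^sub>R v) - 1 * p x) * (q (x + t *\<^sub>R w) - q x))
       = torus_integral (\<lambda>x. (q (x + s *\<^sub>R (-v)) - 1 * q x) * (p (x - t *\<^sub>R w) - p x))" for s
      using torus_diff_swap[OF p(2) cp q(2) cq, of "s *\<^sub>R v" "t *\<^sub>R w"] by (simp add: mult.commute)
    with 1 2 show ?thesis using DERIV_unique by fastforce
  qed
  have 1: "((\<lambda>s. torus_integral (\<lambda>x. (q (x + s *\<^sub>R w) - 1 * q x) * (P x \<bullet> v))) has_real_derivative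
           torus_integral (\<lambda>x. (Q x \<bullet> w) * (P x \<bullet> v))) (at 0)"
    by (rule torus_leibniz[OF q(1)]) (intro continuous_intros cP)
  have 2: "((\<lambda>s. torus_integral (\<lambda>x. (p (x + s *\<^sub>R (-w)) - 1 * p x) * (Q x \<bullet> (-v)))) has_real_derivative
           torus_integral (\<lambda>x. (P x \<bullet> (-w)) * (Q x \<bullet> (-v)))) (at 0)"
    by (rule torus_leibniz[OF p(1)]) (intro continuous_intros cQ)
  have "torus_integral (\<lambda>x. (q (x + s *\<^sub>R w) - 1 * q x) * (P x \<bullet> v)) =
     torus_integral (\<lambda>x. (p (x + s *\<^sub>R (-w)) - 1 * p x) * (Q x \<bullet> (-v)))" for s
    using A[of s] by (simp add: mult.commute)
  with 1 2 have "torus_integral (\<lambda>x. (Q x \<bullet> w) * (P x \<bullet> v)) = torus_integral (\<lambda>x. (P x \<bullet> (-w)) * (Q x \<bullet> (-v)))"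
    using DERIV_unique by fastforce
  then show ?thesis by (simp add: mult.commute)
qed

text \<open>The mean value theorem is applied twice to the second difference, first in direction
  \<open>i\<close>, then in direction \<open>j\<close>. The second difference is symmetric in the
  two directions, which is the source of Schwarz's theorem.\<close>

lemma hess_symmetric_aux:
  fixes f :: "real^2 \<Rightarrow> real"
  assumes f: "c1 f g" and g: "\<And>i. c1 (\<lambda>x. g x $ i) (\<lambda>x. H x $ i)" and d: "d > 0"
  shows "\<exists>s t. 0 < s \<and> s < d \<and> 0 < t \<and> t < d \<and>
     f (x + axis i d + axis j d) - f (x + axis i d) - f (x + axis j d) + f x
       = d * (d * (H (x + axis i s + axis j t) $ i $ j))"
proof -
  have sc: "s *\<^sub>R axis k 1 = axis k (s::real)" for s k
    by (simp add: axis_def vec_eq_iff)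
  have a0: "axis k 0 = (0::real^2)" for k by (simp add: axis_def vec_eq_iff)
  have ie: "v \<bullet> axis k 1 = v $ k" for v k by (simp add: inner_axis)
  let ?F = "\<lambda>s. f ((x + axis j d) + s *\<^sub>R axis i 1) - f (x + s *\<^sub>R axis i 1)"
  have "(?F has_real_derivative (g ((x + axis j d) + s *\<^sub>R axis i 1) $ i - g (x + s *\<^sub>R axis i 1) $ i)) (at s)" for s
    using DERIV_diff[OF c1_line[OF f, of "x + axis j d" "axis i 1" s] c1_line[OF f, of x "axis i 1" s]] unfolding ie .
  then obtain s where s: "0 < s" "s < d" and
    1: "?F d - ?F 0 = d * (g ((x + axis j d) + s *\<^sub>R axis i 1) $ i - g (x + s *\<^sub>R axis i 1) $ i)"
    using MVT2[of 0 d ?F "\<lambda>s. g ((x + axis j d) + s *\<^sub>R axis i 1) $ i - g (x + s *\<^sub>R axis i 1) $ i"] d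
    by auto
  let ?G = "\<lambda>t. g ((x + axis i s) + t *\<^sub>R axis j 1) $ i"
  have "(?G has_real_derivative (H ((x + axis i s) + t *\<^sub>R axis j 1) $ i $ j)) (at t)" for t
    using c1_line[OF g[of i], of "x + axis i s" "axis j 1" t] unfolding ie .
  then obtain t where t: "0 < t" "t < d" and
    2: "?G d - ?G 0 = d * (H ((x + axis i s) + t *\<^sub>R axis j 1) $ i $ j)"
    using MVT2[of 0 d ?G "\<lambda>t. H ((x + axis i s) + t *\<^sub>R axis j 1) $ i $ j"] d by auto
  have "f (x + axis i d + axis j d) - f (x + axis i d) - f (x + axis j d) + f x = ?F d - ?F 0"
    by (simp add: sc a0 algebra_simps)
  also have "\<dots> = d * (?G d - ?G 0)" unfolding 1 by (simp add: sc a0 algebra_simps)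
  also have "\<dots> = d * (d * (H (x + axis i s + axis j t) $ i $ j))" unfolding 2 by (simp add: sc a0)
  finally show ?thesis using s t by blast
qed

lemma hess_symmetric:
  fixes f :: "real^2 \<Rightarrow> real"
  assumes f: "c1 f g" and g: "\<And>i. c1 (\<lambda>x. g x $ i) (\<lambda>x. H x $ i)"
  shows "H x $ i $ j = H x $ j $ i"
proof (rule ccontr)
  assume ne: "H x $ i $ j \<noteq> H x $ j $ i"
  \<comment> \<open>Half the gap: numbers closer than \<open>e\<close> to the two distinct entries
    cannot coincide, yet both are the same second difference divided by d^2.\<close>
  define e where "e = \<bar>H x $ i $ j - H x $ j $ i\<bar> / 2"
  have e: "e > 0" using ne by (simp add: e_def)
  have "\<exists>d>0. \<forall>y. dist y x < d \<longrightarrow> \<bar>H y $ a $ b - H x $ a $ b\<bar> < e" for a b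
  proof -
    have "continuous_on UNIV (\<lambda>x. H x $ a)" using g by (simp add: c1_def)
    then have "continuous_on UNIV (\<lambda>x. H x $ a $ b)" by (rule continuous_on_component)
    then show ?thesis using e unfolding continuous_on_iff by (auto simp: dist_real_def)
  qed
  then obtain d1 d2 where d: "d1 > 0" "d2 > 0" and
    h1: "\<And>y. dist y x < d1 \<Longrightarrow> \<bar>H y $ i $ j - H x $ i $ j\<bar> < e" and
    h2: "\<And>y. dist y x < d2 \<Longrightarrow> \<bar>H y $ j $ i - H x $ j $ i\<bar> < e" by metis
  define d where "d = min d1 d2 / 2"
  have d0: "d > 0" using d by (simp add: d_def)
  have near: "dist (x + axis a s + axis b t) x < min d1 d2" if "0 < s" "s < d" "0 < t" "t < d" for a b s t
  proof -
    have "dist (x + axis a s + axis b t) x \<le> norm (axis a s :: real^2) + norm (axis b t :: real^2)"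
      using norm_triangle_ineq[of "axis a s :: real^2" "axis b t"] by (simp add: dist_norm add.assoc)
    also have "\<dots> = s + t"
    proof -
      have "norm (axis k u :: real^2) = u" if "0 < u" for k u
        using that by (simp add: norm_eq_sqrt_inner inner_axis_axis)
      then show ?thesis using that by simp
    qed
    finally show ?thesis using that by (simp add: d_def)
  qed
  from hess_symmetric_aux[OF f g d0, of x i j] obtain s t where st: "0 < s" "s < d" "0 < t" "t < d"
    and 1: "f (x + axis i d + axis j d) - f (x + axis i d) - f (x + axis j d) + f x
       = d * (d * (H (x + axis i s + axis j t) $ i $ j))" by blast
  from hess_symmetric_aux[OF f g d0, of x j i] obtain s' t' where st': "0 < s'" "s' < d" "0 < t'" "t' < d"
    and 2: "f (x + axis j d + axis i d) - f (x + axis j d) - f (x + axis i d) + f x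
       = d * (d * (H (x + axis j s' + axis i t') $ j $ i))" by blast
  have "H (x + axis i s + axis j t) $ i $ j = H (x + axis j s' + axis i t') $ j $ i"
    using 1 2 d0 by (simp add: algebra_simps)
  moreover have "\<bar>H (x + axis i s + axis j t) $ i $ j - H x $ i $ j\<bar> < e"
    using near[OF st, of i j] by (intro h1) simp
  moreover have "\<bar>H (x + axis j s' + axis i t') $ j $ i - H x $ j $ i\<bar> < e"
    using near[OF st', of j i] by (intro h2) simp
  ultimately show False unfolding e_def by (simp add: abs_if split: if_splits)
qed

text \<open>
  \<open>pot g H\<close>: \<open>g\<close> is a periodic curl-free \<open>C^1\<close> field with Jacobian \<open>H\<close>; it plays the role of \<open>\<nabla>\<psi>\<close>
  (up to a constant field), and the potential itself is never needed.
\<close>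

definition pot :: "(real^2 \<Rightarrow> real^2) \<Rightarrow> (real^2 \<Rightarrow> real^2^2) \<Rightarrow> bool" where
  "pot g H \<longleftrightarrow> periodic g \<and> (\<forall>i. c1 (\<lambda>x. g x $ i) (\<lambda>x. H x $ i)) \<and> (\<forall>x. H x $ 1 $ 2 = H x $ 2 $ 1)"

lemma C1_c1: "C1 f \<Longrightarrow> c1 f (grad f)"
  unfolding C1_def c1_def
proof (intro conjI allI)
  fix x assume "f differentiable_on UNIV \<and> continuous_on UNIV (grad f)"
  then have "f differentiable (at x)" by (simp add: differentiable_on_def)
  then have d: "(f has_derivative frechet_derivative f (at x)) (at x)"
    by (simp add: frechet_derivative_works)
  then have lin: "linear (frechet_derivative f (at x))" by (rule has_derivative_linear)
  have "frechet_derivative f (at x) h = grad f x \<bullet> h" for h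
  proof -
    have "h = h $ 1 *\<^sub>R axis 1 1 + h $ 2 *\<^sub>R axis 2 1" by (simp add: vec2_eq_iff)
    then have "frechet_derivative f (at x) h = frechet_derivative f (at x) (h $ 1 *\<^sub>R axis 1 1 + h $ 2 *\<^sub>R axis 2 1)"
      by simp
    also have "\<dots> = h $ 1 * frechet_derivative f (at x) (axis 1 1) + h $ 2 * frechet_derivative f (at x) (axis 2 1)"
      by (simp only: linear_add[OF lin] linear_cmul[OF lin] real_scaleR_def)
    finally show ?thesis by (simp add: grad_def inner2 mult.commute)
  qed
  then have "frechet_derivative f (at x) = (\<bullet>) (grad f x)" by (rule ext)
  with d show "(f has_derivative (\<bullet>) (grad f x)) (at x)" by simp
qed auto

lemma C2_pot:
  assumes "C2 f" "periodic f"
  shows "pot (grad f) (hess f)"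
proof -
  have c: "c1 f (grad f)" using assms C1_c1 by (auto simp: C2_def)
  have H: "c1 (\<lambda>x. grad f x $ i) (\<lambda>x. hess f x $ i)" for i
    unfolding c1_def
  proof (intro conjI allI)
    fix x
    have "grad f differentiable (at x)" using assms by (auto simp: C2_def differentiable_on_def)
    then have "(grad f has_derivative (\<lambda>h. hess f x *v h)) (at x)"
      unfolding hess_def by (simp add: jacobian_works)
    then have "((\<lambda>x. grad f x $ i) has_derivative (\<lambda>h. (hess f x *v h) $ i)) (at x)"
      by (rule bounded_linear.has_derivative[OF bounded_linear_vec_nth])
    then show "((\<lambda>x. grad f x $ i) has_derivative (\<bullet>) (hess f x $ i)) (at x)"
      by (simp add: matrix_vector_mul_component)
    show "continuous_on UNIV (\<lambda>x. hess f x $ i)"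
      using assms by (intro continuous_intros) (auto simp: C2_def)
  qed
  show ?thesis
    unfolding pot_def using c1_periodic[OF c assms(2)] H hess_symmetric[OF c H] by blast
qed

lemma potD:
  assumes "pot g H"
  shows pot_periodic_g: "periodic g" and pot_c1: "c1 (\<lambda>x. g x $ i) (\<lambda>x. H x $ i)"
    and pot_sym: "H x $ i $ j = H x $ j $ i" and pot_cont: "continuous_on UNIV H"
    and pot_periodic: "periodic H"
proof -
  show *: "periodic g" "c1 (\<lambda>x. g x $ i) (\<lambda>x. H x $ i)" for i using assms by (auto simp: pot_def)
  show "H x $ i $ j = H x $ j $ i" using assms exhaust_2[of i] exhaust_2[of j] by (auto simp: pot_def)
  have "continuous_on UNIV (\<lambda>x. H x $ i)" for i using *(2) by (simp add: c1_def)
  then have "continuous_on UNIV (\<lambda>x. \<chi> i. H x $ i)" by (rule continuous_on_vec_lambda)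
  then show "continuous_on UNIV H" by simp
  have "periodic (\<lambda>x. H x $ i)" for i
    by (rule c1_periodic[OF *(2)]) (rule periodic_compose[OF *(1)])
  then show "periodic H" by (auto simp: periodic_def vec_eq_iff)
qed

lemma pot_entry_cont: "pot g H \<Longrightarrow> continuous_on UNIV (\<lambda>x. H x $ i $ j)"
  by (intro continuous_intros pot_cont)

lemma pot_entry_periodic: "pot g H \<Longrightarrow> periodic (\<lambda>x. H x $ i $ j)"
  by (rule periodic_compose[OF pot_periodic])

lemma pot_g_periodic: "pot g H \<Longrightarrow> periodic (\<lambda>x. g x $ i)"
  by (rule periodic_compose[OF pot_periodic_g])

lemma pot_integral_zero: "pot g H \<Longrightarrow> torus_integral (\<lambda>x. H x $ i $ j) = 0"
  using torus_integral_deriv_zero[OF pot_c1[where g=g and H=H and i=i] pot_g_periodic[where H=H], of "axis j 1"]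
  by (simp add: inner_axis)

text \<open>Polarised form of the fact that the Hessian determinant is a null Lagrangian. The energy
  identity, the vanishing mean of the determinant and the uniqueness proof all rest on it.\<close>

lemma pot_null:
  assumes "pot g H" "pot g' K"
  shows "torus_integral (\<lambda>x. H x $ i $ i * K x $ j $ j) = torus_integral (\<lambda>x. H x $ i $ j * K x $ i $ j)"
  using torus_null[OF pot_c1[OF assms(1), of i] pot_g_periodic[OF assms(1), of i]
      pot_c1[OF assms(2), of j] pot_g_periodic[OF assms(2), of j], of "axis i 1" "axis j 1"]
  by (simp add: inner_axis pot_sym[OF assms(2), of _ j i])

lemma pot_shift: "pot g H \<Longrightarrow> pot (\<lambda>x. g (x + a)) (\<lambda>x. H (x + a))"
  unfolding pot_def by (auto intro!: periodic_shift c1_shift)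

lemma pot_diff: "pot g H \<Longrightarrow> pot g' H' \<Longrightarrow> pot (\<lambda>x. g x - g' x) (\<lambda>x. H x - H' x)"
  unfolding pot_def by (auto intro!: periodic_compose2[where F="(-)"] simp: c1_diff)

section \<open>Energy identity for Hessian fields\<close>

definition tr2 :: "real^2^2 \<Rightarrow> real" where "tr2 A = A $ 1 $ 1 + A $ 2 $ 2"

lemma tr2_diff [simp]: "tr2 (A - B) = tr2 A - tr2 B" by (simp add: tr2_def)

definition sqn :: "real^2^2 \<Rightarrow> real" where
  "sqn A = (A $ 1 $ 1)\<^sup>2 + (A $ 1 $ 2)\<^sup>2 + (A $ 2 $ 1)\<^sup>2 + (A $ 2 $ 2)\<^sup>2"

text \<open>The square of the trace exceeds the squared Frobenius norm by twice the determinant,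
  whose integral vanishes. The constant 1 in this L^2 bound is what the contraction argument lives
  on.\<close>

lemma pot_energy:
  assumes "pot g H"
  shows "torus_integral (\<lambda>x. sqn (H x)) = torus_integral (\<lambda>x. (tr2 (H x))\<^sup>2)"
proof -
  note c = pot_entry_cont[OF assms]
  have *: "(tr2 (H x))\<^sup>2 = sqn (H x) + 2 * (H x $ 1 $ 1 * H x $ 2 $ 2 - H x $ 1 $ 2 * H x $ 1 $ 2)" for x
    by (simp add: tr2_def sqn_def power2_eq_square algebra_simps pot_sym[OF assms, of _ 2 1])
  have "torus_integral (\<lambda>x. H x $ 1 $ 1 * H x $ 2 $ 2 - H x $ 1 $ 2 * H x $ 1 $ 2) = 0"
    using pot_null[OF assms assms, of 1 2]
    by (subst torus_integral_diff) (auto intro!: continuous_intros c)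
  moreover have "torus_integral (\<lambda>x. (tr2 (H x))\<^sup>2) = torus_integral (\<lambda>x. sqn (H x)) +
     torus_integral (\<lambda>x. 2 * (H x $ 1 $ 1 * H x $ 2 $ 2 - H x $ 1 $ 2 * H x $ 1 $ 2))"
    unfolding * sqn_def by (rule torus_integral_add) (intro continuous_intros c)+
  ultimately show ?thesis by (simp only: torus_integral_cmult mult_zero_right add_0_right)
qed

lemma c1I:
  assumes "\<And>x. (p has_derivative D x) (at x)" "\<And>x h. D x h = P x \<bullet> h" "continuous_on UNIV P"
  shows "c1 p P"
proof -
  have "D x = (\<bullet>) (P x)" for x using assms(2) by (intro ext) simp
  then show ?thesis using assms by (simp add: c1_def)
qed

lemma abs_sq_le: "\<bar>x\<bar> \<le> c \<Longrightarrow> x\<^sup>2 \<le> (c::real)\<^sup>2"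
  using power_mono[of "\<bar>x\<bar>" c 2] by simp

section \<open>Multiscale averages and the estimates for the Laplacian\<close>

text \<open>For n \<ge> 2 the kink at 0 disappears, because the difference quotient there is at most
  |h|.\<close>

lemma max0_power_deriv:
  assumes "n \<ge> 2"
  shows "((\<lambda>s::real. max 0 s ^ n) has_real_derivative of_nat n * max 0 s ^ (n - 1)) (at s)"
proof -
  consider "s > 0" | "s < 0" | "s = 0" by linarith
  then show ?thesis
  proof cases
    case 1
    have "((\<lambda>s. s ^ n) has_real_derivative of_nat n * s ^ (n - 1)) (at s)"
      by (auto intro!: derivative_eq_intros)
    then have "((\<lambda>s. max 0 s ^ n) has_real_derivative of_nat n * s ^ (n - 1)) (at s)"
      by (rule has_field_derivative_transform_within_open[where S="{0<..}"]) (use 1 in auto)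
    with 1 show ?thesis by simp
  next
    case 2
    have "((\<lambda>s. 0) has_real_derivative 0) (at s)" by simp
    then have "((\<lambda>s. max 0 s ^ n) has_real_derivative 0) (at s)"
      by (rule has_field_derivative_transform_within_open[where S="{..<0}"]) (use 2 assms in auto)
    with 2 assms show ?thesis by (simp add: power_0_left)
  next
    case 3
    have "((\<lambda>h. (max 0 (0 + h) ^ n - max 0 0 ^ n) / h) \<longlongrightarrow> 0) (at (0::real))"
    proof (rule Lim_null_comparison)
      show "eventually (\<lambda>h. norm ((max 0 (0 + h) ^ n - max 0 0 ^ n) / h) \<le> \<bar>h\<bar>) (at (0::real))"
        unfolding eventually_at
      proof (intro exI[of _ 1] conjI ballI impI)
        fix h :: real assume h: "h \<noteq> 0 \<and> dist h 0 < 1"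
        have "max 0 h ^ n \<le> \<bar>h\<bar> ^ n" by (rule power_mono) auto
        also have "\<dots> \<le> \<bar>h\<bar> ^ 2" using h assms by (intro power_decreasing) auto
        finally have "max 0 h ^ n \<le> \<bar>h\<bar> * \<bar>h\<bar>" by (simp add: power2_eq_square)
        then show "norm ((max 0 (0 + h) ^ n - max 0 0 ^ n) / h) \<le> \<bar>h\<bar>"
          using h assms by (simp add: abs_divide field_simps power_0_left)
      qed simp
      show "((\<lambda>h. \<bar>h\<bar>) \<longlongrightarrow> 0) (at (0::real))" by (rule tendsto_eq_intros | simp)+
    qed
    with 3 assms show ?thesis by (simp add: DERIV_def power_0_left)
  qed
qed

text \<open>Powers of (1 - |z|^2)_+ have explicit polynomial derivatives inside the ball and enough
  smoothness across its boundary, so they replace smooth cut-off functions.\<close>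

definition bump :: "nat \<Rightarrow> real^2 \<Rightarrow> real" where "bump n z = max 0 (1 - z \<bullet> z) ^ n"

lemma bump_zero: "norm z \<ge> 1 \<Longrightarrow> n > 0 \<Longrightarrow> bump n z = 0"
proof -
  assume "norm z \<ge> 1" "n > 0"
  then have "z \<bullet> z \<ge> 1" by (metis norm_eq_sqrt_inner real_sqrt_ge_1_iff)
  then show ?thesis using \<open>n > 0\<close> by (simp add: bump_def)
qed

lemma bump_bounds: "0 \<le> bump n z" "bump n z \<le> 1"
  unfolding bump_def by (auto intro!: power_le_one)


lemma c1_bump:
  assumes "n \<ge> 2"
  shows "c1 (bump n) (\<lambda>z. (- 2 * real n * bump (n - 1) z) *\<^sub>R z)"
proof (rule c1I)
  fix z :: "real^2"
  have *: "((\<lambda>z. 1 - z \<bullet> z) has_derivative (\<lambda>h. - 2 * (z \<bullet> h))) (at z)"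
    by (auto intro!: derivative_eq_intros simp: inner_commute)
  have "((\<lambda>s::real. max 0 s ^ n) has_derivative (\<lambda>h. (of_nat n * max 0 (1 - z \<bullet> z) ^ (n - 1)) * h)) (at (1 - z \<bullet> z))"
    using max0_power_deriv[OF assms, of "1 - z \<bullet> z"] by (simp add: has_field_derivative_def)
  from has_derivative_compose[OF * this]
  show "(bump n has_derivative (\<lambda>h. of_nat n * max 0 (1 - z \<bullet> z) ^ (n - 1) * (- 2 * (z \<bullet> h)))) (at z)"
    by (simp add: bump_def[abs_def])
qed (auto simp: bump_def intro!: continuous_intros)

lemma c1_mult:
  assumes "c1 p P" "c1 q Q"
  shows "c1 (\<lambda>x. p x * q x) (\<lambda>x. p x *\<^sub>R Q x + q x *\<^sub>R P x)"
  using assms c1_cont[OF assms(1)] c1_cont[OF assms(2)] unfolding c1_def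
  by (auto simp: inner_add_left algebra_simps intro!: derivative_eq_intros continuous_intros)

lemma c1_cmult: "c1 p P \<Longrightarrow> c1 (\<lambda>x. c * p x) (\<lambda>x. c *\<^sub>R P x)"
  unfolding c1_def by (auto intro!: derivative_eq_intros continuous_intros)

lemma c1_add: "c1 p P \<Longrightarrow> c1 q Q \<Longrightarrow> c1 (\<lambda>x. p x + q x) (\<lambda>x. P x + Q x)"
  unfolding c1_def by (auto simp: inner_add_left intro!: derivative_eq_intros continuous_intros)

lemma c1_nth: "c1 (\<lambda>z. z $ i) (\<lambda>z. axis i 1)"
proof (rule c1I)
  fix x :: "real^2"
  show "((\<lambda>z::real^2. z $ i) has_derivative (\<lambda>z. z $ i)) (at x)"
    by (rule bounded_linear.has_derivative[OF bounded_linear_vec_nth has_derivative_ident])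
qed (auto simp: inner_axis')

lemma c1_affine:
  assumes "c1 w W" shows "c1 (\<lambda>z. w (x + r *\<^sub>R z)) (\<lambda>z. r *\<^sub>R W (x + r *\<^sub>R z))"
proof (rule c1I)
  fix z
  show "((\<lambda>z. w (x + r *\<^sub>R z)) has_derivative (\<lambda>h. W (x + r *\<^sub>R z) \<bullet> (r *\<^sub>R h))) (at z)"
    by (rule has_derivative_compose[where f="\<lambda>z. x + r *\<^sub>R z" and g=w])
      (use assms in \<open>auto simp: c1_def intro!: derivative_eq_intros\<close>)
  show "continuous_on UNIV (\<lambda>z. r *\<^sub>R W (x + r *\<^sub>R z))"
    using assms by (auto simp: c1_def intro!: continuous_intros cont_shift[of W])
qed simp

text \<open>
  The kernels below live in the unit ball; the box leaves room for translating them by vectors of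
  length at most one, and \<open>x + r QB\<close> fits into a period cell for \<open>r \<le> 1/6\<close>.
\<close>

abbreviation QB :: "(real^2) set" where "QB \<equiv> cbox (vec (-3)) (vec 3)"

lemma QB_norm: "z \<in> QB \<Longrightarrow> norm z \<le> 5"
proof -
  assume "z \<in> QB"
  then have "\<bar>z $ 1\<bar> \<le> 3" "\<bar>z $ 2\<bar> \<le> 3" by (auto simp: mem_box_cart abs_le_iff forall_2)
  then have "(z $ 1)\<^sup>2 \<le> 3\<^sup>2" "(z $ 2)\<^sup>2 \<le> 3\<^sup>2" by (simp_all only: abs_sq_le)
  then have "z \<bullet> z \<le> 5\<^sup>2" by (simp add: inner2 power2_eq_square)
  then show ?thesis by (simp add: norm_le_square)
qed

lemma QB_content: "measure lborel QB = 36"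
proof -
  have "(0::real^2) \<in> QB" by (simp add: mem_box_cart)
  then show ?thesis by (subst content_cbox_if_cart) (auto simp: prod_2 UNIV_2)
qed

text \<open>Both sides equal the integral over the whole plane: the support has radius 2, the shift
  has length at most 1, and the box has half-width 3.\<close>

lemma supp_integral:
  fixes F :: "real^2 \<Rightarrow> real"
  assumes F: "\<And>z. norm z \<ge> 2 \<Longrightarrow> F z = 0" and c: "norm c \<le> 1"
  shows "integral QB (\<lambda>z. F (z + c)) = integral QB F"
proof -
  have *: "integral (cbox (vec (-3) + c) (vec 3 + c)) F = integral UNIV F" if c: "norm c \<le> 1" for c
  proof -
    have "F z = 0" if "z \<notin> cbox (vec (-3) + c) (vec 3 + c)" for z
    proof (rule F, rule ccontr)
      assume n: "\<not> 2 \<le> norm z"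
      have "\<bar>z $ i\<bar> \<le> 2" "\<bar>c $ i\<bar> \<le> 1" for i
        using component_le_norm_cart[of z i] component_le_norm_cart[of c i] n c by auto
      then have "-3 + c $ i \<le> z $ i \<and> z $ i \<le> 3 + c $ i" for i
        by (smt (verit))
      then have "z \<in> cbox (vec (-3) + c) (vec 3 + c)" by (simp add: mem_box_cart)
      with that show False by simp
    qed
    then have "(\<lambda>x. if x \<in> cbox (vec (-3) + c) (vec 3 + c) then F x else 0) = F" by auto
    then show ?thesis using integral_restrict_UNIV[of "cbox (vec (-3) + c) (vec 3 + c)" F] by simp
  qed
  have "integral QB (\<lambda>z. F (z + c)) = integral (cbox (vec (-3) + c) (vec 3 + c)) F"
    using integral_shift_cbox_plus[of "vec (-3)" "vec 3" F c] by (simp add: o_def add.commute)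
  with *[OF c] *[of 0] show ?thesis by simp
qed

lemma supp_deriv_integral:
  assumes F: "c1 F D" "\<And>z. norm z \<ge> 2 \<Longrightarrow> F z = 0" and v: "norm v \<le> 1"
  shows "integral QB (\<lambda>z. D z \<bullet> v) = 0"
proof -
  have cD: "continuous_on UNIV D" using F by (simp add: c1_def)
  have "((\<lambda>s. integral QB (\<lambda>z. F (z + s *\<^sub>R v))) has_real_derivative
           integral QB (\<lambda>z. D (z + 0 *\<^sub>R v) \<bullet> v)) (at 0 within UNIV)"
  proof (rule leibniz_rule_field_derivative[where fx="\<lambda>s z. D (z + s *\<^sub>R v) \<bullet> v"])
    show "((\<lambda>s. F (z + s *\<^sub>R v)) has_real_derivative D (z + s *\<^sub>R v) \<bullet> v) (at s within UNIV)" for s z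
      by (rule c1_line[OF F(1)])
    show "continuous_on (UNIV \<times> QB) (\<lambda>(s, z). D (z + s *\<^sub>R v) \<bullet> v)"
      unfolding split_beta by (intro continuous_intros cont_shift[OF cD])
    show "(\<lambda>z. F (z + s *\<^sub>R v)) integrable_on QB" for s
      by (intro integrable_cont continuous_intros cont_shift[OF c1_cont[OF F(1)]])
  qed auto
  then have "((\<lambda>s. integral QB (\<lambda>z. F (z + s *\<^sub>R v))) has_real_derivative integral QB (\<lambda>z. D z \<bullet> v)) (at 0)"
    by simp
  \<comment> \<open>For |s| < 1 the translated support stays inside the box, so the integral is
    constant near s = 0.\<close>
  then have "((\<lambda>s. integral QB F) has_real_derivative integral QB (\<lambda>z. D z \<bullet> v)) (at 0)"
  proof (rule has_field_derivative_transform_within_open[where S="{-1<..<1}"])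
    fix s :: real assume s: "s \<in> {-1<..<1}"
    have "norm (s *\<^sub>R v) \<le> 1 * 1" unfolding norm_scaleR by (rule mult_mono) (use s v in auto)
    then show "integral QB (\<lambda>z. F (z + s *\<^sub>R v)) = integral QB F"
      by (intro supp_integral F) auto
  qed auto
  then show ?thesis using DERIV_unique DERIV_const by blast
qed

lemma integral_by_parts:
  assumes \<zeta>: "c1 \<zeta> Z" "\<And>z. norm z \<ge> 1 \<Longrightarrow> \<zeta> z = 0" and w: "c1 w W" and v: "norm v \<le> 1"
  shows "r * integral QB (\<lambda>z. \<zeta> z * (W (x + r *\<^sub>R z) \<bullet> v)) = - integral QB (\<lambda>z. (Z z \<bullet> v) * w (x + r *\<^sub>R z))"
proof -
  have cZ: "continuous_on UNIV Z" and cW: "continuous_on UNIV W" using \<zeta> w by (auto simp: c1_def)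
  have "integral QB (\<lambda>z. (\<zeta> z *\<^sub>R (r *\<^sub>R W (x + r *\<^sub>R z)) + w (x + r *\<^sub>R z) *\<^sub>R Z z) \<bullet> v) = 0"
    by (rule supp_deriv_integral[OF c1_mult[OF \<zeta>(1) c1_affine[OF w]] _ v]) (simp add: \<zeta>(2))
  also have "(\<lambda>z. (\<zeta> z *\<^sub>R (r *\<^sub>R W (x + r *\<^sub>R z)) + w (x + r *\<^sub>R z) *\<^sub>R Z z) \<bullet> v)
     = (\<lambda>z. r * (\<zeta> z * (W (x + r *\<^sub>R z) \<bullet> v)) + (Z z \<bullet> v) * w (x + r *\<^sub>R z))"
    by (simp add: inner_add_left algebra_simps)
  also have "integral QB \<dots> = integral QB (\<lambda>z. r * (\<zeta> z * (W (x + r *\<^sub>R z) \<bullet> v)))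
       + integral QB (\<lambda>z. (Z z \<bullet> v) * w (x + r *\<^sub>R z))"
    by (intro integral_add integrable_cont continuous_intros c1_cont[OF \<zeta>(1)] cont_shift[OF cW] cZ cont_shift[OF c1_cont[OF w]])
  finally show ?thesis by simp
qed

text \<open>An average of \<open>q\<close> at scale \<open>r\<close> around \<open>x\<close>, not
  normalised by the integral of the kernel. At r = 0 it degenerates to a multiple of
  \<open>q x\<close>, which is how pointwise values are recovered.\<close>

definition conv :: "(real^2 \<Rightarrow> real) \<Rightarrow> (real^2 \<Rightarrow> real) \<Rightarrow> real \<Rightarrow> real^2 \<Rightarrow> real" where
  "conv \<zeta> q r x = integral QB (\<lambda>z. \<zeta> z * q (x + r *\<^sub>R z))"

definition delta :: "2 \<Rightarrow> 2 \<Rightarrow> real" where "delta i j = (if i = j then 1 else 0)"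

text \<open>
  With \<open>\<Theta> = (1 - |z|^2)_+^4\<close>: \<open>avk z * z_k = - \<partial>_k \<Theta>\<close> and \<open>czk i j = \<partial>_i \<partial>_j \<Theta>\<close>. Differentiating the averages
  of \<open>H_ij\<close> against \<open>avk\<close> in the scale \<open>r\<close> therefore produces \<open>czk i j\<close> applied to the trace of \<open>H\<close>
  (lemma \<open>conv_deriv\<close>), which replaces the singular integral representation of \<open>D^2 \<Delta>^{-1}\<close>.
\<close>

definition avk :: "real^2 \<Rightarrow> real" where "avk z = 8 * bump 3 z"
definition czk :: "2 \<Rightarrow> 2 \<Rightarrow> real^2 \<Rightarrow> real" where
  "czk i j z = 48 * (z $ i * z $ j * bump 2 z) - 8 * delta i j * bump 3 z"

definition avk' :: "real^2 \<Rightarrow> real^2" where "avk' z = (- 48 * bump 2 z) *\<^sub>R z"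
text \<open>These are third derivatives of (1 - |z|^2)_+^4, hence symmetric in all three indices,
  and \<open>conv_deriv\<close> exchanges indices through that symmetry. The power 4 leaves
  \<open>bump 2\<close> in \<open>czk\<close>, the least power to which \<open>c1_bump\<close>
  applies.\<close>

definition czk' :: "2 \<Rightarrow> 2 \<Rightarrow> real^2 \<Rightarrow> real^2" where
  "czk' i j z = (\<chi> k. - 192 * (z $ i * z $ j * z $ k * bump 1 z)
      + 48 * ((delta i k * z $ j + delta j k * z $ i + delta i j * z $ k) * bump 2 z))"

lemma c1_avk: "c1 avk avk'"
proof -
  have "c1 avk (\<lambda>z. 8 *\<^sub>R ((- 2 * real 3 * bump (3 - 1) z) *\<^sub>R z))"
    unfolding avk_def[abs_def] by (intro c1_cmult c1_bump) simp
  moreover have "(\<lambda>z. 8 *\<^sub>R ((- 2 * real 3 * bump (3 - 1) z) *\<^sub>R z)) = avk'"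
    by (simp add: avk'_def fun_eq_iff)
  ultimately show ?thesis by simp
qed

lemma c1_czk: "c1 (czk i j) (czk' i j)"
proof -
  have "c1 (\<lambda>z. 48 * ((z $ i * z $ j) * bump 2 z) - (8 * delta i j) * bump 3 z)
     (\<lambda>z. 48 *\<^sub>R ((z $ i * z $ j) *\<^sub>R ((- 2 * real 2 * bump (2 - 1) z) *\<^sub>R z)
        + bump 2 z *\<^sub>R (z $ i *\<^sub>R axis j 1 + z $ j *\<^sub>R axis i 1))
        - (8 * delta i j) *\<^sub>R ((- 2 * real 3 * bump (3 - 1) z) *\<^sub>R z))"
    by (intro c1_diff c1_cmult c1_mult c1_bump c1_nth) auto
  moreover have "(\<lambda>z. 48 *\<^sub>R ((z $ i * z $ j) *\<^sub>R ((- 2 * real 2 * bump (2 - 1) z) *\<^sub>R z)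
        + bump 2 z *\<^sub>R (z $ i *\<^sub>R axis j 1 + z $ j *\<^sub>R axis i 1))
        - (8 * delta i j) *\<^sub>R ((- 2 * real 3 * bump (3 - 1) z) *\<^sub>R z)) = czk' i j"
    by (auto simp: czk'_def fun_eq_iff vec_eq_iff axis_def delta_def algebra_simps)
  ultimately show ?thesis by (simp add: czk_def[abs_def] mult.assoc)
qed

text \<open>\<open>czk i j\<close> is the derivative in direction \<open>i\<close> of the compactly
  supported function -8 z_j (1 - |z|^2)_+^3.\<close>

lemma czk_mean: "integral QB (czk i j) = 0"
proof -
  have "c1 (\<lambda>z. z $ j * bump 3 z)
     (\<lambda>z. z $ j *\<^sub>R ((- 2 * real 3 * bump (3 - 1) z) *\<^sub>R z) + bump 3 z *\<^sub>R axis j 1)"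
    by (intro c1_mult c1_bump c1_nth) auto
  then have c: "c1 (\<lambda>z. - 8 * (z $ j * bump 3 z))
     (\<lambda>z. - 8 *\<^sub>R (z $ j *\<^sub>R ((- 2 * real 3 * bump (3 - 1) z) *\<^sub>R z) + bump 3 z *\<^sub>R axis j 1))"
    by (rule c1_cmult)
  have "integral QB (\<lambda>z. (- 8 *\<^sub>R (z $ j *\<^sub>R ((- 2 * real 3 * bump (3 - 1) z) *\<^sub>R z) + bump 3 z *\<^sub>R axis j 1)) \<bullet> axis i 1) = 0"
    by (rule supp_deriv_integral[OF c]) (auto simp: bump_zero)
  also have "(\<lambda>z. (- 8 *\<^sub>R (z $ j *\<^sub>R ((- 2 * real 3 * bump (3 - 1) z) *\<^sub>R z) + bump 3 z *\<^sub>R axis j 1)) \<bullet> axis i 1) = czk i j"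
    unfolding inner_axis by (auto simp: czk_def fun_eq_iff delta_def axis_def algebra_simps)
  finally show ?thesis .
qed

lemma kernel_supp: "norm z \<ge> 1 \<Longrightarrow> avk z = 0" "norm z \<ge> 1 \<Longrightarrow> czk i j z = 0"
  by (auto simp: avk_def czk_def bump_zero)

lemma avk_bound: "\<bar>avk z\<bar> \<le> 8" "0 \<le> avk z"
  using bump_bounds[of 3 z] by (auto simp: avk_def)

lemma czk_bound: "\<bar>czk i j z\<bar> \<le> 56"
proof (cases "norm z \<ge> 1")
  case False
  have c: "\<bar>z $ k\<bar> \<le> 1" for k using component_le_norm_cart[of z k] False by linarith
  have "\<bar>z $ i * z $ j * bump 2 z\<bar> \<le> 1 * 1 * 1"
    unfolding abs_mult using c bump_bounds[of 2 z] by (intro mult_mono) auto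
  moreover have "\<bar>delta i j * bump 3 z\<bar> \<le> 1"
    using bump_bounds[of 3 z] by (auto simp: delta_def)
  ultimately show ?thesis unfolding czk_def by linarith
qed (simp add: kernel_supp)

lemma c1_lipschitz:
  assumes "c1 p P" "\<And>z. norm (P z) \<le> L"
  shows "\<bar>p x - p y\<bar> \<le> L * norm (x - y)"
proof -
  obtain s where "p (y + (x - y)) - p y = P (y + s *\<^sub>R (x - y)) \<bullet> (x - y)"
    using c1_mean_value[OF assms(1)] by blast
  then have "\<bar>p x - p y\<bar> \<le> norm (P (y + s *\<^sub>R (x - y))) * norm (x - y)"
    using Cauchy_Schwarz_ineq2[of "P (y + s *\<^sub>R (x - y))" "x - y"] by simp
  also have "\<dots> \<le> L * norm (x - y)" by (intro mult_right_mono assms) auto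
  finally show ?thesis .
qed

lemma norm_le_comps: "(\<And>k. \<bar>(v::real^2) $ k\<bar> \<le> c) \<Longrightarrow> norm v \<le> 2 * c"
proof -
  assume "\<And>k. \<bar>v $ k\<bar> \<le> c"
  from this[of 1] this[of 2] show ?thesis using norm_le_l1_cart[of v] by (simp add: sum_2)
qed

text \<open>Both gradients are bounded by 672 = 2 (192 + 3 * 48); the factor 2 passes from
  components to the Euclidean norm.\<close>

lemma kernel_lipschitz:
  "\<bar>avk x - avk y\<bar> \<le> 672 * norm (x - y)" "\<bar>czk i j x - czk i j y\<bar> \<le> 672 * norm (x - y)"
proof -
  have bz: "bump 1 z = 0" "bump 2 z = 0" if "norm z \<ge> 1" for z
    using that by (auto simp: bump_zero)
  have m: "\<bar>z $ a * z $ b * z $ c * bump 1 z\<bar> \<le> 1" for a b c z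
  proof (cases "norm z \<ge> 1")
    case False
    have "\<bar>z $ k\<bar> \<le> 1" for k using component_le_norm_cart[of z k] False by linarith
    then have "\<bar>z $ a * z $ b * z $ c * bump 1 z\<bar> \<le> 1 * 1 * 1 * 1"
      unfolding abs_mult using bump_bounds[of 1 z] by (intro mult_mono) auto
    then show ?thesis by simp
  qed (simp add: bz del: One_nat_def)
  have m2: "\<bar>z $ a * bump 2 z\<bar> \<le> 1" for a z
  proof (cases "norm z \<ge> 1")
    case False
    have "\<bar>z $ k\<bar> \<le> 1" for k using component_le_norm_cart[of z k] False by linarith
    then have "\<bar>z $ a * bump 2 z\<bar> \<le> 1 * 1"
      unfolding abs_mult using bump_bounds[of 2 z] by (intro mult_mono) auto
    then show ?thesis by simp
  qed (simp add: bz)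
  have d: "\<bar>delta a b * s\<bar> \<le> 1" if "\<bar>s\<bar> \<le> 1" for a b s using that by (auto simp: delta_def)
  have "norm (avk' z) \<le> 2 * 48" for z
    by (rule norm_le_comps) (use m2[of z] in \<open>auto simp: avk'_def mult.assoc mult.commute[of "bump 2 z"] abs_mult\<close>)
  then have "norm (avk' z) \<le> 672" for z by (rule order_trans) simp
  then show "\<bar>avk x - avk y\<bar> \<le> 672 * norm (x - y)" by (rule c1_lipschitz[OF c1_avk])
  have "\<bar>czk' i j z $ k\<bar> \<le> 336" for z k
  proof -
    have "czk' i j z $ k = - 192 * (z $ i * z $ j * z $ k * bump 1 z)
      + 48 * (delta i k * (z $ j * bump 2 z) + delta j k * (z $ i * bump 2 z) + delta i j * (z $ k * bump 2 z))"
      by (simp add: czk'_def algebra_simps)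
    moreover note m[of z i j k] d[OF m2[of z j], of i k] d[OF m2[of z i], of j k] d[OF m2[of z k], of i j]
    moreover have "\<bar>- 192 * a + 48 * (b + c + d)\<bar> \<le> 336"
      if "\<bar>a\<bar> \<le> 1" "\<bar>b\<bar> \<le> 1" "\<bar>c\<bar> \<le> 1" "\<bar>d\<bar> \<le> 1" for a b c d :: real proof -
      have "a \<le> 1" "- 1 \<le> a" "b \<le> 1" "- 1 \<le> b" "c \<le> 1" "- 1 \<le> c" "d \<le> 1" "- 1 \<le> d" using that by auto
      then show ?thesis unfolding abs_le_iff distrib_left by (intro conjI) linarith+
    qed
    ultimately show ?thesis by metis
  qed
  then have "norm (czk' i j z) \<le> 2 * 336" for z by (rule norm_le_comps)
  then show "\<bar>czk i j x - czk i j y\<bar> \<le> 672 * norm (x - y)"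
    by (intro c1_lipschitz[OF c1_czk]) simp
qed

lemma avk_cont: "continuous_on S avk" and czk_cont: "continuous_on S (czk i j)"
  using c1_cont[OF c1_avk] c1_cont[OF c1_czk[of i j]] by (auto intro: continuous_on_subset)

definition mass :: real where "mass = integral QB avk"

text \<open>On the centred unit square |z|^2 \<le> 1/2, hence \<open>avk\<close> \<ge> 8 (1/2)^3 = 1
  there.\<close>

lemma mass_ge: "mass \<ge> 1"
proof -
  let ?S = "cbox (vec (-1/2)) (vec (1/2)) :: (real^2) set"
  have "(0::real^2) \<in> ?S" by (simp add: mem_box_cart)
  then have c: "measure lborel ?S = 1" by (subst content_cbox_if_cart) (auto simp: prod_2 UNIV_2)
  have "1 \<le> avk z" if "z \<in> ?S" for z
  proof -
    have "\<bar>z $ 1\<bar> \<le> 1/2" "\<bar>z $ 2\<bar> \<le> 1/2" using that by (auto simp: mem_box_cart abs_le_iff forall_2)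
    then have "(z $ 1)\<^sup>2 \<le> (1/2)\<^sup>2" "(z $ 2)\<^sup>2 \<le> (1/2)\<^sup>2" by (simp_all only: abs_sq_le)
    then have "z \<bullet> z \<le> 1/2" by (simp add: inner2 power2_eq_square)
    then have "(1/2) ^ 3 \<le> max 0 (1 - z \<bullet> z) ^ 3" by (intro power_mono) auto
    then show ?thesis by (simp add: avk_def bump_def power3_eq_cube)
  qed
  then have "integral ?S (\<lambda>z. 1) \<le> integral ?S avk"
    by (intro integral_le integrable_cont avk_cont) auto
  also have "\<dots> \<le> integral QB avk"
  proof (rule integral_subset_le)
    show "?S \<subseteq> QB"
      unfolding subset_iff mem_box_cart
    proof (intro allI impI)
      fix t :: "real^2" and i assume "\<forall>i. vec (- 1 / 2) $ i \<le> t $ i \<and> t $ i \<le> vec (1 / 2) $ i"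
      then have "- 1 / 2 \<le> t $ i \<and> t $ i \<le> 1 / 2" by (metis vec_component)
      then show "vec (- 3) $ i \<le> t $ i \<and> t $ i \<le> vec 3 $ i" by simp
    qed
  qed (auto simp: avk_bound intro!: integrable_cont avk_cont)
  finally show ?thesis using c by (simp add: mass_def)
qed

text \<open>\<open>H\<close> is only continuous, so the scale cannot be differentiated under the
  integral directly. One integration by parts first replaces \<open>H\<close> by the differentiable
  field \<open>g\<close>; after differentiation the terms with \<open>avk\<close> cancel, and
  further integrations by parts turn the rest into \<open>czk i j\<close> acting on the
  trace.\<close>

lemma conv_deriv:
  assumes p: "pot g H" and r: "r > 0"
  shows "((\<lambda>r. conv avk (\<lambda>y. H y $ i $ j) r x) has_real_derivative
     (1 / r) * conv (czk i j) (\<lambda>y. tr2 (H y)) r x) (at r)"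
proof -
  note cH = pot_entry_cont[OF p]
  have ie: "v \<bullet> axis k 1 = v $ k" for v :: "real^2" and k by (simp add: inner_axis)
  have cg: "continuous_on UNIV (\<lambda>y. g y $ k)" for k by (rule c1_cont[OF pot_c1[OF p]])
  have ca: "continuous_on UNIV avk'" using c1_avk by (simp add: c1_def)
  have nv: "norm (axis k 1 :: real^2) \<le> 1" for k by simp
  define N where "N r = integral QB (\<lambda>z. avk' z $ j * g (x + r *\<^sub>R z) $ i)" for r
  define N' where "N' = integral QB (\<lambda>z. avk' z $ j * (H (x + r *\<^sub>R z) $ i \<bullet> z))"
  have 1: "s * conv avk (\<lambda>y. H y $ i $ j) s x = - N s" for s
    unfolding conv_def N_def
    using integral_by_parts[OF c1_avk kernel_supp(1) pot_c1[OF p, of i] nv[of j], of s x] by (simp add: ie)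
  have dN: "(N has_real_derivative N') (at r)"
  proof -
    have "((\<lambda>r. integral QB (\<lambda>z. avk' z $ j * g (x + r *\<^sub>R z) $ i)) has_real_derivative
       integral QB (\<lambda>z. avk' z $ j * (H (x + r *\<^sub>R z) $ i \<bullet> z))) (at r within UNIV)"
    proof (rule leibniz_rule_field_derivative[where fx="\<lambda>r z. avk' z $ j * (H (x + r *\<^sub>R z) $ i \<bullet> z)"])
      show "((\<lambda>r. avk' z $ j * g (x + r *\<^sub>R z) $ i) has_real_derivative avk' z $ j * (H (x + s *\<^sub>R z) $ i \<bullet> z)) (at s within UNIV)" for s z
        by (intro DERIV_cmult c1_line pot_c1[OF p])
      show "continuous_on (UNIV \<times> QB) (\<lambda>(r, z). avk' z $ j * (H (x + r *\<^sub>R z) $ i \<bullet> z))"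
        unfolding split_beta by (intro continuous_intros cont_shift[OF ca] cont_shift[OF pot_cont[OF p]])
      show "(\<lambda>z. avk' z $ j * g (x + s *\<^sub>R z) $ i) integrable_on QB" for s
        by (intro integrable_cont continuous_intros ca cont_shift[OF cg])
    qed auto
    then show ?thesis by (simp add: N_def[abs_def] N'_def)
  qed
  \<comment> \<open>A derivative is moved onto the kernel and back under another index: entry (i, k)
    against \<open>czk j k\<close> becomes entry (k, k) against \<open>czk i j\<close>. Summation
    over \<open>k\<close> produces the trace.\<close>
  have sw: "conv (czk j k) (\<lambda>y. H y $ i $ k) r x = conv (czk i j) (\<lambda>y. H y $ k $ k) r x" for k
  proof -
    have "r * conv (czk j k) (\<lambda>y. H y $ i $ k) r x = - integral QB (\<lambda>z. czk' j k z $ i * g (x + r *\<^sub>R z) $ k)"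
      unfolding conv_def
      using integral_by_parts[OF c1_czk[of j k] kernel_supp(2) pot_c1[OF p, of k] nv[of i], of r x]
      by (simp add: ie pot_sym[OF p, of _ i k])
    moreover have "r * conv (czk i j) (\<lambda>y. H y $ k $ k) r x = - integral QB (\<lambda>z. czk' i j z $ k * g (x + r *\<^sub>R z) $ k)"
      unfolding conv_def
      using integral_by_parts[OF c1_czk[of i j] kernel_supp(2) pot_c1[OF p, of k] nv[of k], of r x]
      by (simp add: ie)
    moreover have "czk' j k z $ i = czk' i j z $ k" for z
      by (auto simp: czk'_def delta_def algebra_simps)
    ultimately have "r * conv (czk j k) (\<lambda>y. H y $ i $ k) r x = r * conv (czk i j) (\<lambda>y. H y $ k $ k) r x" by simp
    with r show ?thesis by simp
  qed
  have cc: "continuous_on UNIV (\<lambda>z. czk a b z * H (x + r *\<^sub>R z) $ c $ d)" "continuous_on UNIV (\<lambda>z. avk z * H (x + r *\<^sub>R z) $ c $ d)" for a b c d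
    by (intro continuous_intros czk_cont avk_cont cont_shift[OF pot_cont[OF p]])+
  \<comment> \<open>The kernel identity behind this is - (avk')_j z_k = \<open>czk j k\<close> +
    \<open>delta j k\<close> \<open>avk\<close>.\<close>
  have "- N' = integral QB (\<lambda>z. (czk j 1 z * H (x + r *\<^sub>R z) $ i $ 1 + czk j 2 z * H (x + r *\<^sub>R z) $ i $ 2)
        + avk z * H (x + r *\<^sub>R z) $ i $ j)"
    unfolding N'_def
  proof (subst integral_neg[symmetric], rule arg_cong[where f="integral QB"], rule ext)
    fix z
    show "- (avk' z $ j * (H (x + r *\<^sub>R z) $ i \<bullet> z)) = (czk j 1 z * H (x + r *\<^sub>R z) $ i $ 1 + czk j 2 z * H (x + r *\<^sub>R z) $ i $ 2)
        + avk z * H (x + r *\<^sub>R z) $ i $ j"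
      using exhaust_2[of j] by (auto simp: avk'_def avk_def czk_def delta_def inner2 algebra_simps)
  qed
  also have "\<dots> = conv (czk j 1) (\<lambda>y. H y $ i $ 1) r x + conv (czk j 2) (\<lambda>y. H y $ i $ 2) r x
      + conv avk (\<lambda>y. H y $ i $ j) r x"
    unfolding conv_def
    by (subst integral_add[symmetric]; (intro integrable_cont continuous_on_add cc)?)+ simp
  also have "conv (czk j 1) (\<lambda>y. H y $ i $ 1) r x + conv (czk j 2) (\<lambda>y. H y $ i $ 2) r x = conv (czk i j) (\<lambda>y. tr2 (H y)) r x"
    unfolding sw unfolding conv_def tr2_def
    by (subst integral_add[symmetric]; (intro integrable_cont cc)?) (simp add: algebra_simps)
  finally have 2: "- N' = conv (czk i j) (\<lambda>y. tr2 (H y)) r x + conv avk (\<lambda>y. H y $ i $ j) r x" .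
  have "((\<lambda>s. - N s / s) has_real_derivative (- N' * r - (- N r) * 1) / (r * r)) (at r)"
    by (rule DERIV_divide[OF DERIV_minus[OF dN] DERIV_ident]) (use r in simp)
  also have "(- N' * r - (- N r) * 1) / (r * r) = (1 / r) * conv (czk i j) (\<lambda>y. tr2 (H y)) r x"
  proof -
    have n1: "N r = - (r * conv avk (\<lambda>y. H y $ i $ j) r x)" using 1[of r] by simp
    have n2: "N' = - (conv (czk i j) (\<lambda>y. tr2 (H y)) r x + conv avk (\<lambda>y. H y $ i $ j) r x)" using 2 by simp
    have "- N' * r - (- N r) * 1 = r * conv (czk i j) (\<lambda>y. tr2 (H y)) r x"
      unfolding n1 n2 by (simp add: algebra_simps)
    then show ?thesis using r by simp
  qed
  finally have "((\<lambda>s. - N s / s) has_real_derivative (1 / r) * conv (czk i j) (\<lambda>y. tr2 (H y)) r x) (at r)" .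
  then show ?thesis
    by (rule has_field_derivative_transform_within_open[where S="{0<..}"])
      (use r 1 in \<open>auto simp: field_simps\<close>)
qed

lemma conv_cont_r:
  assumes "continuous_on UNIV \<zeta>" "continuous_on UNIV q"
  shows "continuous_on S (\<lambda>r. conv \<zeta> q r x)"
proof -
  have "continuous_on UNIV (\<lambda>r. integral QB (\<lambda>z. \<zeta> z * q (x + r *\<^sub>R z)))"
    by (rule integral_continuous_on_param)
      (auto simp: split_beta intro!: continuous_intros cont_shift[OF assms(1)] cont_shift[OF assms(2)])
  then show ?thesis unfolding conv_def[abs_def] by (rule continuous_on_subset) simp
qed

lemma conv_zero: "conv avk q 0 x = mass * q x"
  by (simp add: conv_def mass_def)

lemma conv_bound_L1:
  assumes \<zeta>: "continuous_on UNIV \<zeta>" "\<And>z. \<bar>\<zeta> z\<bar> \<le> b" and q: "continuous_on UNIV q"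
  shows "\<bar>conv \<zeta> q r x\<bar> \<le> b * integral QB (\<lambda>z. \<bar>q (x + r *\<^sub>R z)\<bar>)"
proof -
  have "\<bar>conv \<zeta> q r x\<bar> \<le> integral QB (\<lambda>z. b * \<bar>q (x + r *\<^sub>R z)\<bar>)"
    unfolding conv_def real_norm_def[symmetric]
    by (rule integral_norm_bound_integral)
      (auto simp: abs_mult intro!: integrable_cont continuous_intros \<zeta> cont_shift[OF q] mult_right_mono)
  then show ?thesis by simp
qed

lemma conv_bound_sup:
  assumes \<zeta>: "continuous_on UNIV \<zeta>" "\<And>z. \<bar>\<zeta> z\<bar> \<le> b" and q: "continuous_on UNIV q"
    and c: "\<And>z. z \<in> QB \<Longrightarrow> \<bar>q (x + r *\<^sub>R z)\<bar> \<le> c" and b: "0 \<le> b"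
  shows "\<bar>conv \<zeta> q r x\<bar> \<le> 36 * b * c"
proof -
  have "integral QB (\<lambda>z. \<bar>q (x + r *\<^sub>R z)\<bar>) \<le> integral QB (\<lambda>z. c)"
    by (rule integral_le) (auto intro!: integrable_cont continuous_intros cont_shift[OF q] c)
  also have "\<dots> = 36 * c" by (simp add: QB_content)
  finally show ?thesis using conv_bound_L1[OF \<zeta> q, of r x] mult_left_mono[OF _ b] by fastforce
qed

lemma conv_minus_const:
  assumes "continuous_on UNIV q" "continuous_on UNIV \<zeta>"
  shows "conv \<zeta> (\<lambda>y. q y - c) r x = conv \<zeta> q r x - c * integral QB \<zeta>"
proof -
  have "conv \<zeta> (\<lambda>y. q y - c) r x = integral QB (\<lambda>z. \<zeta> z * q (x + r *\<^sub>R z) - c * \<zeta> z)"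
    unfolding conv_def by (simp add: algebra_simps)
  also have "\<dots> = conv \<zeta> q r x - integral QB (\<lambda>z. c * \<zeta> z)"
    unfolding conv_def
    by (rule integral_diff) (intro integrable_cont continuous_intros assms cont_shift[OF assms(1)])+
  finally show ?thesis by simp
qed

text \<open>The displacement is transferred to the kernel, whose Lipschitz bound yields the factor
  |w|; of \<open>q\<close> only an L^1 norm remains.\<close>

lemma conv_diff_L1:
  assumes \<zeta>: "continuous_on UNIV \<zeta>" "\<And>z. norm z \<ge> 1 \<Longrightarrow> \<zeta> z = 0" "\<And>y z. \<bar>\<zeta> y - \<zeta> z\<bar> \<le> L * norm (y - z)"
    and q: "continuous_on UNIV q" and w: "norm w \<le> 1"
  shows "\<bar>conv \<zeta> q r (x + r *\<^sub>R w) - conv \<zeta> q r x\<bar> \<le> L * norm w * integral QB (\<lambda>z. \<bar>q (x + r *\<^sub>R z)\<bar>)"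
proof -
  have "conv \<zeta> q r (x + r *\<^sub>R w) = integral QB (\<lambda>z. (\<lambda>y. \<zeta> (y - w) * q (x + r *\<^sub>R y)) (z + w))"
    by (simp add: conv_def algebra_simps)
  also have "\<dots> = integral QB (\<lambda>y. \<zeta> (y - w) * q (x + r *\<^sub>R y))"
  proof (rule supp_integral[OF _ w])
    fix z :: "real^2" assume "norm z \<ge> 2"
    then have "norm (z - w) \<ge> 1" using w norm_triangle_ineq2[of z w] by linarith
    then show "\<zeta> (z - w) * q (x + r *\<^sub>R z) = 0" by (simp add: \<zeta>(2))
  qed
  finally have "conv \<zeta> q r (x + r *\<^sub>R w) - conv \<zeta> q r x = integral QB (\<lambda>y. (\<zeta> (y - w) - \<zeta> y) * q (x + r *\<^sub>R y))"
    unfolding conv_def left_diff_distrib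
    by (subst integral_diff) (auto intro!: integrable_cont continuous_intros cont_shift[OF \<zeta>(1)] cont_shift[OF q])
  also have "\<bar>\<dots>\<bar> \<le> integral QB (\<lambda>y. (L * norm w) * \<bar>q (x + r *\<^sub>R y)\<bar>)"
    unfolding real_norm_def[symmetric]
  proof (rule integral_norm_bound_integral)
    show "norm ((\<zeta> (y - w) - \<zeta> y) * q (x + r *\<^sub>R y)) \<le> L * norm w * norm (q (x + r *\<^sub>R y))" for y
      using \<zeta>(3)[of "y - w" y] by (auto simp: abs_mult intro!: mult_right_mono)
  qed (auto intro!: integrable_cont continuous_intros cont_shift[OF \<zeta>(1)] cont_shift[OF q])
  finally show ?thesis by simp
qed

text \<open>After rescaling, the box has side 6 r \<le> 1 and lies in a translated period cell; 1 /
  r^2 is the Jacobian.\<close>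

lemma box_square_integral:
  assumes q: "periodic q" "continuous_on UNIV q" and r: "0 < r" "r \<le> 1/6"
  shows "integral QB (\<lambda>z. (q (x + r *\<^sub>R z))\<^sup>2) \<le> torus_integral (\<lambda>y. (q y)\<^sup>2) / r\<^sup>2"
proof -
  let ?f = "\<lambda>y. (q y)\<^sup>2"
  let ?a = "x - r *\<^sub>R vec 3" and ?b = "x + r *\<^sub>R vec 3"
  have cf: "continuous_on UNIV ?f" by (intro continuous_intros q)
  have "(?f has_integral integral (cbox ?a ?b) ?f) (cbox ?a ?b)"
    by (intro integrable_integral integrable_cont cf)
  from has_integral_affinity'[OF this r(1), of x]
  have "((\<lambda>z. ?f (r *\<^sub>R z + x)) has_integral integral (cbox ?a ?b) ?f /\<^sub>R r ^ 2) (cbox ((?a - x) /\<^sub>R r) ((?b - x) /\<^sub>R r))"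
    by simp
  moreover have "(?a - x) /\<^sub>R r = vec (-3)" "(?b - x) /\<^sub>R r = vec 3" using r by (auto simp: vec_eq_iff)
  ultimately have "integral QB (\<lambda>z. ?f (x + r *\<^sub>R z)) = integral (cbox ?a ?b) ?f / r\<^sup>2"
    by (auto simp: add.commute divide_inverse mult.commute dest!: integral_unique)
  also have "integral (cbox ?a ?b) ?f \<le> integral (cbox (0 + (x - vec (1/2))) (1 + (x - vec (1/2)))) ?f"
  proof (intro integral_subset_le integrable_cont cf)
    show "cbox ?a ?b \<subseteq> cbox (0 + (x - vec (1/2))) (1 + (x - vec (1/2)))"
      unfolding subset_iff mem_box_cart
    proof (intro allI impI)
      fix t i assume "\<forall>i. ?a $ i \<le> t $ i \<and> t $ i \<le> ?b $ i"
      then have "x $ i - r * 3 \<le> t $ i" "t $ i \<le> x $ i + r * 3" by (metis vec_component vector_minus_component vector_scaleR_component vector_add_component real_scaleR_def)+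
      then show "(0 + (x - vec (1/2))) $ i \<le> t $ i \<and> t $ i \<le> (1 + (x - vec (1/2))) $ i"
        using r by simp
    qed
  qed auto
  also have "\<dots> = torus_integral (\<lambda>y. ?f (y + (x - vec (1/2))))"
    using integral_shift_cbox_plus[of 0 1 ?f "x - vec (1/2)"] by (simp add: torus_integral_def o_def add.commute)
  also have "\<dots> = torus_integral ?f"
    by (rule torus_shift[OF _ cf]) (rule periodic_compose[OF q(1)])
  finally show ?thesis using r by (simp add: divide_right_mono)
qed

lemma box_L1:
  assumes q: "periodic q" "continuous_on UNIV q" and r: "0 < r" "r \<le> 1/6"
    and E: "torus_integral (\<lambda>y. (q y)\<^sup>2) \<le> E\<^sup>2" "E > 0"
  shows "integral QB (\<lambda>z. \<bar>q (x + r *\<^sub>R z)\<bar>) \<le> 6 * E / r"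
proof -
  \<comment> \<open>The optimal parameter in |s| \<le> s^2 / (2 e) + e / 2 for a box of area 36; the
    outcome is the Cauchy-Schwarz bound.\<close>
  define e where "e = E / (6 * r)"
  have e: "e > 0" using E r by (simp add: e_def)
  have am: "\<bar>s\<bar> \<le> (1 / (2 * e)) * s\<^sup>2 + e / 2" for s :: real
  proof -
    have "0 \<le> (\<bar>s\<bar> - e)\<^sup>2" by simp
    then have "2 * e * \<bar>s\<bar> \<le> s\<^sup>2 + e\<^sup>2" by (simp add: power2_diff mult_ac)
    then show ?thesis using e by (simp add: field_simps power2_eq_square)
  qed
  have "integral QB (\<lambda>z. \<bar>q (x + r *\<^sub>R z)\<bar>) \<le> integral QB (\<lambda>z. (1 / (2 * e)) * (q (x + r *\<^sub>R z))\<^sup>2 + e / 2)"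
    by (rule integral_le[OF _ _ am]) (intro integrable_cont continuous_intros cont_shift[OF q(2)] | use e in simp)+
  also have "\<dots> = (1 / (2 * e)) * integral QB (\<lambda>z. (q (x + r *\<^sub>R z))\<^sup>2) + 18 * e"
    by (subst integral_add) (use e in \<open>auto intro!: integrable_cont continuous_intros cont_shift[OF q(2)] simp: QB_content\<close>)
  also have "\<dots> \<le> (1 / (2 * e)) * (E\<^sup>2 / r\<^sup>2) + 18 * e"
    using box_square_integral[OF q r, of x] divide_right_mono[OF E(1), of "r\<^sup>2"] e
    by (intro add_right_mono mult_left_mono) auto
  also have "\<dots> = 6 * E / r" using E r by (simp add: e_def field_simps power2_eq_square)
  finally show ?thesis .
qed

section \<open>Hoelder estimates by integration over scales\<close>

definition holder :: "real \<Rightarrow> real \<Rightarrow> (real^2 \<Rightarrow> real) \<Rightarrow> bool" where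
  "holder \<gamma> S q \<longleftrightarrow> (\<forall>x y. \<bar>q x - q y\<bar> \<le> S * norm (x - y) powr \<gamma>)"

text \<open>Replaces integration of the derivative where its bound may blow up at an end point: h -
  F and h + F are both nondecreasing.\<close>

lemma increment_le_primitive:
  fixes F h :: "real \<Rightarrow> real"
  assumes ab: "a \<le> b" and F: "continuous_on {a..b} F" and h: "continuous_on {a..b} h"
    and dF: "\<And>r. a < r \<Longrightarrow> r < b \<Longrightarrow> (F has_real_derivative F' r) (at r)"
    and dh: "\<And>r. a < r \<Longrightarrow> r < b \<Longrightarrow> (h has_real_derivative h' r) (at r)"
    and le: "\<And>r. a < r \<Longrightarrow> r < b \<Longrightarrow> \<bar>F' r\<bar> \<le> h' r"
  shows "\<bar>F b - F a\<bar> \<le> h b - h a"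
proof -
  have "h a - F a \<le> h b - F b"
  proof (rule DERIV_nonneg_imp_increasing_open[OF ab, where f="\<lambda>r. h r - F r"])
    fix r assume "a < r" "r < b"
    with dF dh le[of r] show "\<exists>y. ((\<lambda>r. h r - F r) has_real_derivative y) (at r) \<and> 0 \<le> y"
      by (intro exI[of _ "h' r - F' r"]) (auto intro!: derivative_eq_intros)
  qed (intro continuous_intros F h)
  moreover have "h a + F a \<le> h b + F b"
  proof (rule DERIV_nonneg_imp_increasing_open[OF ab, where f="\<lambda>r. h r + F r"])
    fix r assume "a < r" "r < b"
    with dF dh le[of r] show "\<exists>y. ((\<lambda>r. h r + F r) has_real_derivative y) (at r) \<and> 0 \<le> y"
      by (intro exI[of _ "h' r + F' r"]) (auto intro!: derivative_eq_intros)
  qed (intro continuous_intros F h)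
  ultimately show ?thesis by linarith
qed

lemma powr_primitive:
  assumes "r > 0" "s \<noteq> 0"
  shows "((\<lambda>r. C * r powr s / s) has_real_derivative C * r powr (s - 1)) (at r)"
  using assms by (auto intro!: derivative_eq_intros)

lemma tr2_cont: "pot g H \<Longrightarrow> continuous_on UNIV (\<lambda>y. tr2 (H y))"
  unfolding tr2_def by (intro continuous_intros pot_cont)

lemma holder_box:
  assumes S: "holder \<gamma> S q" "0 \<le> S" and \<gamma>: "0 < \<gamma>" "\<gamma> < 1" and r: "r > 0" and z: "z \<in> QB"
  shows "\<bar>q (x + r *\<^sub>R z) - q x\<bar> \<le> 5 * S * r powr \<gamma>"
proof -
  have "\<bar>q (x + r *\<^sub>R z) - q x\<bar> \<le> S * norm (r *\<^sub>R z) powr \<gamma>"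
    using S(1) unfolding holder_def by (metis add_diff_cancel_left')
  also have "\<dots> = S * r powr \<gamma> * norm z powr \<gamma>"
    using r by (simp add: powr_mult)
  also have "\<dots> \<le> S * r powr \<gamma> * 5"
  proof (rule mult_left_mono)
    have "norm z powr \<gamma> \<le> 5 powr \<gamma>" using QB_norm[OF z] \<gamma> by (intro powr_mono2) auto
    also have "\<dots> \<le> 5 powr 1" using \<gamma> by (intro powr_mono) auto
    finally show "norm z powr \<gamma> \<le> 5" by simp
  qed (use S(2) in simp)
  finally show ?thesis by (simp add: mult_ac)
qed

text \<open>As \<open>czk i j\<close> has mean zero, the value \<open>f x\<close> may be subtracted
  from \<open>f\<close>. The constants are 10080 = 36 * 56 * 5 and 120960 = 672 * 36 * 5: area of
  the box, kernel bound, and radius bound of the box.\<close>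

lemma conv_czk_holder:
  assumes p: "continuous_on UNIV f" and S: "holder \<gamma> S f" "0 \<le> S" and \<gamma>: "0 < \<gamma>" "\<gamma> < 1" and r: "r > 0"
  shows "\<bar>conv (czk i j) f r x\<bar> \<le> 10080 * S * r powr \<gamma>"
    and "norm w \<le> 1 \<Longrightarrow> \<bar>conv (czk i j) f r (x + r *\<^sub>R w) - conv (czk i j) f r x\<bar> \<le> 120960 * S * r powr \<gamma> * norm w"
proof -
  note b = holder_box[OF S \<gamma> r, of _ x]
  have cq: "continuous_on UNIV (\<lambda>y. f y - f x)" by (intro continuous_intros p)
  have e: "conv (czk i j) f r y = conv (czk i j) (\<lambda>y. f y - f x) r y" for y
    using conv_minus_const[OF p czk_cont, of i j "f x" r y] czk_mean[of i j] by simp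
  have "\<bar>conv (czk i j) f r x\<bar> \<le> 36 * 56 * (5 * S * r powr \<gamma>)"
    unfolding e by (rule conv_bound_sup[OF czk_cont czk_bound cq b]) auto
  then show "\<bar>conv (czk i j) f r x\<bar> \<le> 10080 * S * r powr \<gamma>" by simp
  assume w: "norm w \<le> 1"
  have "\<bar>conv (czk i j) f r (x + r *\<^sub>R w) - conv (czk i j) f r x\<bar>
      \<le> 672 * norm w * integral QB (\<lambda>z. \<bar>f (x + r *\<^sub>R z) - f x\<bar>)"
    unfolding e by (rule conv_diff_L1[OF czk_cont kernel_supp(2) kernel_lipschitz(2) cq w])
  also have "\<dots> \<le> 672 * norm w * integral QB (\<lambda>z. 5 * S * r powr \<gamma>)"
    by (intro mult_left_mono integral_le) (auto intro!: b integrable_cont continuous_intros cont_shift[OF p])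
  also have "\<dots> = 120960 * S * r powr \<gamma> * norm w" by (simp add: QB_content)
  finally show "\<bar>conv (czk i j) f r (x + r *\<^sub>R w) - conv (czk i j) f r x\<bar> \<le> 120960 * S * r powr \<gamma> * norm w" .
qed

lemma entry_sq_le: "(A $ i $ j)\<^sup>2 \<le> sqn A"
  using exhaust_2[of i] exhaust_2[of j] by (auto simp: sqn_def)

lemma sqn_cont: "pot g H \<Longrightarrow> continuous_on UNIV (\<lambda>x. sqn (H x))"
  unfolding sqn_def by (intro continuous_intros pot_cont)

lemma pot_entry_energy:
  assumes p: "pot g H" and F: "\<And>x. \<bar>tr2 (H x)\<bar> \<le> F"
  shows "torus_integral (\<lambda>x. (H x $ i $ j)\<^sup>2) \<le> F\<^sup>2"
proof -
  have "torus_integral (\<lambda>x. (H x $ i $ j)\<^sup>2) \<le> torus_integral (\<lambda>x. sqn (H x))"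
    by (rule torus_integral_mono) (auto intro!: continuous_intros pot_cont[OF p] sqn_cont[OF p] entry_sq_le)
  also have "\<dots> \<le> torus_integral (\<lambda>x. F\<^sup>2)"
    unfolding pot_energy[OF p]
    by (rule torus_integral_mono) (auto intro!: continuous_intros tr2_cont[OF p] abs_sq_le F)
  finally show ?thesis by (simp add: torus_integral_const)
qed

text \<open>Three ranges of scales. At 1/6 the energy bounds the average; between \<open>d\<close>
  and 1/6 the scale derivative is at most a multiple of F / r, whose integral is the logarithm;
  below \<open>d\<close> the Hoelder seminorm makes it integrable. The scale \<open>d\<close> stays
  free for later optimisation.\<close>

lemma pot_log_estimate:
  assumes p: "pot g H" and F: "\<And>x. \<bar>tr2 (H x)\<bar> \<le> F" "F > 0"
    and S: "holder \<gamma> S (\<lambda>x. tr2 (H x))" "0 \<le> S" and \<gamma>: "0 < \<gamma>" "\<gamma> < 1"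
    and d: "0 < d" "d \<le> 1/6"
  shows "\<bar>H x $ i $ j\<bar> \<le> 10080 * (F * (1 + ln (1 / d)) + S * d powr \<gamma> / \<gamma>)"
proof -
  let ?q = "\<lambda>y. H y $ i $ j" and ?f = "\<lambda>y. tr2 (H y)"
  let ?A = "\<lambda>r. conv avk ?q r x"
  note cq = pot_entry_cont[OF p, of i j] and cf = tr2_cont[OF p]
  have cA: "continuous_on T ?A" for T by (rule conv_cont_r[OF avk_cont cq])
  have dA: "(?A has_real_derivative (1 / r) * conv (czk i j) ?f r x) (at r)" if "r > 0" for r
    by (rule conv_deriv[OF p that])
  have "\<bar>?A (1/6)\<bar> \<le> 8 * integral QB (\<lambda>z. \<bar>?q (x + (1/6) *\<^sub>R z)\<bar>)"
    by (rule conv_bound_L1[OF avk_cont avk_bound(1) cq])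
  also have "\<dots> \<le> 8 * (6 * F / (1/6))"
    by (intro mult_left_mono box_L1[OF pot_entry_periodic[OF p] cq _ _ pot_entry_energy[OF p F(1)] F(2)]) auto
  finally have 1: "\<bar>?A (1/6)\<bar> \<le> 288 * F" by simp
  have "\<bar>?A (1/6) - ?A d\<bar> \<le> 2016 * F * ln (1/6) - 2016 * F * ln d"
  proof (rule increment_le_primitive[OF d(2) cA, where h="\<lambda>r. 2016 * F * ln r" and h'="\<lambda>r. 2016 * F * (1 / r)"])
    show "continuous_on {d..1/6} (\<lambda>r. 2016 * F * ln r)"
      using d by (intro continuous_intros) auto
    fix r assume r: "d < r" "r < 1/6"
    then have r0: "r > 0" using d by simp
    show "(?A has_real_derivative (1 / r) * conv (czk i j) ?f r x) (at r)" by (rule dA[OF r0])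
    show "((\<lambda>r. 2016 * F * ln r) has_real_derivative 2016 * F * (1 / r)) (at r)"
      using r0 by (auto intro!: derivative_eq_intros)
    have "\<bar>conv (czk i j) ?f r x\<bar> \<le> 36 * 56 * F"
      by (rule conv_bound_sup[OF czk_cont czk_bound cf F(1)]) simp
    then have "(1 / r) * \<bar>conv (czk i j) ?f r x\<bar> \<le> (1 / r) * (2016 * F)"
      using r0 by (intro mult_left_mono) auto
    then show "\<bar>(1 / r) * conv (czk i j) ?f r x\<bar> \<le> 2016 * F * (1 / r)"
      using r0 by (simp add: abs_mult)
  qed
  also have "\<dots> \<le> 2016 * F * ln (1 / d)"
  proof -
    have "ln (1/6) \<le> (0::real)" by simp
    then have "2016 * F * ln (1/6) \<le> 0" using F(2) by (intro mult_nonneg_nonpos) auto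
    then show ?thesis using d by (simp add: ln_div)
  qed
  finally have 2: "\<bar>?A (1/6) - ?A d\<bar> \<le> 2016 * F * ln (1 / d)" .
  \<comment> \<open>The primitive r^\<gamma> / \<gamma> is continuous up to r = 0, although the
    derivative bound is not.\<close>
  have "\<bar>?A d - ?A 0\<bar> \<le> 10080 * S * d powr \<gamma> / \<gamma> - 10080 * S * 0 powr \<gamma> / \<gamma>"
  proof (rule increment_le_primitive[where h="\<lambda>r. 10080 * S * r powr \<gamma> / \<gamma>" and h'="\<lambda>r. 10080 * S * r powr (\<gamma> - 1)"])
    show "continuous_on {0..d} (\<lambda>r. 10080 * S * r powr \<gamma> / \<gamma>)"
      using \<gamma> by (intro continuous_intros continuous_on_powr') auto
    fix r assume r: "0 < r" "r < d"
    show "(?A has_real_derivative (1 / r) * conv (czk i j) ?f r x) (at r)" by (rule dA[OF r(1)])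
    show "((\<lambda>r. 10080 * S * r powr \<gamma> / \<gamma>) has_real_derivative 10080 * S * r powr (\<gamma> - 1)) (at r)"
      using r \<gamma> by (intro powr_primitive) auto
    have "(1 / r) * \<bar>conv (czk i j) ?f r x\<bar> \<le> (1 / r) * (10080 * S * r powr \<gamma>)"
      using r by (intro mult_left_mono conv_czk_holder[OF cf S \<gamma>]) auto
    then show "\<bar>(1 / r) * conv (czk i j) ?f r x\<bar> \<le> 10080 * S * r powr (\<gamma> - 1)"
      using r by (simp add: abs_mult powr_diff)
  qed (use d cA in auto)
  then have 3: "\<bar>?A d - ?A 0\<bar> \<le> 10080 * (S * d powr \<gamma> / \<gamma>)" by simp
  have "\<bar>?q x\<bar> \<le> mass * \<bar>?q x\<bar>" using mass_ge mult_right_mono[of 1 mass "\<bar>?q x\<bar>"] by simp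
  also have "\<dots> = \<bar>?A 0\<bar>" using mass_ge by (simp add: conv_zero abs_mult)
  also have "\<dots> \<le> 288 * F + 2016 * (F * ln (1 / d)) + 10080 * (S * d powr \<gamma> / \<gamma>)"
    using 1 2 3 by linarith
  also have "\<dots> \<le> 10080 * (F * (1 + ln (1 / d)) + S * d powr \<gamma> / \<gamma>)"
  proof -
    have "0 \<le> F * ln (1 / d)" using F(2) d by simp
    then show ?thesis using F(2) by (simp add: algebra_simps)
  qed
  finally show ?thesis .
qed

lemma powr_ge_self: "0 < d \<Longrightarrow> d \<le> 1 \<Longrightarrow> 0 < \<gamma> \<Longrightarrow> \<gamma> < 1 \<Longrightarrow> d \<le> d powr (\<gamma>::real)"
  using powr_mono'[of \<gamma> 1 d] by simp

text \<open>The averages at \<open>x\<close> and \<open>y\<close> are compared across scales. Above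
  |y - x| the Lipschitz kernels gain the factor |y - x| / r, which produces 1 / (1 - \<gamma>);
  below it the two points are treated separately, which produces 1 / \<gamma>.\<close>

lemma pot_schauder_near:
  assumes p: "pot g H" and F: "\<And>x. \<bar>tr2 (H x)\<bar> \<le> F" "F > 0"
    and S: "holder \<gamma> S (\<lambda>x. tr2 (H x))" "0 \<le> S" and \<gamma>: "0 < \<gamma>" "\<gamma> < 1"
    and d: "0 < norm (y - x)" "norm (y - x) \<le> 1/6"
  shows "\<bar>H x $ i $ j - H y $ i $ j\<bar> \<le> 1000000 * (1 / \<gamma> + 1 / (1 - \<gamma>)) * (F + S) * norm (y - x) powr \<gamma>"
proof -
  let ?q = "\<lambda>y. H y $ i $ j" and ?f = "\<lambda>y. tr2 (H y)"
  define dd where "dd = norm (y - x)"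
  have dd: "0 < dd" "dd \<le> 1/6" using d by (auto simp: dd_def)
  let ?A = "\<lambda>r. conv avk ?q r y - conv avk ?q r x"
  note cq = pot_entry_cont[OF p, of i j] and cf = tr2_cont[OF p]
  have cA: "continuous_on T ?A" for T by (intro continuous_intros conv_cont_r[OF avk_cont cq])
  have dA: "(?A has_real_derivative (1 / r) * (conv (czk i j) ?f r y - conv (czk i j) ?f r x)) (at r)" if "r > 0" for r
    using DERIV_diff[OF conv_deriv[OF p that, of i j y] conv_deriv[OF p that, of i j x]]
    by (simp add: right_diff_distrib)
  \<comment> \<open>At scale \<open>r\<close> the displacement is (y - x) / r, of length at most 1
    exactly when r \<ge> |y - x|.\<close>
  have shift: "y = x + r *\<^sub>R ((1 / r) *\<^sub>R (y - x))" if "r > 0" for r using that by simp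
  have nw: "norm ((1 / r) *\<^sub>R (y - x)) = dd / r" if "r > 0" for r using that by (simp add: dd_def)
  have "\<bar>?A (1/6)\<bar> \<le> 672 * norm ((1 / (1/6)) *\<^sub>R (y - x)) * integral QB (\<lambda>z. \<bar>?q (x + (1/6) *\<^sub>R z)\<bar>)"
    using conv_diff_L1[OF avk_cont kernel_supp(1) kernel_lipschitz(1) cq, of "(1 / (1/6)) *\<^sub>R (y - x)" "1/6" x]
      shift[of "1/6"] nw[of "1/6"] dd by simp
  also have "\<dots> \<le> 672 * norm ((1 / (1/6)) *\<^sub>R (y - x)) * (6 * F / (1/6))"
    by (intro mult_left_mono box_L1[OF pot_entry_periodic[OF p] cq _ _ pot_entry_energy[OF p F(1)] F(2)]) auto
  also have "\<dots> = 145152 * F * dd" by (simp add: nw dd_def)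
  also have "\<dots> \<le> 145152 * F * dd powr \<gamma>"
    using powr_ge_self[of dd \<gamma>] dd \<gamma> F(2) by (intro mult_left_mono) auto
  finally have 1: "\<bar>?A (1/6)\<bar> \<le> 145152 * F * dd powr \<gamma>" .
  let ?C = "- 120960 * S * dd"
  have "\<bar>?A (1/6) - ?A dd\<bar> \<le> (- ?C) * (1/6) powr (\<gamma> - 1) / (\<gamma> - 1) - (- ?C) * dd powr (\<gamma> - 1) / (\<gamma> - 1)"
  proof (rule increment_le_primitive[OF dd(2) cA, where h="\<lambda>r. (- ?C) * r powr (\<gamma> - 1) / (\<gamma> - 1)" and h'="\<lambda>r. (- ?C) * r powr (\<gamma> - 1 - 1)"])
    show "continuous_on {dd..1/6} (\<lambda>r. (- ?C) * r powr (\<gamma> - 1) / (\<gamma> - 1))"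
      using dd \<gamma> by (intro continuous_intros) auto
    fix r assume r: "dd < r" "r < 1/6"
    then have r0: "r > 0" using dd by simp
    show "(?A has_real_derivative (1 / r) * (conv (czk i j) ?f r y - conv (czk i j) ?f r x)) (at r)" by (rule dA[OF r0])
    show "((\<lambda>r. (- ?C) * r powr (\<gamma> - 1) / (\<gamma> - 1)) has_real_derivative (- ?C) * r powr (\<gamma> - 1 - 1)) (at r)"
      using r0 \<gamma> by (intro powr_primitive) auto
    have "norm ((1 / r) *\<^sub>R (y - x)) \<le> 1" using nw[OF r0] r r0 by simp
    then have "\<bar>conv (czk i j) ?f r y - conv (czk i j) ?f r x\<bar> \<le> 120960 * S * r powr \<gamma> * (dd / r)"
      using conv_czk_holder(2)[OF cf S \<gamma> r0, of "(1 / r) *\<^sub>R (y - x)" i j x]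
      unfolding shift[OF r0, symmetric] nw[OF r0] by blast
    then have "(1 / r) * \<bar>conv (czk i j) ?f r y - conv (czk i j) ?f r x\<bar> \<le> (1 / r) * (120960 * S * r powr \<gamma> * (dd / r))"
      using r0 by (intro mult_left_mono) auto
    also have "\<dots> = (- ?C) * r powr (\<gamma> - 1 - 1)"
      using r0 by (simp add: powr_diff power2_eq_square)
    finally show "\<bar>(1 / r) * (conv (czk i j) ?f r y - conv (czk i j) ?f r x)\<bar> \<le> (- ?C) * r powr (\<gamma> - 1 - 1)"
      using r0 by (simp add: abs_mult)
  qed
  also have "\<dots> \<le> 120960 * S * (1 / (1 - \<gamma>)) * dd powr \<gamma>"
  proof -
    have "(- ?C) * (1/6) powr (\<gamma> - 1) / (\<gamma> - 1) \<le> 0"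
      using S dd \<gamma> by (intro divide_nonneg_nonpos mult_nonneg_nonneg) auto
    moreover have "- ((- ?C) * dd powr (\<gamma> - 1) / (\<gamma> - 1)) = 120960 * S * (1 / (1 - \<gamma>)) * dd powr \<gamma>"
      using dd \<gamma> by (simp add: powr_diff field_simps)
    ultimately show ?thesis by linarith
  qed
  finally have 2: "\<bar>?A (1/6) - ?A dd\<bar> \<le> 120960 * S * (1 / (1 - \<gamma>)) * dd powr \<gamma>" .
  have "\<bar>?A dd - ?A 0\<bar> \<le> 20160 * S * dd powr \<gamma> / \<gamma> - 20160 * S * 0 powr \<gamma> / \<gamma>"
  proof (rule increment_le_primitive[where h="\<lambda>r. 20160 * S * r powr \<gamma> / \<gamma>" and h'="\<lambda>r. 20160 * S * r powr (\<gamma> - 1)"])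
    show "continuous_on {0..dd} (\<lambda>r. 20160 * S * r powr \<gamma> / \<gamma>)"
      using \<gamma> by (intro continuous_intros continuous_on_powr') auto
    fix r assume r: "0 < r" "r < dd"
    show "(?A has_real_derivative (1 / r) * (conv (czk i j) ?f r y - conv (czk i j) ?f r x)) (at r)" by (rule dA[OF r(1)])
    show "((\<lambda>r. 20160 * S * r powr \<gamma> / \<gamma>) has_real_derivative 20160 * S * r powr (\<gamma> - 1)) (at r)"
      using r \<gamma> by (intro powr_primitive) auto
    have "\<bar>conv (czk i j) ?f r y - conv (czk i j) ?f r x\<bar> \<le> 20160 * S * r powr \<gamma>"
      using conv_czk_holder(1)[OF cf S \<gamma> r(1), of i j x] conv_czk_holder(1)[OF cf S \<gamma> r(1), of i j y] by linarith
    then have "(1 / r) * \<bar>conv (czk i j) ?f r y - conv (czk i j) ?f r x\<bar> \<le> (1 / r) * (20160 * S * r powr \<gamma>)"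
      using r by (intro mult_left_mono) auto
    then show "\<bar>(1 / r) * (conv (czk i j) ?f r y - conv (czk i j) ?f r x)\<bar> \<le> 20160 * S * r powr (\<gamma> - 1)"
      using r by (simp add: abs_mult powr_diff)
  qed (use dd cA in auto)
  then have 3: "\<bar>?A dd - ?A 0\<bar> \<le> 20160 * S * (1 / \<gamma>) * dd powr \<gamma>" by simp
  have "\<bar>?q x - ?q y\<bar> \<le> mass * \<bar>?q x - ?q y\<bar>" using mass_ge mult_right_mono[of 1 mass "\<bar>?q x - ?q y\<bar>"] by simp
  also have "\<dots> = \<bar>?A 0\<bar>" using mass_ge
    by (simp add: conv_zero right_diff_distrib[symmetric] abs_mult abs_minus_commute)
  also have "\<dots> \<le> (145152 * F + 120960 * S * (1 / (1 - \<gamma>)) + 20160 * S * (1 / \<gamma>)) * dd powr \<gamma>"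
    using 1 2 3 unfolding distrib_right by linarith
  also have "\<dots> \<le> 1000000 * (1 / \<gamma> + 1 / (1 - \<gamma>)) * (F + S) * dd powr \<gamma>"
  proof (intro mult_right_mono)
    have a: "1 \<le> 1 / \<gamma>" "0 \<le> 1 / (1 - \<gamma>)" using \<gamma> by auto
    have "1 \<le> 1 / \<gamma> + 1 / (1 - \<gamma>)" using a by linarith
    then have "F * 1 \<le> F * (1 / \<gamma> + 1 / (1 - \<gamma>))" using F(2) by (intro mult_left_mono) auto
    moreover have "0 \<le> S * (1 / (1 - \<gamma>))" "0 \<le> S * (1 / \<gamma>)" using S a \<gamma> by auto
    moreover have "1000000 * (1 / \<gamma> + 1 / (1 - \<gamma>)) * (F + S) = 1000000 * (F * (1 / \<gamma> + 1 / (1 - \<gamma>)))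
       + 1000000 * (S * (1 / (1 - \<gamma>))) + 1000000 * (S * (1 / \<gamma>))" by (simp add: algebra_simps add_divide_distrib)
    ultimately show "145152 * F + 120960 * S * (1 / (1 - \<gamma>)) + 20160 * S * (1 / \<gamma>) \<le> 1000000 * (1 / \<gamma> + 1 / (1 - \<gamma>)) * (F + S)"
      using F(2) by linarith
  qed simp
  finally show ?thesis by (simp add: dd_def)
qed

definition sch :: "real \<Rightarrow> real" where "sch \<gamma> = 1000000 * (1 / \<gamma> + 1 / (1 - \<gamma>))"

lemma sch_ge: "0 < \<gamma> \<Longrightarrow> \<gamma> < 1 \<Longrightarrow> sch \<gamma> \<ge> 1000000"
proof -
  assume "0 < \<gamma>" "\<gamma> < 1"
  then have "1 \<le> 1 / \<gamma>" "0 \<le> 1 / (1 - \<gamma>)" by auto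
  then show ?thesis unfolding sch_def distrib_left by linarith
qed

lemma pot_schauder:
  assumes p: "pot g H" and F: "\<And>x. \<bar>tr2 (H x)\<bar> \<le> F" "F > 0"
    and S: "holder \<gamma> S (\<lambda>x. tr2 (H x))" "0 \<le> S" and \<gamma>: "0 < \<gamma>" "\<gamma> < 1"
  shows "holder \<gamma> (sch \<gamma> * (F + S)) (\<lambda>x. H x $ i $ j)"
  unfolding holder_def
proof (intro allI)
  fix x y :: "real^2"
  consider "x = y" | "0 < norm (y - x)" "norm (y - x) \<le> 1/6" | "norm (y - x) > 1/6" by force
  then show "\<bar>H x $ i $ j - H y $ i $ j\<bar> \<le> sch \<gamma> * (F + S) * norm (x - y) powr \<gamma>"
  proof cases
    case 2
    then show ?thesis using pot_schauder_near[OF p F S \<gamma> 2, of i j] by (simp add: sch_def norm_minus_commute)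
  next
    case 3
    \<comment> \<open>At distances above 1/6 the sup bound suffices, since |x - y|^\<gamma> is then
      bounded below. The scale 1/6 gives 1 + ln 6 \<le> 6.\<close>
    have l: "\<bar>H z $ i $ j\<bar> \<le> 10080 * (6 * F + S / \<gamma>)" for z
    proof -
      have "\<bar>H z $ i $ j\<bar> \<le> 10080 * (F * (1 + ln (1 / (1/6))) + S * (1/6) powr \<gamma> / \<gamma>)"
        by (rule pot_log_estimate[OF p F S \<gamma>]) auto
      also have "\<dots> \<le> 10080 * (F * 6 + S * 1 / \<gamma>)"
      proof -
        have "ln (6::real) \<le> 5" using ln_le_minus_one[of 6] by simp
        moreover have "(1/6) powr \<gamma> \<le> (1::real)" using \<gamma> powr_le1[of \<gamma> "1/6"] by simp
        ultimately show ?thesis using F(2) S(2) \<gamma>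
          by (intro mult_left_mono add_mono divide_right_mono) auto
      qed
      finally show ?thesis by (simp add: mult.commute)
    qed
    have six: "1 \<le> 6 * norm (x - y) powr \<gamma>"
    proof -
      have "(1/6::real) \<le> (1/6) powr \<gamma>" using \<gamma> by (intro powr_ge_self) auto
      also have "\<dots> \<le> norm (x - y) powr \<gamma>" using 3 \<gamma> by (intro powr_mono2) (auto simp: norm_minus_commute)
      finally show ?thesis by simp
    qed
    have g1: "1 \<le> 1 / \<gamma>" "0 \<le> 1 / (1 - \<gamma>)" using \<gamma> by auto
    have "\<bar>H x $ i $ j - H y $ i $ j\<bar> \<le> 20160 * (6 * F + S / \<gamma>)" using l[of x] l[of y] by linarith
    also have "\<dots> \<le> (20160 * (6 * F + S / \<gamma>)) * (6 * norm (x - y) powr \<gamma>)"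
      using mult_left_mono[OF six, of "20160 * (6 * F + S / \<gamma>)"] F(2) S(2) \<gamma> by simp
    also have "\<dots> = (120960 * (6 * F + S / \<gamma>)) * norm (x - y) powr \<gamma>" by simp
    also have "\<dots> \<le> sch \<gamma> * (F + S) * norm (x - y) powr \<gamma>"
    proof (intro mult_right_mono)
      have "1 \<le> 1 / \<gamma> + 1 / (1 - \<gamma>)" using g1 by linarith
      then have "F * 1 \<le> F * (1 / \<gamma> + 1 / (1 - \<gamma>))" using F(2) by (intro mult_left_mono) auto
      moreover have "0 \<le> S * (1 / (1 - \<gamma>))" "0 \<le> S * (1 / \<gamma>)" using S g1 \<gamma> by auto
      moreover have "sch \<gamma> * (F + S) = 1000000 * (F * (1 / \<gamma> + 1 / (1 - \<gamma>)))
         + 1000000 * (S * (1 / (1 - \<gamma>))) + 1000000 * (S * (1 / \<gamma>))" by (simp add: sch_def algebra_simps add_divide_distrib)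
      moreover have "120960 * (6 * F + S / \<gamma>) = 725760 * F + 120960 * (S * (1 / \<gamma>))" by simp
      ultimately show "120960 * (6 * F + S / \<gamma>) \<le> sch \<gamma> * (F + S)" using F(2) by linarith
    qed simp
    finally show ?thesis .
  qed simp
qed

text \<open>The average at scale \<open>r\<close> is controlled by the L^2 norm, its distance from
  the point value by the Hoelder seminorm. With \<open>r\<close> free, L^2 smallness becomes uniform
  smallness while the seminorm stays merely bounded.\<close>

lemma sup_interpolation:
  assumes q: "periodic q" "continuous_on UNIV q" and S: "holder \<gamma> S q" "0 \<le> S"
    and E: "torus_integral (\<lambda>y. (q y)\<^sup>2) \<le> E\<^sup>2" "E > 0"
    and \<gamma>: "0 < \<gamma>" "\<gamma> < 1" and r: "0 < r" "r \<le> 1/6"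
  shows "\<bar>q x\<bar> \<le> 48 * E / r + 1440 * S * r powr \<gamma>"
proof -
  have "\<bar>conv avk q r x\<bar> \<le> 8 * integral QB (\<lambda>z. \<bar>q (x + r *\<^sub>R z)\<bar>)"
    by (rule conv_bound_L1[OF avk_cont avk_bound(1) q(2)])
  also have "\<dots> \<le> 8 * (6 * E / r)" by (intro mult_left_mono box_L1[OF q r E]) auto
  finally have 1: "\<bar>conv avk q r x\<bar> \<le> 48 * E / r" by simp
  note b = holder_box[OF S \<gamma> r(1), of _ x]
  have "\<bar>conv avk (\<lambda>y. q y - q x) r x\<bar> \<le> 36 * 8 * (5 * S * r powr \<gamma>)"
    by (rule conv_bound_sup) (auto intro!: continuous_intros q avk_cont avk_bound(1) b)
  then have 2: "\<bar>conv avk q r x - mass * q x\<bar> \<le> 1440 * S * r powr \<gamma>"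
    using conv_minus_const[OF q(2) avk_cont, of "q x" r x] by (simp add: mass_def mult_ac)
  have "\<bar>q x\<bar> \<le> mass * \<bar>q x\<bar>" using mass_ge mult_right_mono[of 1 mass "\<bar>q x\<bar>"] by simp
  also have "\<dots> = \<bar>mass * q x\<bar>" using mass_ge by (simp add: abs_mult)
  also have "\<dots> \<le> 48 * E / r + 1440 * S * r powr \<gamma>" using 1 2 by linarith
  finally show ?thesis .
qed

section \<open>Poisson equation for trigonometric polynomials\<close>

text \<open>The phase \<open>b\<close> includes the sines, so one constructor covers all real
  modes.\<close>

inductive trig :: "(real^2 \<Rightarrow> real) \<Rightarrow> bool" where
  trig_cos: "lattice_vec w \<Longrightarrow> trig (\<lambda>x. a * cos (((2 * pi) *\<^sub>R w) \<bullet> x + b))"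
| trig_add: "trig p \<Longrightarrow> trig q \<Longrightarrow> trig (\<lambda>x. p x + q x)"

lemma lattice_vec_add: "lattice_vec v \<Longrightarrow> lattice_vec w \<Longrightarrow> lattice_vec (v + w)"
  unfolding lattice_vec_def
proof (elim exE)
  fix m n m' n' :: int
  assume "v = axis 1 (of_int m) + axis 2 (of_int n)" "w = axis 1 (of_int m') + axis 2 (of_int n')"
  then have "v + w = axis 1 (of_int (m + m')) + axis 2 (of_int (n + n'))" by (simp add: axis_add)
  then show "\<exists>m n::int. v + w = axis 1 (of_int m) + axis 2 (of_int n)" by blast
qed

lemma lattice_vec_minus: "lattice_vec v \<Longrightarrow> lattice_vec (- v)"
  unfolding lattice_vec_def
proof (elim exE)
  fix m n :: int
  assume "v = axis 1 (of_int m) + axis 2 (of_int n)"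
  then have "- v = axis 1 (of_int (- m)) + axis 2 (of_int (- n))" by (simp add: vec2_eq_iff)
  then show "\<exists>m n::int. - v = axis 1 (of_int m) + axis 2 (of_int n)" by blast
qed

lemma lattice_vec_axis: "lattice_vec (axis i 1)"
proof -
  have "axis 1 1 = axis 1 (of_int 1) + axis 2 (of_int 0 :: real)" "axis 2 1 = axis 1 (of_int 0 :: real) + axis 2 (of_int 1)"
    by (simp_all add: vec2_eq_iff)
  then show ?thesis unfolding lattice_vec_def using exhaust_2[of i] by metis
qed

lemma lattice_vec_zero: "lattice_vec 0"
  using lattice_vec_add[OF lattice_vec_axis lattice_vec_minus[OF lattice_vec_axis], of 1 1] by simp

lemma trig_cmult: "trig p \<Longrightarrow> trig (\<lambda>x. c * p x)"
proof (induction rule: trig.induct)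
  case (trig_cos w a b)
  from trig.trig_cos[OF this, of "c * a" b] show ?case by (simp add: mult.assoc)
next
  case (trig_add p q)
  from trig.trig_add[OF trig_add.IH] show ?case by (simp add: distrib_left)
qed

lemma trig_const: "trig (\<lambda>x. c)"
  using trig_cos[OF lattice_vec_zero, of c 0] by simp

lemma trig_mult_cos: "trig p \<Longrightarrow> trig (\<lambda>x. cos (2 * pi * x $ i + c) * p x)"
proof (induction rule: trig.induct)
  case (trig_cos w a b)
  let ?u = "w + axis i 1" and ?v = "w - axis i 1"
  have lu: "lattice_vec ?u" "lattice_vec ?v"
    using lattice_vec_add[OF trig_cos lattice_vec_axis] lattice_vec_add[OF trig_cos lattice_vec_minus[OF lattice_vec_axis], of i]
    by auto
  have *: "cos (2 * pi * x $ i + c) * (a * cos (((2 * pi) *\<^sub>R w) \<bullet> x + b)) =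
     (a / 2) * cos (((2 * pi) *\<^sub>R ?u) \<bullet> x + (b + c)) + (a / 2) * cos (((2 * pi) *\<^sub>R ?v) \<bullet> x + (b - c))" for x
  proof -
    have e: "((2 * pi) *\<^sub>R ?u) \<bullet> x + (b + c) = (((2 * pi) *\<^sub>R w) \<bullet> x + b) + (2 * pi * x $ i + c)"
      "((2 * pi) *\<^sub>R ?v) \<bullet> x + (b - c) = (((2 * pi) *\<^sub>R w) \<bullet> x + b) - (2 * pi * x $ i + c)"
      by (simp_all add: inner_add_left inner_diff_left inner_axis' algebra_simps)
    show ?thesis unfolding e cos_add cos_diff by (simp add: algebra_simps)
  qed
  show ?case unfolding * by (intro trig.intros lu)
next
  case (trig_add p q)
  from trig.trig_add[OF trig_add.IH] show ?case by (simp add: distrib_left)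
qed

lemma pot_add: "pot g H \<Longrightarrow> pot g' H' \<Longrightarrow> pot (\<lambda>x. g x + g' x) (\<lambda>x. H x + H' x)"
  unfolding pot_def by (auto intro!: periodic_compose2[where F="(+)"] simp: c1_add)

lemma pot_zero: "pot (\<lambda>x. 0) (\<lambda>x. 0)"
  unfolding pot_def c1_def by (auto simp: periodic_def intro!: derivative_eq_intros)

lemma pot_const: "pot (\<lambda>x. c) (\<lambda>x. 0)"
  unfolding pot_def c1_def by (auto simp: periodic_def intro!: derivative_eq_intros)

lemma cos_periodic_lattice:
  assumes "lattice_vec w"
  shows "periodic (\<lambda>x. f (sin (((2 * pi) *\<^sub>R w) \<bullet> x + b)))"
proof (rule periodic_compose[where F=f and f="\<lambda>x. sin (((2 * pi) *\<^sub>R w) \<bullet> x + b)"], unfold periodic_def, intro allI)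
  fix x i
  obtain m n :: int where w: "w = axis 1 (of_int m) + axis 2 (of_int n)"
    using assms by (auto simp: lattice_vec_def)
  obtain k :: int where "w $ i = of_int k" using exhaust_2[of i] w by auto
  then have "((2 * pi) *\<^sub>R w) \<bullet> (x + axis i 1) + b = (((2 * pi) *\<^sub>R w) \<bullet> x + b) + 2 * pi * of_int k"
    by (simp add: inner_add_right inner_axis algebra_simps)
  moreover have "sin (t + 2 * pi * of_int k) = sin t" for t
    by (simp add: sin_add sin_int_2pin cos_int_2pin)
  ultimately show "sin (((2 * pi) *\<^sub>R w) \<bullet> (x + axis i 1) + b) = sin (((2 * pi) *\<^sub>R w) \<bullet> x + b)"
    by (simp only:)
qed

text \<open>Mode by mode: for frequency K \<noteq> 0 the field (a / |K|^2) sin(K x + b) K has a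
  Jacobian with trace a cos(K x + b). The zero frequency cannot be inverted and goes into
  \<open>m\<close>.\<close>

lemma trig_poisson: "trig f \<Longrightarrow> \<exists>g H m. pot g H \<and> (\<forall>x. tr2 (H x) = f x - m)"
proof (induction rule: trig.induct)
  case (trig_cos w a b)
  show ?case
  proof (cases "w = 0")
    case True
    then show ?thesis
      using pot_zero by (intro exI[of _ "\<lambda>x. 0"] exI[of _ "a * cos b"]) (auto simp: tr2_def)
  next
    case False
    define K where "K = (2 * pi) *\<^sub>R w"
    have KK: "K \<bullet> K \<noteq> 0" using False by (simp add: K_def)
    define c where "c = a / (K \<bullet> K)"
    define g where "g = (\<lambda>x. (c * sin (K \<bullet> x + b)) *\<^sub>R K)"
    define H :: "real^2 \<Rightarrow> real^2^2" where "H = (\<lambda>x. \<chi> i j. c * cos (K \<bullet> x + b) * K $ i * K $ j)"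
    have "c1 (\<lambda>x. g x $ i) (\<lambda>x. H x $ i)" for i
    proof (rule c1I)
      show "((\<lambda>x. g x $ i) has_derivative (\<lambda>h. c * (cos (K \<bullet> x + b) * (K \<bullet> h)) * K $ i)) (at x)" for x
        unfolding g_def by (auto intro!: derivative_eq_intros)
      show "c * (cos (K \<bullet> x + b) * (K \<bullet> h)) * K $ i = H x $ i \<bullet> h" for x h
        by (simp add: H_def inner2 algebra_simps)
      show "continuous_on UNIV (\<lambda>x. H x $ i)"
        unfolding H_def by (auto intro!: continuous_intros)
    qed
    moreover have "periodic g" unfolding g_def K_def by (rule cos_periodic_lattice[OF trig_cos])
    ultimately have p: "pot g H" by (simp add: pot_def H_def)
    have "tr2 (H x) = c * (K \<bullet> K) * cos (K \<bullet> x + b)" for x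
      by (simp add: tr2_def H_def inner2 algebra_simps)
    then have "tr2 (H x) = a * cos (((2 * pi) *\<^sub>R w) \<bullet> x + b) - 0" for x
      using KK by (simp add: c_def K_def)
    with p show ?thesis by blast
  qed
next
  case (trig_add p q)
  then obtain g H m g' H' m' where "pot g H" "pot g' H'" and
    t: "\<And>x. tr2 (H x) = p x - m" "\<And>x. tr2 (H' x) = q x - m'" by blast
  then have "pot (\<lambda>x. g x + g' x) (\<lambda>x. H x + H' x)" by (intro pot_add)
  moreover have "tr2 (H x + H' x) = (p x + q x) - (m + m')" for x
    using t[of x] by (simp add: tr2_def)
  ultimately show ?case by blast
qed

section \<open>Trigonometric approximation by a positive kernel\<close>

definition cosq :: "real \<Rightarrow> real" where "cosq s = (cos (pi * s))\<^sup>2"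

text \<open>
  Convolution with \<open>(cos^2 \<pi>x_1)^a (cos^2 \<pi>x_2)^b\<close>: a positive kernel, so sup norm and Hoelder seminorm do not
  increase after normalisation, and the result is a trigonometric polynomial.
\<close>

definition smear :: "(real^2 \<Rightarrow> real) \<Rightarrow> nat \<Rightarrow> nat \<Rightarrow> real^2 \<Rightarrow> real" where
  "smear f a b x = torus_integral (\<lambda>y. f y * (cosq (x $ 1 - y $ 1) ^ a * cosq (x $ 2 - y $ 2) ^ b))"

lemma cosq_diff: "cosq (s - t) = (1 + cos (2 * pi * s + 0) * cos (2 * pi * t) + cos (2 * pi * s + (- pi / 2)) * sin (2 * pi * t)) / 2"
proof -
  have "cosq (s - t) = (1 + cos (2 * pi * s - 2 * pi * t)) / 2"
    unfolding cosq_def cos_squared_eq using cos_double_cos[of "pi * (s - t)"]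
    by (simp add: cos_squared_eq right_diff_distrib mult.assoc)
  moreover have "cos (2 * pi * s + (- pi / 2)) = sin (2 * pi * s)" by (simp add: cos_diff)
  ultimately show ?thesis by (simp add: cos_diff)
qed

lemma cosq_cont [continuous_intros]:
  fixes h :: "'a::t2_space \<Rightarrow> real"
  shows "continuous_on S h \<Longrightarrow> continuous_on S (\<lambda>x. cosq (h x))"
  unfolding cosq_def by (auto intro!: continuous_intros)

text \<open>The addition formula separates \<open>x\<close> from \<open>y\<close> in one factor of
  the kernel. The phase - pi / 2 writes the sine as a cosine, so that \<open>trig_mult_cos\<close>
  handles both terms.\<close>

lemma smear_step:
  assumes f: "continuous_on UNIV f" and K: "continuous_on UNIV (\<lambda>y. K x y)"
  shows "torus_integral (\<lambda>y. f y * (cosq (x $ i - y $ i) * K x y)) =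
    (1/2) * (torus_integral (\<lambda>y. f y * K x y)
      + cos (2 * pi * x $ i + 0) * torus_integral (\<lambda>y. (f y * cos (2 * pi * y $ i)) * K x y)
      + cos (2 * pi * x $ i + (- pi / 2)) * torus_integral (\<lambda>y. (f y * sin (2 * pi * y $ i)) * K x y))"
proof -
  have "torus_integral (\<lambda>y. f y * (cosq (x $ i - y $ i) * K x y)) = torus_integral (\<lambda>y. (1/2) * ((f y * K x y
      + cos (2 * pi * x $ i + 0) * ((f y * cos (2 * pi * y $ i)) * K x y))
      + cos (2 * pi * x $ i + (- pi / 2)) * ((f y * sin (2 * pi * y $ i)) * K x y)))"
    unfolding cosq_diff by (simp add: algebra_simps add_divide_distrib)
  also have "\<dots> = (1/2) * (torus_integral (\<lambda>y. f y * K x y)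
      + torus_integral (\<lambda>y. cos (2 * pi * x $ i + 0) * ((f y * cos (2 * pi * y $ i)) * K x y))
      + torus_integral (\<lambda>y. cos (2 * pi * x $ i + (- pi / 2)) * ((f y * sin (2 * pi * y $ i)) * K x y)))"
    unfolding torus_integral_cmult[of "1/2"]
    by (subst torus_integral_add, (intro continuous_intros f K)+)+ simp
  finally show ?thesis unfolding torus_integral_cmult .
qed

text \<open>Induction removes one kernel factor at a time; \<open>f\<close> is arbitrary because
  each removal multiplies it by a cosine or a sine in \<open>y\<close>.\<close>

lemma trig_smear: "continuous_on UNIV f \<Longrightarrow> trig (smear f a b)"
proof (induction a arbitrary: f)
  case 0
  then show ?case
  proof (induction b arbitrary: f)
    case 0
    then show ?case unfolding smear_def[abs_def] by (simp add: trig_const)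
  next
    case (Suc b)
    have c: "continuous_on UNIV (\<lambda>y. f y * cos (2 * pi * y $ 2))" "continuous_on UNIV (\<lambda>y. f y * sin (2 * pi * y $ 2))"
      by (intro continuous_intros Suc.prems)+
    have eq: "smear f 0 (Suc b) = (\<lambda>x. (1/2) * (smear f 0 b x
      + cos (2 * pi * x $ 2 + 0) * smear (\<lambda>y. f y * cos (2 * pi * y $ 2)) 0 b x
      + cos (2 * pi * x $ 2 + (- pi / 2)) * smear (\<lambda>y. f y * sin (2 * pi * y $ 2)) 0 b x))"
    proof
      fix x :: "real^2"
      have "continuous_on UNIV (\<lambda>y::real^2. cosq (x $ 2 - y $ 2) ^ b)"
        by (intro continuous_intros)
      from smear_step[OF Suc.prems, of "\<lambda>x y. cosq (x $ 2 - y $ 2) ^ b" x 2, OF this]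
      show "smear f 0 (Suc b) x = (1/2) * (smear f 0 b x
        + cos (2 * pi * x $ 2 + 0) * smear (\<lambda>y. f y * cos (2 * pi * y $ 2)) 0 b x
        + cos (2 * pi * x $ 2 + (- pi / 2)) * smear (\<lambda>y. f y * sin (2 * pi * y $ 2)) 0 b x)"
        by (simp add: smear_def)
    qed
    show ?case unfolding eq
      by (intro trig_cmult trig_add trig_mult_cos Suc.IH c Suc.prems)
  qed
next
  case (Suc a)
  have c: "continuous_on UNIV (\<lambda>y. f y * cos (2 * pi * y $ 1))" "continuous_on UNIV (\<lambda>y. f y * sin (2 * pi * y $ 1))"
    by (intro continuous_intros Suc.prems)+
  have eq: "smear f (Suc a) b = (\<lambda>x. (1/2) * (smear f a b x
      + cos (2 * pi * x $ 1 + 0) * smear (\<lambda>y. f y * cos (2 * pi * y $ 1)) a b x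
      + cos (2 * pi * x $ 1 + (- pi / 2)) * smear (\<lambda>y. f y * sin (2 * pi * y $ 1)) a b x))"
  proof
    fix x :: "real^2"
    have "continuous_on UNIV (\<lambda>y::real^2. cosq (x $ 1 - y $ 1) ^ a * cosq (x $ 2 - y $ 2) ^ b)"
      by (intro continuous_intros)
    from smear_step[OF Suc.prems, of "\<lambda>x y. cosq (x $ 1 - y $ 1) ^ a * cosq (x $ 2 - y $ 2) ^ b" x 1, OF this]
    show "smear f (Suc a) b x = (1/2) * (smear f a b x
      + cos (2 * pi * x $ 1 + 0) * smear (\<lambda>y. f y * cos (2 * pi * y $ 1)) a b x
      + cos (2 * pi * x $ 1 + (- pi / 2)) * smear (\<lambda>y. f y * sin (2 * pi * y $ 1)) a b x)"
      by (simp add: smear_def mult.assoc)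
  qed
  show ?case unfolding eq
    by (intro trig_cmult trig_add trig_mult_cos Suc.IH c Suc.prems)
qed

abbreviation HB :: "(real^2) set" where "HB \<equiv> cbox (vec (-1/2)) (vec (1/2))"

definition kern :: "nat \<Rightarrow> real^2 \<Rightarrow> real" where "kern n w = cosq (w $ 1) ^ n * cosq (w $ 2) ^ n"

lemma kern_cont: "continuous_on S (kern n)"
  unfolding kern_def[abs_def] by (intro continuous_intros)

lemma cosq_periodic: "cosq (s + of_int k) = cosq s"
proof -
  have "cosq u = (1 + cos (2 * pi * u)) / 2" for u
    using cos_double_cos[of "pi * u"] by (simp add: cosq_def mult.assoc)
  moreover have "cos (2 * pi * (s + of_int k)) = cos (2 * pi * s)"
    by (simp add: distrib_left cos_add cos_int_2pin sin_int_2pin)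
  ultimately show ?thesis by metis
qed

lemma kern_periodic: "periodic (kern n)"
  unfolding periodic_def kern_def using cosq_periodic[of _ 1] by (auto simp: axis_def)

lemma kern_nonneg: "0 \<le> kern n w"
  by (simp add: kern_def cosq_def)

lemma torus_integral_half:
  assumes "periodic q" "continuous_on UNIV q"
  shows "torus_integral q = integral HB q"
proof -
  have "torus_integral q = torus_integral (\<lambda>x. q (x + vec (-1/2)))" by (rule torus_shift[symmetric, OF assms])
  also have "\<dots> = integral (cbox (0 + vec (-1/2)) (1 + vec (-1/2))) q"
    using integral_shift_cbox_plus[of 0 1 q "vec (-1/2)"] by (simp add: torus_integral_def o_def add.commute)
  also have "cbox (0 + vec (-1/2)) (1 + vec (-1/2)) = HB"
    by (rule arg_cong2[where f=cbox]) (simp_all add: vec_eq_iff)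
  finally show ?thesis .
qed

text \<open>Passage to the centred cell, in which the kernel has its single peak at 0.\<close>

lemma smear_eq:
  assumes "periodic f" "continuous_on UNIV f"
  shows "smear f n n x = integral HB (\<lambda>w. f (x + w) * kern n w)"
proof -
  have cq: "continuous_on UNIV (\<lambda>y. f y * kern n (y - x))"
    by (intro continuous_intros assms cont_shift[OF kern_cont])
  have pq: "periodic (\<lambda>y. f y * kern n (y - x))"
    using periodic_shift[OF kern_periodic, of n "- x"] by (intro periodic_compose2[where F="(*)"] assms) auto
  have even: "cosq (s - t) = cosq (t - s)" for s t
    unfolding cosq_def by (metis cos_minus minus_diff_eq mult_minus_right)
  have "smear f n n x = torus_integral (\<lambda>y. f y * kern n (y - x))"
    unfolding smear_def kern_def by (simp add: even[of "x $ _"])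
  also have "\<dots> = torus_integral (\<lambda>y. f (y + x) * kern n (y + x - x))"
    by (rule torus_shift[symmetric, OF pq cq])
  also have "\<dots> = torus_integral (\<lambda>y. f (x + y) * kern n y)" by (simp add: add.commute)
  also have "\<dots> = integral HB (\<lambda>y. f (x + y) * kern n y)"
  proof (rule torus_integral_half)
    show "periodic (\<lambda>y. f (x + y) * kern n y)"
      using periodic_shift[OF assms(1), of x]
      by (intro periodic_compose2[where F="(*)"] kern_periodic) (simp add: add.commute)
    show "continuous_on UNIV (\<lambda>y. f (x + y) * kern n y)"
      by (intro continuous_intros kern_cont cont_shift[OF assms(2)])
  qed
  finally show ?thesis .
qed

lemma HB_abs: "w \<in> HB \<Longrightarrow> \<bar>w $ i\<bar> \<le> 1/2"
proof -
  assume "w \<in> HB"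
  then have "- (1/2) \<le> w $ i \<and> w $ i \<le> 1/2" by (simp add: mem_box_cart)
  then show ?thesis by linarith
qed

lemma HB_norm: "w \<in> HB \<Longrightarrow> norm w \<le> 1"
proof -
  assume "w \<in> HB"
  then have "(w $ 1)\<^sup>2 \<le> (1/2)\<^sup>2" "(w $ 2)\<^sup>2 \<le> (1/2)\<^sup>2" using HB_abs abs_sq_le by metis+
  then have "w \<bullet> w \<le> 1\<^sup>2" by (simp add: inner2 power2_eq_square)
  then show ?thesis by (simp add: norm_le_square)
qed

lemma cosq_mono:
  assumes "\<bar>s\<bar> \<le> \<bar>t\<bar>" "\<bar>t\<bar> \<le> 1/2"
  shows "cosq t \<le> cosq s"
proof -
  have a: "cosq u = (cos (pi * \<bar>u\<bar>))\<^sup>2" for u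
    unfolding cosq_def by (cases "u \<ge> 0") (auto simp: abs_if)
  have "pi * \<bar>t\<bar> \<le> pi * (1/2)" by (intro mult_left_mono) (use assms in auto)
  then have "cos (pi * \<bar>t\<bar>) \<ge> 0" by (intro cos_ge_zero) (auto intro: order_trans[of _ 0])
  moreover have "cos (pi * \<bar>t\<bar>) \<le> cos (pi * \<bar>s\<bar>)"
    using assms \<open>pi * \<bar>t\<bar> \<le> pi * (1/2)\<close> pi_ge_zero
    by (intro cos_monotone_0_pi_le mult_left_mono) auto
  ultimately show ?thesis unfolding a by (intro power_mono) auto
qed

lemma cosq_bounds: "0 \<le> cosq s" "cosq s \<le> 1"
  by (auto simp: cosq_def abs_square_le_1)

text \<open>Away from 0 the kernel is at most q^n, while its integral is at least a constant times
  q'^n with q < q', so the far part loses exponentially against the total mass. Near 0 the weight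
  |w|^\<gamma> is at most e / 2.\<close>

lemma kern_concentration:
  assumes \<gamma>: "0 < \<gamma>" "\<gamma> < (1::real)" and e: "e > 0"
  shows "\<exists>n. integral HB (kern n) > 0 \<and> integral HB (\<lambda>w. norm w powr \<gamma> * kern n w) \<le> e * integral HB (kern n)"
proof -
  define d where "d = min (1/2) ((e / 2) powr (1 / \<gamma>))"
  have d: "0 < d" "d \<le> 1/2" using e by (auto simp: d_def)
  have dg: "d powr \<gamma> \<le> e / 2"
  proof -
    have "d powr \<gamma> \<le> ((e / 2) powr (1 / \<gamma>)) powr \<gamma>"
      using d \<gamma> by (intro powr_mono2) (auto simp: d_def)
    also have "\<dots> = e / 2" using e \<gamma> by (simp add: powr_powr)
    finally show ?thesis .
  qed
  \<comment> \<open>If |w| \<ge> d, some coordinate is at least d / 2 in modulus, so one of the two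
    base factors is at most \<open>q\<close>.\<close>
  define q where "q = cosq (d / 2)"
  have q1: "q < 1"
  proof -
    have "cos (pi * (d / 2)) < cos 0" using d by (intro cos_monotone_0_pi) auto
    moreover have "0 \<le> cos (pi * (d / 2))" using d by (intro cos_ge_zero) (auto intro: order_trans[of _ 0])
    ultimately have "(cos (pi * (d / 2)))\<^sup>2 < 1\<^sup>2" by (intro power_strict_mono) auto
    then show ?thesis by (simp add: q_def cosq_def)
  qed
  have q0: "0 \<le> q" by (simp add: q_def cosq_bounds)
  \<comment> \<open>This yields a square around 0 on which the product of both base factors exceeds
    \<open>q\<close>; it supplies the lower bound for the total mass.\<close>
  have "((\<lambda>s. cosq s * cosq s) \<longlongrightarrow> 1) (at_right 0)"
    unfolding cosq_def by (auto intro!: tendsto_eq_intros)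
  then have "eventually (\<lambda>s. q < cosq s * cosq s) (at_right 0)" using q1 by (rule order_tendstoD)
  moreover have "eventually (\<lambda>s. s \<in> {0<..<1/2::real}) (at_right 0)" by (rule eventually_at_right_real) simp
  ultimately have "eventually (\<lambda>s. q < cosq s * cosq s \<and> s \<in> {0<..<1/2}) (at_right 0)" by (rule eventually_conj)
  then have "\<exists>s. q < cosq s * cosq s \<and> s \<in> {0<..<1/2}" by (rule eventually_happens'[rotated]) simp
  then obtain s where s: "q < cosq s * cosq s" "0 < s" "s < 1/2" by auto
  define q' where "q' = cosq s * cosq s"
  have q'0: "q' > 0" using s q0 by (simp add: q'_def)
  have I: "integral HB (kern n) \<ge> (2 * s)\<^sup>2 * q' ^ n" for n
  proof -
    let ?S = "cbox (vec (- s)) (vec s) :: (real^2) set"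
    have "(0::real^2) \<in> ?S" using s by (simp add: mem_box_cart)
    then have c: "measure lborel ?S = (2 * s)\<^sup>2"
      using s by (subst content_cbox_if_cart) (auto simp: prod_2 UNIV_2 power2_eq_square)
    have "(2 * s)\<^sup>2 * q' ^ n = integral ?S (\<lambda>w. q' ^ n)" using c by simp
    also have "\<dots> \<le> integral ?S (kern n)"
    proof (rule integral_le)
      fix w assume "w \<in> ?S"
      then have "\<bar>w $ i\<bar> \<le> s" for i by (auto simp: mem_box_cart abs_le_iff) (metis minus_le_iff)
      then have "cosq s \<le> cosq (w $ i)" for i using s by (intro cosq_mono) (auto intro: order_trans)
      then have "cosq s ^ n * cosq s ^ n \<le> cosq (w $ 1) ^ n * cosq (w $ 2) ^ n"
        by (intro mult_mono power_mono) (auto simp: cosq_bounds)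
      then show "q' ^ n \<le> kern n w" by (simp add: q'_def kern_def power_mult_distrib)
    qed (auto intro!: integrable_cont kern_cont)
    also have "\<dots> \<le> integral HB (kern n)"
    proof (rule integral_subset_le)
      show "?S \<subseteq> HB" unfolding subset_iff mem_box_cart
      proof (intro allI impI)
        fix t :: "real^2" and i assume "\<forall>i. vec (- s) $ i \<le> t $ i \<and> t $ i \<le> vec s $ i"
        then have "- s \<le> t $ i \<and> t $ i \<le> s" by (metis vec_component)
        then show "vec (-1/2) $ i \<le> t $ i \<and> t $ i \<le> vec (1/2) $ i" using s by simp
      qed
    qed (auto simp: kern_nonneg intro!: integrable_cont kern_cont)
    finally show ?thesis .
  qed
  have "(\<lambda>n. (q / q') ^ n) \<longlonglongrightarrow> 0"
    using q0 q'0 s by (intro LIMSEQ_power_zero) (auto simp: q'_def)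
  then have "eventually (\<lambda>n. (q / q') ^ n < e / 2 * (2 * s)\<^sup>2) sequentially"
    using e s by (intro order_tendstoD) auto
  then obtain n where n: "(q / q') ^ n < e / 2 * (2 * s)\<^sup>2" by (metis eventually_happens' sequentially_bot)
  have qn: "q ^ n \<le> e / 2 * integral HB (kern n)"
  proof -
    have "q ^ n = (q / q') ^ n * q' ^ n" using q'0 by (simp add: power_divide)
    also have "\<dots> \<le> (e / 2 * (2 * s)\<^sup>2) * q' ^ n" using n q'0 by (intro mult_right_mono) auto
    also have "\<dots> \<le> e / 2 * integral HB (kern n)" using mult_left_mono[OF I[of n], of "e / 2"] e by (simp add: mult_ac)
    finally show ?thesis .
  qed
  have pos: "integral HB (kern n) > 0"
    by (rule less_le_trans[OF _ I]) (use s q'0 in simp)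
  have hb: "(0::real^2) \<in> HB" by (simp add: mem_box_cart)
  then have c: "measure lborel HB = 1" by (subst content_cbox_if_cart) (auto simp: prod_2 UNIV_2)
  have "integral HB (\<lambda>w. norm w powr \<gamma> * kern n w) \<le> integral HB (\<lambda>w. (e / 2) * kern n w + q ^ n)"
  proof (rule integral_le)
    fix w assume w: "w \<in> HB"
    show "norm w powr \<gamma> * kern n w \<le> (e / 2) * kern n w + q ^ n"
    proof (cases "norm w < d")
      case True
      have "norm w powr \<gamma> \<le> d powr \<gamma>" using True \<gamma> by (intro powr_mono2) auto
      then have "norm w powr \<gamma> * kern n w \<le> (e / 2) * kern n w"
        using dg by (intro mult_right_mono kern_nonneg) simp
      moreover have "0 \<le> q ^ n" using q0 by simp
      ultimately show ?thesis by linarith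
    next
      case False
      have "\<exists>i. \<bar>w $ i\<bar> \<ge> d / 2"
      proof (rule ccontr)
        assume "\<nexists>i. d / 2 \<le> \<bar>w $ i\<bar>"
        then have "\<bar>w $ 1\<bar> < d / 2" "\<bar>w $ 2\<bar> < d / 2" by (auto simp: not_le)
        then show False using norm_le_l1_cart[of w] False by (simp add: sum_2)
      qed
      then obtain i where i: "\<bar>w $ i\<bar> \<ge> d / 2" by blast
      have "cosq (w $ i) \<le> q" unfolding q_def using i HB_abs[OF w, of i] d by (intro cosq_mono) auto
      then have qi: "cosq (w $ i) ^ n \<le> q ^ n" by (intro power_mono cosq_bounds)
      have le1: "cosq (w $ k) ^ n \<le> 1" for k by (intro power_le_one cosq_bounds)
      have "kern n w \<le> q ^ n"
      proof -
        have "i = 1 \<or> i = 2" by (rule exhaust_2)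
        then show ?thesis
        proof
          assume "i = 1"
          then have "kern n w \<le> q ^ n * 1" unfolding kern_def using qi le1[of 2]
            by (intro mult_mono) (auto simp: cosq_bounds q0)
          then show ?thesis by simp
        next
          assume "i = 2"
          then have "kern n w \<le> 1 * q ^ n" unfolding kern_def using qi le1[of 1]
            by (intro mult_mono) (auto simp: cosq_bounds q0)
          then show ?thesis by simp
        qed
      qed
      moreover have "norm w powr \<gamma> \<le> 1" using HB_norm[OF w] \<gamma> by (intro powr_le1) auto
      ultimately have "norm w powr \<gamma> * kern n w \<le> 1 * q ^ n" by (intro mult_mono kern_nonneg) auto
      moreover have "0 \<le> (e / 2) * kern n w" using e kern_nonneg by simp
      ultimately show ?thesis by linarith
    qed
  qed (use \<gamma> in \<open>auto intro!: integrable_cont continuous_intros continuous_on_powr' kern_cont\<close>)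
  also have "\<dots> = (e / 2) * integral HB (kern n) + q ^ n"
    using c by (subst integral_add) (auto intro!: integrable_cont continuous_intros kern_cont)
  also have "\<dots> \<le> e * integral HB (kern n)" using qn by simp
  finally show ?thesis using pos by blast
qed

text \<open>The bounds for \<open>f'\<close> are independent of \<open>e\<close>, which is essential
  because the error is driven to 0 along the Picard iteration. The number \<open>m\<close> is the
  mean of \<open>f'\<close>.\<close>

lemma smooth_poisson:
  assumes f: "periodic f" "continuous_on UNIV f" and F: "\<And>x. \<bar>f x\<bar> \<le> F"
    and S: "holder \<gamma> S f" "0 \<le> S" and \<gamma>: "0 < \<gamma>" "\<gamma> < 1" and e: "e > 0"
  shows "\<exists>g H m f'. pot g H \<and> (\<forall>x. tr2 (H x) = f' x - m) \<and> (\<forall>x. \<bar>f' x\<bar> \<le> F) \<and> holder \<gamma> S f' \<and> (\<forall>x. \<bar>f' x - f x\<bar> \<le> e)"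
proof -
  \<comment> \<open>S + 1 rather than S, because the seminorm bound S may be 0.\<close>
  have "e / (S + 1) > 0" using e S(2) by simp
  from kern_concentration[OF \<gamma> this] obtain n where n: "integral HB (kern n) > 0"
    "integral HB (\<lambda>w. norm w powr \<gamma> * kern n w) \<le> (e / (S + 1)) * integral HB (kern n)" by blast
  define I where "I = integral HB (kern n)"
  define f' where "f' = (\<lambda>x. (1 / I) * smear f n n x)"
  have I0: "I > 0" using n by (simp add: I_def)
  have ci: "(\<lambda>w. f (x + w) * kern n w) integrable_on HB" for x
    by (intro integrable_cont continuous_intros kern_cont cont_shift[OF f(2)])
  have key: "\<bar>(1 / I) * integral HB (\<lambda>w. q w * kern n w)\<bar> \<le> b"
    if q: "continuous_on UNIV q" and b: "\<And>w. \<bar>q w\<bar> \<le> b" for q b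
  proof -
    have "\<bar>integral HB (\<lambda>w. q w * kern n w)\<bar> \<le> integral HB (\<lambda>w. b * kern n w)"
      unfolding real_norm_def[symmetric]
      by (rule integral_norm_bound_integral)
        (auto intro!: integrable_cont continuous_intros kern_cont q mult_right_mono b simp: abs_mult kern_nonneg)
    also have "\<dots> = b * I" by (simp add: I_def)
    finally show ?thesis using I0 by (simp add: abs_mult field_simps)
  qed
  have t: "trig f'" unfolding f'_def by (intro trig_cmult trig_smear f)
  have fe: "f' x = (1 / I) * integral HB (\<lambda>w. f (x + w) * kern n w)" for x
    by (simp add: f'_def smear_eq[OF f])
  have 1: "\<bar>f' x\<bar> \<le> F" for x
    unfolding fe by (rule key) (auto intro!: F cont_shift[OF f(2)] continuous_intros)
  have 2: "holder \<gamma> S f'"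
    unfolding holder_def
  proof (intro allI)
    fix x y :: "real^2"
    have "f' x - f' y = (1 / I) * integral HB (\<lambda>w. (f (x + w) - f (y + w)) * kern n w)"
      unfolding fe right_diff_distrib[symmetric] left_diff_distrib
      by (subst integral_diff, rule ci, rule ci, rule refl)
    also have "\<bar>\<dots>\<bar> \<le> S * norm (x - y) powr \<gamma>"
    proof (rule key)
      show "\<bar>f (x + w) - f (y + w)\<bar> \<le> S * norm (x - y) powr \<gamma>" for w
        using S(1) unfolding holder_def by (metis add_diff_cancel_right)
    qed (intro continuous_intros cont_shift[OF f(2)])
    finally show "\<bar>f' x - f' y\<bar> \<le> S * norm (x - y) powr \<gamma>" .
  qed
  have 3: "\<bar>f' x - f x\<bar> \<le> e" for x
  proof -
    have "f x = (1 / I) * integral HB (\<lambda>w. f x * kern n w)" using I0 by (simp add: I_def)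
    then have "f' x - f x = (1 / I) * (integral HB (\<lambda>w. f (x + w) * kern n w) - integral HB (\<lambda>w. f x * kern n w))"
      by (simp add: fe right_diff_distrib)
    also have "\<dots> = (1 / I) * integral HB (\<lambda>w. (f (x + w) - f x) * kern n w)"
      unfolding left_diff_distrib
      by (subst integral_diff, rule ci, intro integrable_cont continuous_intros kern_cont, rule refl)
    finally have d: "f' x - f x = (1 / I) * integral HB (\<lambda>w. (f (x + w) - f x) * kern n w)" .
    have "\<bar>integral HB (\<lambda>w. (f (x + w) - f x) * kern n w)\<bar> \<le> integral HB (\<lambda>w. S * (norm w powr \<gamma> * kern n w))"
      unfolding real_norm_def[symmetric]
    proof (rule integral_norm_bound_integral)
      show "norm ((f (x + w) - f x) * kern n w) \<le> S * (norm w powr \<gamma> * kern n w)" for w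
      proof -
        have "\<bar>f (x + w) - f x\<bar> \<le> S * norm w powr \<gamma>"
          using S(1) unfolding holder_def by (metis add_diff_cancel_left')
        then show ?thesis using kern_nonneg[of n w] by (simp add: abs_mult mult_right_mono mult.assoc[symmetric])
      qed
    qed (use \<gamma> in \<open>auto intro!: integrable_cont continuous_intros continuous_on_powr' kern_cont cont_shift[OF f(2)]\<close>)
    also have "\<dots> \<le> S * ((e / (S + 1)) * I)"
      using mult_left_mono[OF n(2) S(2)] by (simp add: I_def)
    also have "\<dots> \<le> e * I"
    proof -
      have "S * (e / (S + 1)) \<le> e" using e S(2) by (simp add: field_simps)
      then show ?thesis using mult_right_mono[of "S * (e / (S + 1))" e I] I0 by simp
    qed
    finally show ?thesis unfolding d using I0 by (simp add: abs_mult field_simps)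
  qed
  from trig_poisson[OF t] 1 2 3 show ?thesis by blast
qed

section \<open>The Monge-Ampere equation near the identity\<close>

definition det2 :: "real^2^2 \<Rightarrow> real" where "det2 A = A $ 1 $ 1 * A $ 2 $ 2 - A $ 1 $ 2 * A $ 2 $ 1"

lemma det2_cont: "pot g H \<Longrightarrow> continuous_on UNIV (\<lambda>x. det2 (H x))"
  unfolding det2_def by (intro continuous_intros pot_cont)

text \<open>Compatibility condition of the iteration: subtracting \<epsilon> times the determinant
  from \<rho> keeps the mean 0.\<close>

lemma pot_det_zero:
  assumes "pot g H" shows "torus_integral (\<lambda>x. det2 (H x)) = 0"
  unfolding det2_def
  using pot_null[OF assms assms, of 1 2] pot_sym[OF assms, of _ 2 1]
  by (subst torus_integral_diff) (auto intro!: continuous_intros pot_cont[OF assms])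

lemma abs_mult_diff_le:
  fixes a b a' b' :: real
  assumes "\<bar>b\<bar> \<le> K" "\<bar>a'\<bar> \<le> K"
  shows "\<bar>a * b - a' * b'\<bar> \<le> K * (\<bar>a - a'\<bar> + \<bar>b - b'\<bar>)"
proof -
  have "a * b - a' * b' = (a - a') * b + a' * (b - b')" by (simp add: algebra_simps)
  also have "\<bar>\<dots>\<bar> \<le> \<bar>a - a'\<bar> * \<bar>b\<bar> + \<bar>a'\<bar> * \<bar>b - b'\<bar>" using abs_triangle_ineq by (metis abs_mult)
  also have "\<dots> \<le> \<bar>a - a'\<bar> * K + K * \<bar>b - b'\<bar>" by (intro add_mono mult_mono assms) (use assms in auto)
  finally show ?thesis by (simp add: algebra_simps)
qed

lemma det2_diff_le:
  assumes "\<And>i j. \<bar>A $ i $ j\<bar> \<le> K" "\<And>i j. \<bar>B $ i $ j\<bar> \<le> K"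
  shows "\<bar>det2 A - det2 B\<bar> \<le> K * (\<bar>(A - B) $ 1 $ 1\<bar> + \<bar>(A - B) $ 2 $ 2\<bar> + \<bar>(A - B) $ 1 $ 2\<bar> + \<bar>(A - B) $ 2 $ 1\<bar>)"
proof -
  have "\<bar>A $ 1 $ 1 * A $ 2 $ 2 - B $ 1 $ 1 * B $ 2 $ 2\<bar> \<le> K * (\<bar>(A - B) $ 1 $ 1\<bar> + \<bar>(A - B) $ 2 $ 2\<bar>)"
    "\<bar>A $ 1 $ 2 * A $ 2 $ 1 - B $ 1 $ 2 * B $ 2 $ 1\<bar> \<le> K * (\<bar>(A - B) $ 1 $ 2\<bar> + \<bar>(A - B) $ 2 $ 1\<bar>)"
    using abs_mult_diff_le[OF assms(1) assms(2)] by simp_all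
  then show ?thesis unfolding det2_def distrib_left by linarith
qed

lemma det2_bound: "(\<And>i j. \<bar>A $ i $ j\<bar> \<le> K) \<Longrightarrow> \<bar>det2 A\<bar> \<le> 2 * K\<^sup>2"
proof -
  assume a: "\<And>i j. \<bar>A $ i $ j\<bar> \<le> K"
  have "\<bar>A $ 1 $ 1 * A $ 2 $ 2\<bar> \<le> K * K" "\<bar>A $ 1 $ 2 * A $ 2 $ 1\<bar> \<le> K * K"
    unfolding abs_mult using a order_trans[OF abs_ge_zero a] by (auto intro!: mult_mono)
  then show ?thesis unfolding det2_def power2_eq_square by linarith
qed

lemma sum4_sq_le: "(\<bar>a\<bar> + \<bar>d\<bar> + \<bar>b\<bar> + \<bar>c\<bar>)\<^sup>2 \<le> 4 * (a\<^sup>2 + b\<^sup>2 + c\<^sup>2 + (d::real)\<^sup>2)"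
proof -
  have "0 \<le> (\<bar>a\<bar> - \<bar>b\<bar>)\<^sup>2 + (\<bar>a\<bar> - \<bar>c\<bar>)\<^sup>2 + (\<bar>a\<bar> - \<bar>d\<bar>)\<^sup>2 + (\<bar>b\<bar> - \<bar>c\<bar>)\<^sup>2 + (\<bar>b\<bar> - \<bar>d\<bar>)\<^sup>2 + (\<bar>c\<bar> - \<bar>d\<bar>)\<^sup>2"
    by simp
  then show ?thesis by (simp add: power2_eq_square algebra_simps)
qed

text \<open>Pointwise form of the contraction: Cauchy-Schwarz over the four entries accounts for the
  factor 4.\<close>

lemma det2_diff_sq:
  assumes "\<And>i j. \<bar>A $ i $ j\<bar> \<le> K" "\<And>i j. \<bar>B $ i $ j\<bar> \<le> K"
  shows "(det2 A - det2 B)\<^sup>2 \<le> 4 * K\<^sup>2 * sqn (A - B)"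
proof -
  let ?s = "\<bar>(A - B) $ 1 $ 1\<bar> + \<bar>(A - B) $ 2 $ 2\<bar> + \<bar>(A - B) $ 1 $ 2\<bar> + \<bar>(A - B) $ 2 $ 1\<bar>"
  have "(det2 A - det2 B)\<^sup>2 \<le> (K * ?s)\<^sup>2" by (intro abs_sq_le det2_diff_le assms)
  also have "\<dots> = K\<^sup>2 * ?s\<^sup>2" by (simp add: power_mult_distrib)
  also have "\<dots> \<le> K\<^sup>2 * (4 * sqn (A - B))"
    unfolding sqn_def by (intro mult_left_mono sum4_sq_le) simp
  finally show ?thesis by simp
qed

lemma holder_det2:
  assumes "\<And>x i j. \<bar>H x $ i $ j\<bar> \<le> K" "\<And>i j. holder \<gamma> N (\<lambda>x. H x $ i $ j)"
  shows "holder \<gamma> (4 * K * N) (\<lambda>x. det2 (H x))"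
  unfolding holder_def
proof (intro allI)
  fix x y :: "real^2"
  have K: "0 \<le> K" using assms(1)[of x 1 1] by linarith
  have h: "\<bar>(H x - H y) $ i $ j\<bar> \<le> N * norm (x - y) powr \<gamma>" for i j
    using assms(2) by (simp add: holder_def)
  have "\<bar>det2 (H x) - det2 (H y)\<bar> \<le> K * (\<bar>(H x - H y) $ 1 $ 1\<bar> + \<bar>(H x - H y) $ 2 $ 2\<bar> + \<bar>(H x - H y) $ 1 $ 2\<bar> + \<bar>(H x - H y) $ 2 $ 1\<bar>)"
    by (rule det2_diff_le) (rule assms(1))+
  also have "\<dots> \<le> K * (4 * (N * norm (x - y) powr \<gamma>))"
    using h[of 1 1] h[of 2 2] h[of 1 2] h[of 2 1] K by (intro mult_left_mono) linarith+
  finally show "\<bar>det2 (H x) - det2 (H y)\<bar> \<le> 4 * K * N * norm (x - y) powr \<gamma>" by (simp add: mult_ac)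
qed

lemma holder_add: "holder \<gamma> S p \<Longrightarrow> holder \<gamma> S' q \<Longrightarrow> holder \<gamma> (S + S') (\<lambda>x. p x + q x)"
  unfolding holder_def distrib_right by (smt (verit))
lemma holder_cmult: "holder \<gamma> S p \<Longrightarrow> holder \<gamma> (\<bar>c\<bar> * S) (\<lambda>x. c * p x)"
  unfolding holder_def by (auto simp: right_diff_distrib[symmetric] abs_mult mult.assoc intro!: mult_left_mono)
lemma holder_mono: "holder \<gamma> S p \<Longrightarrow> S \<le> S' \<Longrightarrow> holder \<gamma> S' p"
  unfolding holder_def by (meson mult_right_mono order_trans powr_ge_zero)
lemma holder_shift_const: "holder \<gamma> S p \<Longrightarrow> holder \<gamma> S (\<lambda>x. p x - c)"
  unfolding holder_def by simp

text \<open>This is 1 + ln (1 + S / M), the logarithmic loss in the endpoint estimate for second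
  derivatives; for M > 0 and S \<ge> 0 it is at least 1.\<close>

definition lamb :: "real \<Rightarrow> real \<Rightarrow> real" where "lamb M S = 1 + ln ((S + M) / M)"

lemma lamb_ge: "0 < M \<Longrightarrow> 0 \<le> S \<Longrightarrow> lamb M S \<ge> 1"
  unfolding lamb_def by simp

text \<open>The scale is chosen with d^\<gamma> \<le> M / (S + M): the Hoelder term shrinks to the
  size of M and ln (1 / d) becomes a multiple of \<open>lamb M S\<close>. The bounds 4 M and 2 (S +
  4 M) are tailored to \<open>picard_step\<close>, and 322560 = 10080 (24 + 8).\<close>

lemma pot_log_bound:
  assumes p: "pot g H" and F: "\<And>x. \<bar>tr2 (H x)\<bar> \<le> 4 * M" "M > 0"
    and S: "holder \<gamma> (2 * (S + 4 * M)) (\<lambda>x. tr2 (H x))" "0 \<le> S" and \<gamma>: "0 < \<gamma>" "\<gamma> < 1"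
  shows "\<bar>H x $ i $ j\<bar> \<le> (322560 / \<gamma>) * M * lamb M S"
proof -
  define d where "d = (1/6) * (M / (S + M)) powr (1 / \<gamma>)"
  have q: "0 < M / (S + M)" "M / (S + M) \<le> 1" using F(2) S(2) by (auto simp: field_simps)
  have "\<bar>M / (S + M)\<bar> \<le> 1" using q by linarith
  then have "(M / (S + M)) powr (1 / \<gamma>) \<le> 1" using q(1) \<gamma> by (intro powr_le1) auto
  then have d: "0 < d" "d \<le> 1/6" using q by (auto simp: d_def)
  have dg: "d powr \<gamma> \<le> M / (S + M)"
  proof -
    have "(u powr (1 / \<gamma>)) powr \<gamma> = u" if "0 < u" for u using that \<gamma> by (simp add: powr_powr)
    from this[OF q(1)] have "d powr \<gamma> = (1/6) powr \<gamma> * (M / (S + M))"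
      unfolding d_def by (subst powr_mult) (use q in simp_all)
    also have "\<dots> \<le> 1 * (M / (S + M))" using q \<gamma> by (intro mult_right_mono powr_le1) auto
    finally show ?thesis by simp
  qed
  have L: "1 \<le> lamb M S" using F(2) S(2) by (rule lamb_ge)
  have ld: "1 + ln (1 / d) \<le> 6 * lamb M S / \<gamma>"
  proof -
    have "ln d = ln (1/6) + (1 / \<gamma>) * ln (M / (S + M))"
      unfolding d_def using q by (subst ln_mult) (auto simp: ln_powr)
    also have "ln (M / (S + M)) = 1 - lamb M S"
      unfolding lamb_def using F(2) S(2) by (simp add: ln_div)
    also have "ln (1/6) = - ln (6::real)" by (simp add: ln_div)
    also have "- ln 6 + (1 / \<gamma>) * (1 - lamb M S) = - ln 6 - (1 / \<gamma>) * (lamb M S - 1)" by (simp add: algebra_simps)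
    finally have "ln d = - ln 6 - (1 / \<gamma>) * (lamb M S - 1)" .
    moreover have "ln (6::real) \<le> 5" using ln_le_minus_one[of 6] by simp
    moreover have "ln (1 / d) = - ln d" using d by (simp add: ln_div)
    ultimately have "1 + ln (1 / d) \<le> 6 + (1 / \<gamma>) * (lamb M S - 1)" by linarith
    also have "\<dots> \<le> 6 * (1 / \<gamma>) + 6 * (1 / \<gamma>) * (lamb M S - 1)"
    proof (intro add_mono mult_right_mono)
      have g1: "1 \<le> 1 / \<gamma>" using \<gamma> by simp
      show "6 \<le> 6 * (1 / \<gamma>)" using g1 by linarith
      show "1 / \<gamma> \<le> 6 * (1 / \<gamma>)" using g1 by linarith
      show "0 \<le> lamb M S - 1" using L by simp
    qed
    also have "\<dots> = 6 * lamb M S / \<gamma>" by (simp add: algebra_simps diff_divide_distrib)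
    finally show ?thesis .
  qed
  have "\<bar>H x $ i $ j\<bar> \<le> 10080 * ((4 * M) * (1 + ln (1 / d)) + (2 * (S + 4 * M)) * d powr \<gamma> / \<gamma>)"
    by (rule pot_log_estimate[OF p F(1) _ S(1) _ \<gamma> d]) (use F S in auto)
  also have "\<dots> \<le> 10080 * ((4 * M) * (6 * lamb M S / \<gamma>) + 8 * M * lamb M S / \<gamma>)"
  proof (intro mult_left_mono add_mono divide_right_mono ld)
    have "2 * (S + 4 * M) * d powr \<gamma> \<le> (8 * (S + M)) * (M / (S + M))"
      by (rule mult_mono) (use dg F(2) S(2) in auto)
    also have "\<dots> = 8 * M" using F(2) S(2) by (simp add: field_simps)
    also have "\<dots> \<le> 8 * M * lamb M S" using L F(2) by simp
    finally show "2 * (S + 4 * M) * d powr \<gamma> \<le> 8 * M * lamb M S" .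
  qed (use F \<gamma> in auto)
  also have "\<dots> = (322560 / \<gamma>) * M * lamb M S" by (simp add: field_simps)
  finally show ?thesis .
qed

text \<open>The invariant set of the iteration. The normalisation g 0 = 0 fixes the additive
  constant, so that uniform convergence of the Jacobians forces convergence of the fields in
  \<open>pot_limit\<close>.\<close>

definition good :: "real \<Rightarrow> real \<Rightarrow> real \<Rightarrow> (real^2 \<Rightarrow> real^2) \<Rightarrow> (real^2 \<Rightarrow> real^2^2) \<Rightarrow> bool" where
  "good \<gamma> K N g H \<longleftrightarrow> pot g H \<and> g 0 = 0 \<and> (\<forall>x i j. \<bar>H x $ i $ j\<bar> \<le> K) \<and> (\<forall>i j. holder \<gamma> N (\<lambda>x. H x $ i $ j))"

text \<open>\<open>K\<close> and \<open>N\<close> are what the linear estimates give for a trace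
  bounded by 4 M with seminorm 2 S + 4 M. The conditions \<open>c1\<close> and \<open>c2\<close>
  keep \<epsilon> times the determinant of the previous iterate inside that margin, in sup norm and
  seminorm respectively.\<close>

lemma picard_step:
  assumes \<gamma>: "0 < \<gamma>" "\<gamma> < 1" and M: "M > 0" and S: "S \<ge> 0" and \<epsilon>: "\<epsilon> > 0"
    and \<rho>: "periodic \<rho>" "continuous_on UNIV \<rho>" "torus_integral \<rho> = 0" "\<And>x. \<bar>\<rho> x\<bar> \<le> M" "holder \<gamma> S \<rho>"
    and K: "K = (322560 / \<gamma>) * M * lamb M S" and N: "N = 2 * sch \<gamma> * (S + 4 * M)"
    and c1: "2 * \<epsilon> * K\<^sup>2 \<le> M" and c2: "8 * sch \<gamma> * \<epsilon> * K \<le> 1"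
    and g: "good \<gamma> K N g H" and e: "e > 0"
  shows "\<exists>g' H'. good \<gamma> K N g' H' \<and> (\<forall>x. \<bar>tr2 (H' x) - (\<rho> x - \<epsilon> * det2 (H x))\<bar> \<le> e)"
proof -
  have p: "pot g H" and Kb: "\<And>x i j. \<bar>H x $ i $ j\<bar> \<le> K" and Nb: "\<And>i j. holder \<gamma> N (\<lambda>x. H x $ i $ j)"
    using g by (auto simp: good_def)
  let ?f = "\<lambda>x. \<rho> x - \<epsilon> * det2 (H x)"
  have K0: "K \<ge> 0" using Kb[of 0 1 1] by linarith
  have sc: "sch \<gamma> > 0" using sch_ge[OF \<gamma>] by simp
  have N0: "N \<ge> 0" using sc S M by (simp add: N)
  have cf: "continuous_on UNIV ?f" by (intro continuous_intros \<rho> det2_cont[OF p])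
  have pf: "periodic ?f"
    using \<rho>(1) periodic_compose[OF pot_periodic[OF p], of det2] by (simp add: periodic_def)
  have F: "\<bar>?f x\<bar> \<le> 2 * M" for x
  proof -
    have "\<bar>\<epsilon> * det2 (H x)\<bar> \<le> \<epsilon> * (2 * K\<^sup>2)"
      using det2_bound[of "H x" K] Kb \<epsilon> by (simp add: abs_mult)
    then show ?thesis using \<rho>(4)[of x] c1 by linarith
  qed
  have h: "holder \<gamma> (2 * S + 4 * M) ?f"
  proof -
    have "holder \<gamma> (S + \<bar>- \<epsilon>\<bar> * (4 * K * N)) (\<lambda>x. \<rho> x + (- \<epsilon>) * det2 (H x))"
      by (intro holder_add \<rho> holder_cmult holder_det2 Kb Nb)
    moreover have "\<epsilon> * (4 * K * N) \<le> S + 4 * M"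
    proof -
      have "\<epsilon> * (4 * K * N) = (8 * sch \<gamma> * \<epsilon> * K) * (S + 4 * M)" by (simp add: N)
      also have "\<dots> \<le> 1 * (S + 4 * M)" using c2 S M by (intro mult_right_mono) auto
      finally show ?thesis by simp
    qed
    then have "S + \<bar>- \<epsilon>\<bar> * (4 * K * N) \<le> 2 * S + 4 * M" using \<epsilon> by simp
    ultimately have "holder \<gamma> (2 * S + 4 * M) (\<lambda>x. \<rho> x + (- \<epsilon>) * det2 (H x))" by (rule holder_mono)
    then show ?thesis by simp
  qed
  have mean: "torus_integral ?f = 0"
    by (subst torus_integral_diff)
      (auto intro!: continuous_intros \<rho> det2_cont[OF p] simp: torus_integral_cmult pot_det_zero[OF p] \<rho>)
  have "e / 2 > 0" using e by simp
  from smooth_poisson[OF pf cf F h _ \<gamma> this] S M obtain g' H' m f' where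
    p': "pot g' H'" and t: "\<And>x. tr2 (H' x) = f' x - m" and f': "\<And>x. \<bar>f' x\<bar> \<le> 2 * M" "holder \<gamma> (2 * S + 4 * M) f'"
      "\<And>x. \<bar>f' x - ?f x\<bar> \<le> e / 2" by auto
  have f'e: "f' = (\<lambda>x. tr2 (H' x) + m)" using t by auto
  have cf': "continuous_on UNIV f'" unfolding f'e by (intro continuous_intros tr2_cont[OF p'])
  have "torus_integral (\<lambda>x. tr2 (H' x)) = 0"
    unfolding tr2_def by (subst torus_integral_add) (auto intro!: continuous_intros pot_cont[OF p'] simp: pot_integral_zero[OF p'])
  then have m: "torus_integral f' = m"
    unfolding f'e by (subst torus_integral_add) (auto intro!: continuous_intros tr2_cont[OF p'] simp: torus_integral_const)
  \<comment> \<open>Two bounds on the mean: this one secures the sup bound 4 M whatever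
    \<open>e\<close> is, the next one makes the residual small.\<close>
  have mb: "\<bar>m\<bar> \<le> 2 * M"
  proof -
    have "f' x \<le> 2 * M" "- (2 * M) \<le> f' x" for x using f'(1)[of x] by linarith+
    then have "torus_integral f' \<le> torus_integral (\<lambda>x. 2 * M)" "torus_integral (\<lambda>x. - (2 * M)) \<le> torus_integral f'"
      by (intro torus_integral_mono cf' continuous_on_const, simp)+
    then show ?thesis by (simp add: torus_integral_const m)
  qed
  have me: "\<bar>m\<bar> \<le> e / 2"
  proof -
    have "torus_integral (\<lambda>x. f' x - ?f x) = m" by (subst torus_integral_diff[OF cf' cf]) (simp add: m mean)
    moreover have b: "f' x - ?f x \<le> e / 2" "- (e / 2) \<le> f' x - ?f x" for x using f'(3)[of x] by linarith+
    have "torus_integral (\<lambda>x. f' x - ?f x) \<le> torus_integral (\<lambda>x. e / 2)"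
      by (rule torus_integral_mono[OF continuous_on_diff[OF cf' cf] continuous_on_const b(1)])
    moreover have "torus_integral (\<lambda>x. - (e / 2)) \<le> torus_integral (\<lambda>x. f' x - ?f x)"
      by (rule torus_integral_mono[OF continuous_on_const continuous_on_diff[OF cf' cf] b(2)])
    ultimately show ?thesis by (simp add: torus_integral_const)
  qed
  have Fb: "\<bar>tr2 (H' x)\<bar> \<le> 4 * M" for x using f'(1)[of x] mb unfolding t by linarith
  have ht: "holder \<gamma> (2 * S + 4 * M) (\<lambda>x. tr2 (H' x))" unfolding t by (rule holder_shift_const[OF f'(2)])
  have K': "\<bar>H' x $ i $ j\<bar> \<le> K" for x i j
    unfolding K
    by (rule pot_log_bound[OF p' Fb M holder_mono[OF ht] S \<gamma>]) (use M in simp)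
  have N': "holder \<gamma> N (\<lambda>x. H' x $ i $ j)" for i j
  proof (rule holder_mono[OF pot_schauder[OF p' Fb _ ht _ \<gamma>]])
    show "sch \<gamma> * (4 * M + (2 * S + 4 * M)) \<le> N" by (simp add: N algebra_simps)
  qed (use M S in auto)
  have p'': "pot (\<lambda>x. g' x - g' 0) H'" using pot_diff[OF p' pot_const[of "g' 0"]] by simp
  have "\<bar>tr2 (H' x) - ?f x\<bar> \<le> e" for x using f'(3)[of x] me unfolding t by linarith
  moreover have "good \<gamma> K N (\<lambda>x. g' x - g' 0) H'" using p'' K' N' by (simp add: good_def)
  ultimately show ?thesis by blast
qed

section \<open>Convergence of the Picard iteration\<close>

lemma norm_mat_le: "norm (A::real^2^2) \<le> \<bar>A $ 1 $ 1\<bar> + \<bar>A $ 1 $ 2\<bar> + \<bar>A $ 2 $ 1\<bar> + \<bar>A $ 2 $ 2\<bar>"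
proof -
  have "norm A \<le> norm (A $ 1) + norm (A $ 2)"
    using L2_set_le_sum[of UNIV "\<lambda>i. norm (A $ i)"] unfolding norm_vec_def[of A] by (simp add: sum_2)
  moreover have "norm (A $ i) \<le> \<bar>A $ i $ 1\<bar> + \<bar>A $ i $ 2\<bar>" for i using norm_le_l1_cart[of "A $ i"] by (simp add: sum_2)
  from this[of 1] this[of 2] calculation show ?thesis by linarith
qed

lemma pot_limit:
  assumes p: "\<And>n. pot (g n) (H n)" and z: "\<And>n. g n 0 = 0" and u: "uniform_limit UNIV H L sequentially"
  shows "\<exists>g. pot g L"
proof -
  have ex: "\<exists>G. \<forall>x\<in>UNIV. (\<lambda>n. g n x $ i) \<longlonglongrightarrow> G x \<and> (G has_derivative (\<lambda>h. L x $ i \<bullet> h)) (at x within UNIV)" for i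
  proof (rule has_derivative_sequence[where ?x0.0=0 and l=0 and f'="\<lambda>n x h. H n x $ i \<bullet> h"])
    show "((\<lambda>x. g n x $ i) has_derivative (\<bullet>) (H n x $ i)) (at x within UNIV)" for n x
      using pot_c1[OF p] by (simp add: c1_def)
    fix e :: real assume "e > 0"
    with u have "\<forall>\<^sub>F n in sequentially. \<forall>x\<in>UNIV. dist (H n x) (L x) < e" by (rule uniform_limitD)
    then show "\<forall>\<^sub>F n in sequentially. \<forall>x\<in>UNIV. \<forall>h. norm (H n x $ i \<bullet> h - L x $ i \<bullet> h) \<le> e * norm h"
    proof (rule eventually_mono, intro ballI allI)
      fix n x h assume *: "\<forall>x\<in>UNIV. dist (H n x) (L x) < e"
      have "norm (H n x $ i \<bullet> h - L x $ i \<bullet> h) = \<bar>(H n x - L x) $ i \<bullet> h\<bar>" by (simp add: inner_diff_left)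
      also have "\<dots> \<le> norm ((H n x - L x) $ i) * norm h" by (rule Cauchy_Schwarz_ineq2)
      also have "\<dots> \<le> e * norm h"
        using * Finite_Cartesian_Product.norm_nth_le[of "H n x - L x" i] by (intro mult_right_mono) (auto simp: dist_norm intro: order_trans less_imp_le)
      finally show "norm (H n x $ i \<bullet> h - L x $ i \<bullet> h) \<le> e * norm h" .
    qed
  qed (auto simp: z)
  then have "\<forall>i. \<exists>G. \<forall>x. (\<lambda>n. g n x $ i) \<longlonglongrightarrow> G x \<and> (G has_derivative (\<lambda>h. L x $ i \<bullet> h)) (at x)" by simp
  then obtain G where G: "\<And>i x. (\<lambda>n. g n x $ i) \<longlonglongrightarrow> G i x" "\<And>i x. (G i has_derivative (\<lambda>h. L x $ i \<bullet> h)) (at x)"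
    by metis
  have cL: "continuous_on UNIV L"
    by (rule uniform_limit_theorem[OF _ u]) (auto intro!: always_eventually pot_cont[OF p])
  have lim: "(\<lambda>n. H n x) \<longlonglongrightarrow> L x" for x using tendsto_uniform_limitI[OF u] by simp
  have "periodic (\<lambda>x. \<chi> i. G i x)"
    unfolding periodic_def
  proof (intro allI)
    fix x k
    have "G i (x + axis k 1) = G i x" for i
    proof (rule LIMSEQ_unique[OF G(1)])
      show "(\<lambda>n. g n (x + axis k 1) $ i) \<longlonglongrightarrow> G i x"
        using G(1)[of x i] pot_periodic_g[OF p] by (simp add: periodic_def)
    qed
    then show "(\<chi> i. G i (x + axis k 1)) = (\<chi> i. G i x)" by simp
  qed
  moreover have "c1 (\<lambda>x. (\<chi> i. G i x) $ i) (\<lambda>x. L x $ i)" for i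
    unfolding c1_def using G(2) by (auto intro!: continuous_intros cL)
  moreover have "L x $ 1 $ 2 = L x $ 2 $ 1" for x
  proof (rule LIMSEQ_unique)
    show "(\<lambda>n. H n x $ 1 $ 2) \<longlonglongrightarrow> L x $ 1 $ 2" by (intro tendsto_vec_nth lim)
    have "(\<lambda>n. H n x $ 2 $ 1) \<longlonglongrightarrow> L x $ 2 $ 1" by (intro tendsto_vec_nth lim)
    then show "(\<lambda>n. H n x $ 1 $ 2) \<longlonglongrightarrow> L x $ 2 $ 1" by (simp add: pot_sym[OF p, of _ _ 1 2])
  qed
  ultimately show ?thesis unfolding pot_def by blast
qed

lemma half_power_sq: "((1/2::real) ^ n)\<^sup>2 = (1/4) ^ n"
  by (simp add: power2_eq_square flip: power_mult_distrib)

text \<open>The inverse Laplacian followed by two derivatives is not bounded in the sup norm, so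
  contraction is shown in L^2 only; the uniform Hoelder bound upgrades it to uniform convergence of
  the Hessians by \<open>sup_interpolation\<close>.\<close>

lemma ma_existence:
  assumes \<gamma>: "0 < \<gamma>" "\<gamma> < 1" and M: "M > 0" and S: "S \<ge> 0" and \<epsilon>: "\<epsilon> > 0"
    and \<rho>: "periodic \<rho>" "continuous_on UNIV \<rho>" "torus_integral \<rho> = 0" "\<And>x. \<bar>\<rho> x\<bar> \<le> M" "holder \<gamma> S \<rho>"
    and K: "K = (322560 / \<gamma>) * M * lamb M S" and N: "N = 2 * sch \<gamma> * (S + 4 * M)"
    and c1: "2 * \<epsilon> * K\<^sup>2 \<le> M" and c2: "8 * sch \<gamma> * \<epsilon> * K \<le> 1"
  shows "\<exists>g H. pot g H \<and> (\<forall>x i j. \<bar>H x $ i $ j\<bar> \<le> K) \<and> (\<forall>i j. holder \<gamma> N (\<lambda>x. H x $ i $ j))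
      \<and> (\<forall>x. tr2 (H x) + \<epsilon> * det2 (H x) = \<rho> x)"
proof -
  have K0: "K \<ge> 0" using K \<gamma> M lamb_ge[OF M S] by simp
  have sc: "sch \<gamma> \<ge> 1000000" by (rule sch_ge[OF \<gamma>])
  have N0: "N \<ge> 0" using sc S M by (simp add: N)
  have g0: "good \<gamma> K N (\<lambda>x. 0) (\<lambda>x. 0)" using pot_zero K0 N0 by (auto simp: good_def holder_def)
  \<comment> \<open>The error 2^-n allowed in step \<open>n\<close> decays geometrically and
    perturbs the contraction only by a geometric term.\<close>
  have "\<exists>s. \<forall>n. good \<gamma> K N (fst (s n)) (snd (s n)) \<and>
     (\<forall>x. \<bar>tr2 (snd (s (Suc n)) x) - (\<rho> x - \<epsilon> * det2 (snd (s n) x))\<bar> \<le> (1/2) ^ n)"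
  proof (rule dependent_nat_choice)
    show "\<exists>x. good \<gamma> K N (fst x) (snd x)" using g0 by (intro exI[of _ "(\<lambda>x. 0, \<lambda>x. 0)"]) simp
    fix s n assume "good \<gamma> K N (fst s) (snd s)"
    from picard_step[OF \<gamma> M S \<epsilon> \<rho> K N c1 c2 this, of "(1/2) ^ n"]
    show "\<exists>y. good \<gamma> K N (fst y) (snd y) \<and> (\<forall>x. \<bar>tr2 (snd y x) - (\<rho> x - \<epsilon> * det2 (snd s x))\<bar> \<le> (1/2) ^ n)" by auto
  qed
  then obtain s where s: "\<And>n. good \<gamma> K N (fst (s n)) (snd (s n))"
    "\<And>n x. \<bar>tr2 (snd (s (Suc n)) x) - (\<rho> x - \<epsilon> * det2 (snd (s n) x))\<bar> \<le> (1/2) ^ n" by blast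
  define g where "g n = fst (s n)" for n
  define H where "H n = snd (s n)" for n
  have p: "pot (g n) (H n)" and z: "g n 0 = 0" and Kb: "\<bar>H n x $ i $ j\<bar> \<le> K" and Nb: "holder \<gamma> N (\<lambda>x. H n x $ i $ j)" for n x i j
    using s(1)[of n] by (auto simp: good_def g_def H_def)
  have st: "\<bar>tr2 (H (Suc n) x) - (\<rho> x - \<epsilon> * det2 (H n x))\<bar> \<le> (1/2) ^ n" for n x using s(2) by (simp add: H_def)
  define X where "X n x = H (Suc n) x - H n x" for n x
  have pX: "pot (\<lambda>x. g (Suc n) x - g n x) (X n)" for n unfolding X_def by (rule pot_diff[OF p p])
  define E where "E n = torus_integral (\<lambda>x. sqn (X n x))" for n
  have eK: "8 * (\<epsilon> * K) \<le> 1"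
  proof -
    have "8 * (\<epsilon> * K) * 1 \<le> 8 * (\<epsilon> * K) * sch \<gamma>" using sc K0 \<epsilon> by (intro mult_left_mono) auto
    then show ?thesis using c2 by (simp add: mult_ac)
  qed
  \<comment> \<open>Up to 2 * 2^-n the new trace is - \<epsilon> times a difference of determinants.
    Since 8 \<epsilon> K \<le> 1, its square contributes at most 1/8 of the old energy
    density.\<close>
  have Estep: "E (Suc n) \<le> 8 * (1/4) ^ n + (1/8) * E n" for n
  proof -
    have "(tr2 (X (Suc n) x))\<^sup>2 \<le> 8 * (1/4) ^ n + (1/8) * sqn (X n x)" for x
    proof -
      let ?d = "\<epsilon> * (det2 (H (Suc n) x) - det2 (H n x))"
      have "\<bar>tr2 (X (Suc n) x) + ?d\<bar> \<le> 2 * (1/2) ^ n"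
      proof -
        have "(1/2::real) ^ Suc n \<le> (1/2) ^ n" by simp
        then show ?thesis
          using st[of "Suc n" x] st[of n x] unfolding X_def tr2_diff right_diff_distrib by linarith
      qed
      then have "(tr2 (X (Suc n) x) + ?d)\<^sup>2 \<le> (2 * (1/2) ^ n)\<^sup>2" by (rule abs_sq_le)
      also have "\<dots> = 4 * (1/4) ^ n" by (simp only: power_mult_distrib half_power_sq) simp
      finally have 1: "(tr2 (X (Suc n) x) + ?d)\<^sup>2 \<le> 4 * (1/4) ^ n" .
      have "?d\<^sup>2 \<le> \<epsilon>\<^sup>2 * (4 * K\<^sup>2 * sqn (X n x))"
        unfolding power_mult_distrib X_def by (intro mult_left_mono det2_diff_sq Kb) simp
      also have "\<dots> = (8 * (\<epsilon> * K))\<^sup>2 * (sqn (X n x) / 16)" by (simp add: power_mult_distrib)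
      also have "\<dots> \<le> 1 * (sqn (X n x) / 16)"
        using eK K0 \<epsilon> by (intro mult_right_mono power_le_one) (auto simp: sqn_def)
      finally have 2: "?d\<^sup>2 \<le> sqn (X n x) / 16" by simp
      have "(tr2 (X (Suc n) x))\<^sup>2 \<le> 2 * (tr2 (X (Suc n) x) + ?d)\<^sup>2 + 2 * ?d\<^sup>2"
      proof -
        have "(a::real)\<^sup>2 \<le> 2 * (a + b)\<^sup>2 + 2 * b\<^sup>2" for a b
        proof -
          have "0 \<le> (a + 2 * b)\<^sup>2" by simp
          then show ?thesis by (simp add: power2_eq_square algebra_simps)
        qed
        then show ?thesis .
      qed
      with 1 2 show ?thesis by linarith
    qed
    then have "torus_integral (\<lambda>x. (tr2 (X (Suc n) x))\<^sup>2) \<le> torus_integral (\<lambda>x. 8 * (1/4) ^ n + (1/8) * sqn (X n x))"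
      by (intro torus_integral_mono continuous_intros tr2_cont[OF pX] sqn_cont[OF pX])
    also have "\<dots> = 8 * (1/4) ^ n + (1/8) * E n"
      unfolding E_def torus_integral_cmult[symmetric]
      by (subst torus_integral_add) (auto intro!: continuous_intros sqn_cont[OF pX] simp: torus_integral_const)
    finally show ?thesis using pot_energy[OF pX[of "Suc n"]] by (simp add: E_def)
  qed
  have E0: "E n \<ge> 0" for n
    using torus_integral_mono[of "\<lambda>x. 0" "\<lambda>x. sqn (X n x)"] sqn_cont[OF pX]
    by (simp add: E_def torus_integral_const sqn_def)
  \<comment> \<open>A \<ge> 64 is exactly 8 + A / 8 \<le> A / 4, so the rate 1/4 of the squared
    errors survives the induction.\<close>
  define A where "A = E 0 + 64"
  have A: "E n \<le> A * (1/4) ^ n" for n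
  proof (induction n)
    case (Suc n)
    have "E (Suc n) \<le> 8 * (1/4) ^ n + (1/8) * (A * (1/4) ^ n)" using Estep[of n] Suc by linarith
    also have "\<dots> = (8 + A / 8) * (1/4) ^ n" by (simp add: algebra_simps)
    also have "\<dots> \<le> (A / 4) * (1/4) ^ n" using E0[of 0] by (intro mult_right_mono) (auto simp: A_def)
    finally show ?case by simp
  qed (simp add: A_def)
  have A0: "A > 0" using E0[of 0] by (simp add: A_def)
  define \<theta> where "\<theta> = (1/2) powr (\<gamma> / 2)"
  have \<theta>: "0 < \<theta>" "\<theta> < 1" using \<gamma> powr_less_mono'[of "1/2" 0 "\<gamma> / 2"] by (auto simp: \<theta>_def)
  define B where "B = 288 * sqrt A + 2880 * N"
  have Xb: "\<bar>X n x $ i $ j\<bar> \<le> B * \<theta> ^ n" for n x i j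
  proof -
    \<comment> \<open>At this scale the two terms of \<open>sup_interpolation\<close> decay like
      2^(-n/2) and 2^(-n \<gamma>/2), and \<theta>^n dominates both.\<close>
    define r where "r = (1/6) * (1/2) powr (real n / 2)"
    have r: "0 < r" "r \<le> 1/6" unfolding r_def by (auto intro!: powr_le1)
    have tn: "\<theta> ^ n = (1/2) powr (real n * \<gamma> / 2)"
      unfolding \<theta>_def by (simp add: powr_realpow[symmetric] powr_powr mult_ac)
    have "torus_integral (\<lambda>x. (X n x $ i $ j)\<^sup>2) \<le> E n"
      unfolding E_def by (intro torus_integral_mono continuous_intros pot_cont[OF pX] sqn_cont[OF pX] entry_sq_le)
    also have "\<dots> \<le> A * (1/4) ^ n" by (rule A)
    also have "\<dots> = (sqrt A * (1/2) ^ n)\<^sup>2"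
      using A0 by (simp only: power_mult_distrib half_power_sq) simp
    finally have e: "torus_integral (\<lambda>x. (X n x $ i $ j)\<^sup>2) \<le> (sqrt A * (1/2) ^ n)\<^sup>2" .
    have hX: "holder \<gamma> (2 * N) (\<lambda>x. X n x $ i $ j)"
      using holder_add[OF Nb[of "Suc n" i j] holder_cmult[OF Nb[of n i j], of "-1"]] by (simp add: X_def)
    have "\<bar>X n x $ i $ j\<bar> \<le> 48 * (sqrt A * (1/2) ^ n) / r + 1440 * (2 * N) * r powr \<gamma>"
      by (rule sup_interpolation[OF pot_entry_periodic[OF pX] pot_entry_cont[OF pX] hX _ e _ \<gamma> r]) (use N0 A0 in auto)
    also have "48 * (sqrt A * (1/2) ^ n) / r = 288 * sqrt A * (1/2) powr (real n / 2)"
    proof -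
      have "(1/2::real) ^ n = (1/2) powr (real n / 2) * (1/2) powr (real n / 2)"
        by (simp add: powr_realpow[symmetric] flip: powr_add)
      then show ?thesis by (simp add: r_def field_simps)
    qed
    finally have 1: "\<bar>X n x $ i $ j\<bar> \<le> 288 * sqrt A * (1/2) powr (real n / 2) + 1440 * (2 * N) * r powr \<gamma>" .
    have "(1/2::real) powr (real n / 2) \<le> \<theta> ^ n" unfolding tn using \<gamma> mult_left_mono[of \<gamma> 1 "real n"] by (intro powr_mono') auto
    then have "288 * sqrt A * (1/2) powr (real n / 2) \<le> 288 * sqrt A * \<theta> ^ n"
      using A0 by (intro mult_left_mono) auto
    moreover have "r powr \<gamma> \<le> \<theta> ^ n"
    proof -
      have "r powr \<gamma> = (1/6) powr \<gamma> * (1/2) powr (real n * \<gamma> / 2)"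
        unfolding r_def by (subst powr_mult) (auto simp: powr_powr)
      also have "\<dots> \<le> 1 * (1/2) powr (real n * \<gamma> / 2)" using \<gamma> by (intro mult_right_mono powr_le1) auto
      finally show ?thesis by (simp add: tn)
    qed
    then have "1440 * (2 * N) * r powr \<gamma> \<le> 1440 * (2 * N) * \<theta> ^ n" using N0 by (intro mult_left_mono) auto
    moreover have "B * \<theta> ^ n = 288 * sqrt A * \<theta> ^ n + 1440 * (2 * N) * \<theta> ^ n" by (simp add: B_def algebra_simps)
    ultimately show ?thesis using 1 by linarith
  qed
  have "uniform_limit UNIV (\<lambda>n x. \<Sum>i<n. X i x) (\<lambda>x. suminf (\<lambda>i. X i x)) sequentially"
  proof (rule Weierstrass_m_test)
    show "norm (X n x) \<le> (4 * B) * \<theta> ^ n" for n x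
      using norm_mat_le[of "X n x"] Xb[of n x 1 1] Xb[of n x 1 2] Xb[of n x 2 1] Xb[of n x 2 2] by linarith
    show "summable (\<lambda>n. (4 * B) * \<theta> ^ n)" using \<theta> by (intro summable_mult summable_geometric) auto
  qed
  then have "uniform_limit UNIV (\<lambda>n x. H 0 x + (\<Sum>i<n. X i x)) (\<lambda>x. H 0 x + suminf (\<lambda>i. X i x)) sequentially"
    by (intro uniform_limit_intros)
  moreover have "H 0 x + (\<Sum>i<n. X i x) = H n x" for n x
    unfolding X_def by (subst sum_lessThan_telescope) simp
  ultimately obtain L where u: "uniform_limit UNIV H L sequentially" by auto
  obtain gl where pl: "pot gl L" using pot_limit[OF p z u] by blast
  have lim: "(\<lambda>n. H n x) \<longlonglongrightarrow> L x" for x using tendsto_uniform_limitI[OF u] by simp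
  have lime: "(\<lambda>n. H n x $ i $ j) \<longlonglongrightarrow> L x $ i $ j" for x i j by (intro tendsto_vec_nth lim)
  have KL: "\<bar>L x $ i $ j\<bar> \<le> K" for x i j
    by (rule LIMSEQ_le_const2[OF tendsto_rabs[OF lime]]) (use Kb in auto)
  have NL: "holder \<gamma> N (\<lambda>x. L x $ i $ j)" for i j
    unfolding holder_def
  proof (intro allI)
    fix x y :: "real^2"
    have l: "(\<lambda>n. \<bar>H n x $ i $ j - H n y $ i $ j\<bar>) \<longlonglongrightarrow> \<bar>L x $ i $ j - L y $ i $ j\<bar>"
      by (intro tendsto_rabs tendsto_diff lime)
    show "\<bar>L x $ i $ j - L y $ i $ j\<bar> \<le> N * norm (x - y) powr \<gamma>"
      by (rule LIMSEQ_le_const2[OF l]) (use Nb in \<open>auto simp: holder_def\<close>)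
  qed
  have "tr2 (L x) + \<epsilon> * det2 (L x) = \<rho> x" for x
  proof -
    have "(\<lambda>n. tr2 (H (Suc n) x) - (\<rho> x - \<epsilon> * det2 (H n x))) \<longlonglongrightarrow> tr2 (L x) - (\<rho> x - \<epsilon> * det2 (L x))"
      unfolding tr2_def det2_def by (intro tendsto_intros lime LIMSEQ_Suc[OF lime])
    moreover have "(\<lambda>n. tr2 (H (Suc n) x) - (\<rho> x - \<epsilon> * det2 (H n x))) \<longlonglongrightarrow> 0"
      by (rule Lim_null_comparison[where g="\<lambda>n. (1/2) ^ n"]) (auto intro!: always_eventually LIMSEQ_power_zero st)
    ultimately show ?thesis using LIMSEQ_unique by fastforce
  qed
  with pl KL NL show ?thesis by blast
qed

text \<open>The mixed discriminant inequality for positive definite matrices of equal determinant,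
  with its equality case. Multiplication by a a' turns the defect into D (a - a')^2 + (a' b - a
  b')^2.\<close>

lemma mixed_det_ineq:
  fixes a b c a' b' c' :: real
  assumes "a > 0" "a' > 0" "a * c - b * b = D" "a' * c' - b' * b' = D" "D > 0"
  shows "0 \<le> c * a' + a * c' - 2 * b * b' - 2 * D"
    and "c * a' + a * c' - 2 * b * b' - 2 * D = 0 \<Longrightarrow> a = a' \<and> b = b' \<and> c = c'"
proof -
  let ?Q = "c * a' + a * c' - 2 * b * b' - 2 * D"
  have ac: "a * c = D + b * b" "a' * c' = D + b' * b'" using assms by auto
  have "a * a' * ?Q = a' * a' * (a * c) + a * a * (a' * c') - 2 * a * a' * b * b' - 2 * a * a' * D"
    by (simp add: algebra_simps)
  also have "\<dots> = D * (a - a')\<^sup>2 + (a' * b - a * b')\<^sup>2"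
    unfolding ac by (simp add: power2_eq_square algebra_simps)
  finally have e: "a * a' * ?Q = D * (a - a')\<^sup>2 + (a' * b - a * b')\<^sup>2" .
  have "0 \<le> a * a' * ?Q" unfolding e using assms by simp
  moreover have "a * a' > 0" using assms by simp
  ultimately show "0 \<le> ?Q" using mult_pos_neg[of "a * a'" ?Q] by linarith
  assume "?Q = 0"
  then have "D * (a - a')\<^sup>2 + (a' * b - a * b')\<^sup>2 = 0" using e by simp
  moreover have "0 \<le> D * (a - a')\<^sup>2" using assms by simp
  ultimately have "D * (a - a')\<^sup>2 = 0" "(a' * b - a * b')\<^sup>2 = 0"
    by (smt (verit) zero_le_power2)+
  then have "a = a'" "a' * b = a * b'" using assms by auto
  then show "a = a' \<and> b = b' \<and> c = c'" using assms ac by auto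
qed

text \<open>The assumptions are asymmetric on purpose: smallness is required of \<open>H2\<close>
  only, and a mere positivity condition of \<open>H1\<close>, so an arbitrary convex solution can be
  compared with the constructed one.\<close>

lemma ma_unique:
  assumes p1: "pot g1 H1" and p2: "pot g2 H2" and \<epsilon>: "\<epsilon> > 0"
    and pos: "\<And>x. 0 < 1 + \<epsilon> * H1 x $ 1 $ 1" and small: "\<And>x i j. \<bar>\<epsilon> * H2 x $ i $ j\<bar> \<le> 1/8"
    and eq: "\<And>x. tr2 (H1 x) + \<epsilon> * det2 (H1 x) = tr2 (H2 x) + \<epsilon> * det2 (H2 x)"
  shows "H1 = H2"
proof -
  let ?W = "\<lambda>x. H1 x - H2 x"
  have pW: "pot (\<lambda>x. g1 x - g2 x) ?W" by (rule pot_diff[OF p1 p2])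
  \<comment> \<open>The cofactor matrix of I + \<epsilon> H2 contracted with \<epsilon> W. In this
    form its integral vanishes by \<open>pot_null\<close>; in the form \<open>Qe\<close> it is the
    nonnegative defect of \<open>mixed_det_ineq\<close>.\<close>
  define Q where "Q x = \<epsilon> * (tr2 (?W x) + \<epsilon> * (H2 x $ 2 $ 2 * ?W x $ 1 $ 1 + H2 x $ 1 $ 1 * ?W x $ 2 $ 2 - 2 * (H2 x $ 1 $ 2 * ?W x $ 1 $ 2)))" for x
  let ?a = "\<lambda>x. 1 + \<epsilon> * H2 x $ 1 $ 1" and ?b = "\<lambda>x. \<epsilon> * H2 x $ 1 $ 2" and ?c = "\<lambda>x. 1 + \<epsilon> * H2 x $ 2 $ 2"
  let ?a' = "\<lambda>x. 1 + \<epsilon> * H1 x $ 1 $ 1" and ?b' = "\<lambda>x. \<epsilon> * H1 x $ 1 $ 2" and ?c' = "\<lambda>x. 1 + \<epsilon> * H1 x $ 2 $ 2"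
  define D where "D x = ?a x * ?c x - ?b x * ?b x" for x
  have a0: "?a x > 0" for x using small[of x 1 1] by linarith
  have D0: "D x > 0" for x
  proof -
    have "7/8 \<le> ?a x" "7/8 \<le> ?c x" using small[of x 1 1] small[of x 2 2] by linarith+
    then have "(7/8) * (7/8) \<le> ?a x * ?c x" by (intro mult_mono) auto
    moreover have "?b x * ?b x \<le> (1/8)\<^sup>2" using abs_sq_le[OF small[of x 1 2]] by (simp only: power2_eq_square)
    ultimately show ?thesis unfolding D_def by (simp add: power2_eq_square)
  qed
  have D': "?a' x * ?c' x - ?b' x * ?b' x = D x" for x
  proof -
    have "?a' x * ?c' x - ?b' x * ?b' x = 1 + \<epsilon> * (tr2 (H1 x) + \<epsilon> * det2 (H1 x))"
      by (simp add: tr2_def det2_def pot_sym[OF p1, of x 2 1] algebra_simps)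
    also have "\<dots> = D x" unfolding eq D_def
      by (simp add: tr2_def det2_def pot_sym[OF p2, of x 2 1] algebra_simps)
    finally show ?thesis .
  qed
  have Qe: "Q x = ?c x * ?a' x + ?a x * ?c' x - 2 * ?b x * ?b' x - 2 * D x" for x
    by (simp add: Q_def D_def tr2_def algebra_simps)
  have Q0: "Q x \<ge> 0" for x unfolding Qe by (rule mixed_det_ineq(1)[OF a0 pos D_def[symmetric] D' D0])
  have cQ: "continuous_on UNIV Q" unfolding Q_def[abs_def]
    by (intro continuous_intros tr2_cont[OF pW] pot_cont[OF p1] pot_cont[OF p2])
  have n: "torus_integral (\<lambda>x. H2 x $ i $ i * ?W x $ j $ j) = torus_integral (\<lambda>x. H2 x $ i $ j * ?W x $ i $ j)" for i j
    by (rule pot_null[OF p2 pW])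
  have "torus_integral Q = 0"
  proof -
    have ce: "continuous_on UNIV (\<lambda>x. H2 x $ i $ j * ?W x $ k $ l)" for i j k l
      by (intro continuous_intros pot_cont[OF p1] pot_cont[OF p2])
    have "torus_integral (\<lambda>x. H2 x $ 2 $ 2 * ?W x $ 1 $ 1 + H2 x $ 1 $ 1 * ?W x $ 2 $ 2 - 2 * (H2 x $ 1 $ 2 * ?W x $ 1 $ 2)) =
       torus_integral (\<lambda>x. H2 x $ 2 $ 2 * ?W x $ 1 $ 1) + torus_integral (\<lambda>x. H2 x $ 1 $ 1 * ?W x $ 2 $ 2)
       - 2 * torus_integral (\<lambda>x. H2 x $ 1 $ 2 * ?W x $ 1 $ 2)"
      unfolding torus_integral_cmult[symmetric]
      by (simp only: torus_integral_diff torus_integral_add ce continuous_on_add continuous_on_mult continuous_on_const)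
    also have "\<dots> = 0"
      using n[of 2 1] n[of 1 2] by (simp only: pot_sym[OF p2, of _ 2 1] pot_sym[OF pW, of _ 2 1])
    finally have 1: "torus_integral (\<lambda>x. H2 x $ 2 $ 2 * ?W x $ 1 $ 1 + H2 x $ 1 $ 1 * ?W x $ 2 $ 2 - 2 * (H2 x $ 1 $ 2 * ?W x $ 1 $ 2)) = 0" .
    have 2: "torus_integral (\<lambda>x. tr2 (?W x)) = 0"
      unfolding tr2_def
      using pot_integral_zero[OF pW]
      by (subst torus_integral_add; (intro continuous_intros pot_cont[OF p1] pot_cont[OF p2])?) simp
    have "torus_integral (\<lambda>x. tr2 (?W x) + \<epsilon> * (H2 x $ 2 $ 2 * ?W x $ 1 $ 1 + H2 x $ 1 $ 1 * ?W x $ 2 $ 2 - 2 * (H2 x $ 1 $ 2 * ?W x $ 1 $ 2)))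
      = torus_integral (\<lambda>x. tr2 (?W x)) + torus_integral (\<lambda>x. \<epsilon> * (H2 x $ 2 $ 2 * ?W x $ 1 $ 1 + H2 x $ 1 $ 1 * ?W x $ 2 $ 2 - 2 * (H2 x $ 1 $ 2 * ?W x $ 1 $ 2)))"
      by (rule torus_integral_add) (intro tr2_cont[OF pW] continuous_intros pot_cont[OF p1] pot_cont[OF p2])+
    then show ?thesis
      unfolding Q_def[abs_def] torus_integral_cmult 1 2 by simp
  qed
  then have z: "Q x = 0" if "x \<in> cbox 0 1" for x
  proof -
    have ne: "box 0 (1::real^2) \<noteq> {}"
    proof -
      have "(vec (1/2) :: real^2) \<in> box 0 1" by (simp add: mem_box_cart)
      then show ?thesis by blast
    qed
    show ?thesis
      using \<open>torus_integral Q = 0\<close> integral_cbox_eq_0_iff[OF continuous_on_subset[OF cQ] ne] Q0 that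
      by (simp add: torus_integral_def)
  qed
  have "H1 x = H2 x" if "x \<in> cbox 0 1" for x
  proof -
    have "?a x = ?a' x \<and> ?b x = ?b' x \<and> ?c x = ?c' x"
      by (rule mixed_det_ineq(2)[OF a0 pos D_def[symmetric] D' D0]) (use z[OF that] Qe in simp)
    then show ?thesis using \<epsilon> by (simp add: vec2_eq_iff pot_sym[OF p1, of x 2 1] pot_sym[OF p2, of x 2 1])
  qed
  then show ?thesis
  proof (intro ext)
    fix x assume a: "\<And>x. x \<in> cbox 0 1 \<Longrightarrow> H1 x = H2 x"
    obtain w where "lattice_vec w" "x + w \<in> cbox 0 1" using lattice_rep by blast
    with a show "H1 x = H2 x" using periodic_lattice[OF pot_periodic[OF p1]] periodic_lattice[OF pot_periodic[OF p2]] by metis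
  qed
qed

lemma ma_estimate:
  assumes \<gamma>: "0 < \<gamma>" "\<gamma> < 1"
  shows "\<exists>D\<ge>1. \<forall>\<epsilon> M S \<rho> g H. 0 < \<epsilon> \<and> 0 < M \<and> 0 \<le> S \<and> periodic \<rho> \<and> continuous_on UNIV \<rho> \<and> torus_integral \<rho> = 0
     \<and> (\<forall>x. \<bar>\<rho> x\<bar> \<le> M) \<and> holder \<gamma> S \<rho> \<and> D * \<epsilon> * M * (lamb M S)\<^sup>2 \<le> 1 \<and> pot g H
     \<and> (\<forall>x. 0 < 1 + \<epsilon> * H x $ 1 $ 1) \<and> (\<forall>x. tr2 (H x) + \<epsilon> * det2 (H x) = \<rho> x)
     \<longrightarrow> (\<forall>x i j. \<bar>H x $ i $ j\<bar> \<le> D * M * lamb M S) \<and> (\<forall>i j. holder \<gamma> (D * (S + M)) (\<lambda>x. H x $ i $ j))"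
proof -
  define D0 where "D0 = 322560 / \<gamma>"
  define c where "c = sch \<gamma>"
  \<comment> \<open>The summands serve, in order, the sup bound, the two smallness conditions of
    \<open>ma_existence\<close>, and the Hoelder bound.\<close>
  define D where "D = D0 + 2 * D0\<^sup>2 + 8 * c * D0 + 8 * c"
  have D0: "D0 > 0" using \<gamma> by (simp add: D0_def)
  have c: "c \<ge> 1000000" unfolding c_def by (rule sch_ge[OF \<gamma>])
  have cD: "0 \<le> c * D0" using c D0 by simp
  have D: "D \<ge> 1" "D0 \<le> D" "2 * D0\<^sup>2 \<le> D" "8 * c * D0 \<le> D" "8 * c \<le> D"
  proof -
    have "0 \<le> 8 * c * D0" "0 \<le> D0\<^sup>2" using c D0 by auto
    then show "D \<ge> 1" "D0 \<le> D" "2 * D0\<^sup>2 \<le> D" "8 * c * D0 \<le> D" "8 * c \<le> D"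
      unfolding D_def using D0 c by linarith+
  qed
  show ?thesis
  proof (intro exI[of _ D] conjI allI impI D(1))
    fix \<epsilon> M S \<rho> g H
    assume *: "0 < \<epsilon> \<and> 0 < M \<and> 0 \<le> S \<and> periodic \<rho> \<and> continuous_on UNIV \<rho> \<and> torus_integral \<rho> = 0
     \<and> (\<forall>x. \<bar>\<rho> x\<bar> \<le> M) \<and> holder \<gamma> S \<rho> \<and> D * \<epsilon> * M * (lamb M S)\<^sup>2 \<le> 1 \<and> pot g H
     \<and> (\<forall>x. 0 < 1 + \<epsilon> * H x $ 1 $ 1) \<and> (\<forall>x. tr2 (H x) + \<epsilon> * det2 (H x) = \<rho> x)"
    then have \<epsilon>: "\<epsilon> > 0" and M: "M > 0" and S: "S \<ge> 0" and p: "pot g H" by auto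
    define L where "L = lamb M S"
    have L: "L \<ge> 1" using lamb_ge[OF M S] by (simp add: L_def)
    have sm: "D * (\<epsilon> * M * L\<^sup>2) \<le> 1" using * by (simp add: L_def mult.assoc)
    have u: "0 \<le> \<epsilon> * M * L\<^sup>2" using \<epsilon> M by simp
    define K where "K = D0 * M * L"
    have K0: "K \<ge> 0" using D0 M L by (simp add: K_def)
    have "2 * D0\<^sup>2 * (\<epsilon> * M * L\<^sup>2) \<le> 1" using mult_right_mono[OF D(3) u] sm by linarith
    then have "M * (2 * D0\<^sup>2 * (\<epsilon> * M * L\<^sup>2)) \<le> M * 1" using M by (intro mult_left_mono) auto
    then have c1: "2 * \<epsilon> * K\<^sup>2 \<le> M" by (simp add: K_def power2_eq_square mult_ac)
    \<comment> \<open>The assumed smallness involves the square of the logarithm, whereas the second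
      condition asks only for its first power.\<close>
    have LL: "L \<le> L\<^sup>2" using L by (simp add: power2_eq_square)
    have "8 * c * D0 * (\<epsilon> * M * L) \<le> 8 * c * D0 * (\<epsilon> * M * L\<^sup>2)"
      using LL \<epsilon> M c D0 by (intro mult_left_mono) auto
    also have "\<dots> \<le> 1" using mult_right_mono[OF D(4) u] sm by linarith
    finally have c2: "8 * c * \<epsilon> * K \<le> 1" by (simp add: K_def mult_ac)
    have "\<exists>g' H'. pot g' H' \<and> (\<forall>x i j. \<bar>H' x $ i $ j\<bar> \<le> K) \<and> (\<forall>i j. holder \<gamma> (2 * c * (S + 4 * M)) (\<lambda>x. H' x $ i $ j))
      \<and> (\<forall>x. tr2 (H' x) + \<epsilon> * det2 (H' x) = \<rho> x)"
      unfolding c_def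
      by (rule ma_existence[OF \<gamma> M S \<epsilon>]) (use * c1 c2 in \<open>auto simp: K_def D0_def L_def c_def\<close>)
    then obtain g' H' where p': "pot g' H'" and K': "\<And>x i j. \<bar>H' x $ i $ j\<bar> \<le> K"
      and N': "\<And>i j. holder \<gamma> (2 * c * (S + 4 * M)) (\<lambda>x. H' x $ i $ j)"
      and e': "\<And>x. tr2 (H' x) + \<epsilon> * det2 (H' x) = \<rho> x" by blast
    have "8 * (\<epsilon> * K) * 1 \<le> 8 * (\<epsilon> * K) * c" using c K0 \<epsilon> by (intro mult_left_mono) auto
    then have eK: "\<epsilon> * K \<le> 1/8" using c2 by (simp add: mult_ac)
    have "H = H'"
    proof (rule ma_unique[OF p p' \<epsilon>])
      fix x i j
      have "\<epsilon> * \<bar>H' x $ i $ j\<bar> \<le> \<epsilon> * K" using \<epsilon> K' by (intro mult_left_mono) auto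
      then have "\<epsilon> * \<bar>H' x $ i $ j\<bar> \<le> 1/8" using eK by linarith
      then show "\<bar>\<epsilon> * H' x $ i $ j\<bar> \<le> 1/8" using \<epsilon> by (simp only: abs_mult abs_of_pos)
    qed (use * e' in auto)
    moreover have "K \<le> D * M * L" unfolding K_def using D(2) M L by (intro mult_right_mono) auto
    moreover have "2 * c * (S + 4 * M) \<le> D * (S + M)"
    proof -
      have "2 * c * (S + 4 * M) \<le> 8 * c * (S + M)" using c S M by (simp add: algebra_simps mult_left_mono)
      also have "\<dots> \<le> D * (S + M)" using D(5) S M by (intro mult_right_mono) auto
      finally show ?thesis .
    qed
    ultimately show "\<bar>H x $ i $ j\<bar> \<le> D * M * lamb M S" "holder \<gamma> (D * (S + M)) (\<lambda>x. H x $ i $ j)" for x i j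
      using K' holder_mono[OF N'] by (auto simp: L_def intro: order_trans)
  qed
qed

text \<open>
  Absorbing half of an a priori finite quantity into the left-hand side.
\<close>

lemma half_absorb:
  fixes A B :: real
  assumes step: "\<And>W. W \<ge> 0 \<Longrightarrow> P W \<Longrightarrow> P (A + W / 2)" and init: "P B" "B \<ge> 0" "A \<ge> 0"
    and P: "\<And>W. P W \<Longrightarrow> f \<le> W"
  shows "f \<le> 2 * A"
proof -
  have "P (2 * A * (1 - (1/2) ^ n) + B * (1/2) ^ n)" for n
  proof (induction n)
    case 0 show ?case using init by simp
  next
    case (Suc n)
    have "(1/2::real) ^ n \<le> 1" by (intro power_le_one) auto
    then have "0 \<le> 2 * A * (1 - (1/2) ^ n) + B * (1/2) ^ n" using init by (intro add_nonneg_nonneg mult_nonneg_nonneg) auto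
    from step[OF this Suc] have "P (A + (2 * A * (1 - (1/2) ^ n) + B * (1/2) ^ n) / 2)" .
    moreover have "A + (2 * A * (1 - (1/2) ^ n) + B * (1/2) ^ n) / 2 = 2 * A * (1 - (1/2) ^ Suc n) + B * (1/2) ^ Suc n"
      by (simp add: algebra_simps add_divide_distrib diff_divide_distrib)
    ultimately show ?case by simp
  qed
  then have "f \<le> 2 * A * (1 - (1/2) ^ n) + B * (1/2) ^ n" for n using P by blast
  moreover have "(\<lambda>n. 2 * A * (1 - (1/2) ^ n) + B * (1/2) ^ n) \<longlonglongrightarrow> 2 * A * (1 - 0) + B * 0"
    by (intro tendsto_intros LIMSEQ_power_zero) auto
  ultimately show ?thesis using LIMSEQ_le_const by fastforce
qed

section \<open>Lipschitz bound for the Hessian\<close>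

lemma holder_mult:
  assumes "\<And>x. \<bar>p x\<bar> \<le> a" "\<And>x. \<bar>q x\<bar> \<le> b" "holder \<gamma> S p" "holder \<gamma> T q"
  shows "holder \<gamma> (S * b + a * T) (\<lambda>x. p x * q x)"
  unfolding holder_def
proof (intro allI)
  fix x y :: "real^2"
  have "p x * q x - p y * q y = (p x - p y) * q x + p y * (q x - q y)" by (simp add: algebra_simps)
  then have "\<bar>p x * q x - p y * q y\<bar> \<le> \<bar>p x - p y\<bar> * \<bar>q x\<bar> + \<bar>p y\<bar> * \<bar>q x - q y\<bar>"
    by (metis abs_mult abs_triangle_ineq)
  also have "\<dots> \<le> (S * norm (x - y) powr \<gamma>) * b + a * (T * norm (x - y) powr \<gamma>)"
  proof -
    have 1: "\<bar>p x - p y\<bar> \<le> S * norm (x - y) powr \<gamma>" and 2: "\<bar>q x - q y\<bar> \<le> T * norm (x - y) powr \<gamma>"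
      using assms by (auto simp: holder_def)
    have "0 \<le> S * norm (x - y) powr \<gamma>" "0 \<le> a" using order_trans[OF abs_ge_zero 1] order_trans[OF abs_ge_zero assms(1)] by auto
    then show ?thesis by (intro add_mono mult_mono 1 2 assms(1,2)) auto
  qed
  finally show "\<bar>p x * q x - p y * q y\<bar> \<le> (S * b + a * T) * norm (x - y) powr \<gamma>" by (simp add: algebra_simps)
qed

text \<open>The two increments are interchanged: the mean value theorem is applied in direction
  \<open>h\<close> to the increment of \<rho> by y - x, so that a difference of gradients
  appears.\<close>

lemma holder_increment:
  assumes r: "c1 \<rho> R" and P: "\<And>x y. norm (R x - R y) \<le> P * norm (x - y) powr \<gamma>"
  shows "holder \<gamma> (P * norm h) (\<lambda>x. \<rho> (x + h) - \<rho> x)"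
  unfolding holder_def
proof (intro allI)
  fix x y :: "real^2"
  have "c1 (\<lambda>z. \<rho> z - \<rho> (z + (y - x))) (\<lambda>z. R z - R (z + (y - x)))"
    by (intro c1_diff r c1_shift)
  from c1_mean_value[OF this, of x h] obtain s where
    s: "(\<rho> (x + h) - \<rho> (x + h + (y - x))) - (\<rho> x - \<rho> (x + (y - x)))
       = (R (x + s *\<^sub>R h) - R (x + s *\<^sub>R h + (y - x))) \<bullet> h" by blast
  have "\<bar>(\<rho> (x + h) - \<rho> x) - (\<rho> (y + h) - \<rho> y)\<bar> = \<bar>(R (x + s *\<^sub>R h) - R (x + s *\<^sub>R h + (y - x))) \<bullet> h\<bar>"
    using s by (simp add: algebra_simps)
  also have "\<dots> \<le> norm (R (x + s *\<^sub>R h) - R (x + s *\<^sub>R h + (y - x))) * norm h" by (rule Cauchy_Schwarz_ineq2)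
  also have "\<dots> \<le> (P * norm (x - y) powr \<gamma>) * norm h"
    using P[of "x + s *\<^sub>R h" "x + s *\<^sub>R h + (y - x)"] by (intro mult_right_mono) (auto simp: norm_minus_commute)
  finally show "\<bar>(\<rho> (x + h) - \<rho> x) - (\<rho> (y + h) - \<rho> y)\<bar> \<le> P * norm h * norm (x - y) powr \<gamma>" by (simp add: mult_ac)
qed

text \<open>
  The increment \<open>V = H (x + h) - H x\<close> solves a linear equation; its Hoelder norm is estimated by the Schauder
  estimate, its \<open>L^2\<close> norm by the energy identity, and interpolation at the fixed scale \<open>r\<close> closes the estimate.
  This gives a Lipschitz bound on \<open>H\<close>, as needed for \<open>\<alpha> = 1\<close>, at the price of one Hoelder seminorm of \<open>\<nabla>\<rho>\<close>.
\<close>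

lemma pot_increment_estimate:
  assumes \<gamma>: "0 < \<gamma>" "\<gamma> < 1" and \<epsilon>: "\<epsilon> > 0" and p: "pot g H"
    and eq: "\<And>x. tr2 (H x) + \<epsilon> * det2 (H x) = \<rho> x" and r: "c1 \<rho> R"
    and Kb: "\<And>x i j. \<bar>H x $ i $ j\<bar> \<le> K" and Nb: "\<And>i j. holder \<gamma> N (\<lambda>x. H x $ i $ j)" and N0: "N \<ge> 0"
    and G: "\<And>x. norm (R x) \<le> G" and P: "\<And>x y. norm (R x - R y) \<le> P * norm (x - y) powr \<gamma>" "P \<ge> 0"
    and small: "8 * sch \<gamma> * \<epsilon> * K \<le> 1"
    and rr: "0 < r" "r \<le> 1/6" "11520 * sch \<gamma> * \<epsilon> * (K + N) * r powr \<gamma> \<le> 1/2"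
    and h: "h \<noteq> 0"
  shows "\<bar>H (x + h) $ i $ j - H x $ i $ j\<bar> \<le> 2 * (96 / r + 2880 * sch \<gamma>) * (G + 1 + P) * norm h"
proof -
  let ?c = "sch \<gamma>" and ?\<eta> = "norm h"
  define V where "V x = H (x + h) - H x" for x
  have pV: "pot (\<lambda>x. g (x + h) - g x) V" unfolding V_def by (rule pot_diff[OF pot_shift[OF p] p])
  have c: "?c \<ge> 1000000" by (rule sch_ge[OF \<gamma>])
  have K0: "K \<ge> 0" using Kb[of 0 1 1] by linarith
  have G0: "G \<ge> 0" using G[of 0] norm_ge_zero order_trans by blast
  have \<eta>: "?\<eta> > 0" using h by simp
  have eK: "8 * (\<epsilon> * K) \<le> 1"
  proof -
    have "8 * (\<epsilon> * K) * 1 \<le> 8 * (\<epsilon> * K) * ?c" using c K0 \<epsilon> by (intro mult_left_mono) auto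
    then show ?thesis using small by (simp add: mult_ac)
  qed
  let ?dr = "\<lambda>x. \<rho> (x + h) - \<rho> x" and ?dd = "\<lambda>x. det2 (H (x + h)) - det2 (H x)"
  have trV: "tr2 (V x) = ?dr x - \<epsilon> * ?dd x" for x
    using eq[of x] eq[of "x + h"] by (simp add: V_def algebra_simps)
  have drb: "\<bar>?dr x\<bar> \<le> G * ?\<eta>" for x using c1_lipschitz[OF r G, of "x + h" x] by simp
  have Kh: "\<bar>H (x + h) $ i $ j\<bar> \<le> K" for x i j by (rule Kb)
  have ddb: "\<bar>?dd x\<bar> \<le> K * (4 * W)" if "\<And>i j. \<bar>V x $ i $ j\<bar> \<le> W" for x W
  proof -
    have "\<bar>?dd x\<bar> \<le> K * (\<bar>V x $ 1 $ 1\<bar> + \<bar>V x $ 2 $ 2\<bar> + \<bar>V x $ 1 $ 2\<bar> + \<bar>V x $ 2 $ 1\<bar>)"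
      unfolding V_def by (rule det2_diff_le) (rule Kb)+
    also have "\<dots> \<le> K * (4 * W)"
      using that[of 1 1] that[of 2 2] that[of 1 2] that[of 2 1] K0 by (intro mult_left_mono) linarith+
    finally show ?thesis .
  qed
  \<comment> \<open>G + 1 rather than G, because \<open>sup_interpolation\<close> asks for a
    positive L^2 bound even if G = 0.\<close>
  define E where "E = 2 * ?\<eta> * (G + 1)"
  have E0: "E > 0" using \<eta> G0 by (simp add: E_def)
  have L2: "torus_integral (\<lambda>x. (V x $ i $ j)\<^sup>2) \<le> E\<^sup>2" for i j
  proof -
    let ?T = "torus_integral (\<lambda>x. sqn (V x))"
    have pw: "(tr2 (V x))\<^sup>2 \<le> 2 * (G * ?\<eta>)\<^sup>2 + (1/8) * sqn (V x)" for x
    proof -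
      have "(\<epsilon> * ?dd x)\<^sup>2 \<le> \<epsilon>\<^sup>2 * (4 * K\<^sup>2 * sqn (V x))"
        unfolding power_mult_distrib V_def by (intro mult_left_mono det2_diff_sq Kb) simp
      also have "\<dots> = (8 * (\<epsilon> * K))\<^sup>2 * (sqn (V x) / 16)" by (simp add: power_mult_distrib)
      also have "\<dots> \<le> 1 * (sqn (V x) / 16)"
        using eK K0 \<epsilon> by (intro mult_right_mono power_le_one) (auto simp: sqn_def)
      finally have 2: "(\<epsilon> * ?dd x)\<^sup>2 \<le> sqn (V x) / 16" by simp
      have 3: "(?dr x)\<^sup>2 \<le> (G * ?\<eta>)\<^sup>2" by (rule abs_sq_le[OF drb])
      have "(a - b)\<^sup>2 \<le> 2 * a\<^sup>2 + 2 * b\<^sup>2" for a b :: real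
      proof -
        have "0 \<le> (a + b)\<^sup>2" by simp
        then show ?thesis by (simp add: power2_eq_square algebra_simps)
      qed
      from this[of "?dr x" "\<epsilon> * ?dd x"] 2 3 show ?thesis unfolding trV by linarith
    qed
    have "?T \<le> torus_integral (\<lambda>x. 2 * (G * ?\<eta>)\<^sup>2 + (1/8) * sqn (V x))"
      unfolding pot_energy[OF pV]
      by (intro torus_integral_mono pw continuous_intros tr2_cont[OF pV] sqn_cont[OF pV])
    also have "\<dots> = 2 * (G * ?\<eta>)\<^sup>2 + (1/8) * ?T"
      unfolding torus_integral_cmult[symmetric]
      by (subst torus_integral_add) (auto intro!: continuous_intros sqn_cont[OF pV] simp: torus_integral_const)
    finally have "?T \<le> 4 * (G * ?\<eta>)\<^sup>2"
      using zero_le_power2[of "G * ?\<eta>"] by linarith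
    also have "\<dots> = (2 * ?\<eta> * G)\<^sup>2" by (simp add: power2_eq_square)
    also have "\<dots> \<le> E\<^sup>2" unfolding E_def using \<eta> G0 by (intro power_mono mult_left_mono) auto
    finally have "?T \<le> E\<^sup>2" .
    moreover have "torus_integral (\<lambda>x. (V x $ i $ j)\<^sup>2) \<le> ?T"
      by (intro torus_integral_mono continuous_intros pot_cont[OF pV] sqn_cont[OF pV] entry_sq_le)
    ultimately show ?thesis by simp
  qed
  define A where "A = (96 / r + 2880 * ?c) * (G + 1 + P) * ?\<eta>"
  have absorb: "\<bar>V x $ i $ j\<bar> \<le> A + W / 2" if W0: "W \<ge> 0" and W: "\<And>x i j. \<bar>V x $ i $ j\<bar> \<le> W" for W x i j
  proof -
    let ?S0 = "?c * (?\<eta> * (G + 1 + P) + 4 * \<epsilon> * (K + N) * W)"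
    \<comment> \<open>Inner absorption: the seminorm \<open>s\<close> of V reappears with a
      coefficient at most 1/2 thanks to \<open>small\<close>, and it is finite a priori by the bound
      2 N.\<close>
    have step: "holder \<gamma> (?S0 + s / 2) (\<lambda>x. V x $ i $ j)" if s0: "s \<ge> 0" and s: "\<And>i j. holder \<gamma> s (\<lambda>x. V x $ i $ j)" for s i j
    proof -
      have hd: "holder \<gamma> (4 * (W * N + s * K)) ?dd"
      proof -
        have Nh: "holder \<gamma> N (\<lambda>x. H (x + h) $ i $ j)" for i j
          using Nb[of i j] unfolding holder_def by (metis add_diff_cancel_right)
        have "?dd = (\<lambda>x. (V x $ 1 $ 1 * H (x + h) $ 2 $ 2 + V x $ 2 $ 2 * H x $ 1 $ 1)
            + (-1) * (V x $ 1 $ 2 * H (x + h) $ 2 $ 1 + V x $ 2 $ 1 * H x $ 1 $ 2))"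
          by (simp add: V_def det2_def algebra_simps)
        moreover have "holder \<gamma> (((s * K + W * N) + (s * K + W * N)) + \<bar>-1\<bar> * ((s * K + W * N) + (s * K + W * N)))
           (\<lambda>x. (V x $ 1 $ 1 * H (x + h) $ 2 $ 2 + V x $ 2 $ 2 * H x $ 1 $ 1)
            + (-1) * (V x $ 1 $ 2 * H (x + h) $ 2 $ 1 + V x $ 2 $ 1 * H x $ 1 $ 2))"
          by (intro holder_add holder_cmult holder_mult W Kb s Nb Nh)
        ultimately show ?thesis by (simp add: algebra_simps)
      qed
      have ht: "holder \<gamma> (P * ?\<eta> + \<epsilon> * (4 * (W * N + s * K))) (\<lambda>x. tr2 (V x))"
      proof -
        have "holder \<gamma> (P * ?\<eta> + \<bar>- \<epsilon>\<bar> * (4 * (W * N + s * K))) (\<lambda>x. ?dr x + (- \<epsilon>) * ?dd x)"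
          by (intro holder_add holder_increment[OF r P(1)] holder_cmult hd)
        then show ?thesis using \<epsilon> unfolding trV by simp
      qed
      have tb: "\<bar>tr2 (V x)\<bar> \<le> (G + 1) * ?\<eta> + \<epsilon> * (K * (4 * W))" for x
      proof -
        have "\<bar>\<epsilon> * ?dd x\<bar> \<le> \<epsilon> * (K * (4 * W))" using ddb[OF W, of x] \<epsilon> by (simp add: abs_mult)
        then show ?thesis unfolding trV using drb[of x] \<eta> unfolding distrib_right by linarith
      qed
      have "holder \<gamma> (?c * (((G + 1) * ?\<eta> + \<epsilon> * (K * (4 * W))) + (P * ?\<eta> + \<epsilon> * (4 * (W * N + s * K))))) (\<lambda>x. V x $ i $ j)"
      proof (rule pot_schauder[OF pV tb _ ht _ \<gamma>])
        have "0 < (G + 1) * ?\<eta>" using G0 \<eta> by simp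
        moreover have "0 \<le> \<epsilon> * (K * (4 * W))" using \<epsilon> K0 W0 by simp
        ultimately show "0 < (G + 1) * ?\<eta> + \<epsilon> * (K * (4 * W))" by linarith
        show "0 \<le> P * ?\<eta> + \<epsilon> * (4 * (W * N + s * K))"
          using P(2) \<epsilon> K0 W0 N0 s0 by simp
      qed
      moreover have "?c * (((G + 1) * ?\<eta> + \<epsilon> * (K * (4 * W))) + (P * ?\<eta> + \<epsilon> * (4 * (W * N + s * K)))) = ?S0 + (8 * ?c * \<epsilon> * K) * (s / 2)"
        by (simp add: algebra_simps)
      moreover have "(8 * ?c * \<epsilon> * K) * (s / 2) \<le> 1 * (s / 2)" using small s0 by (intro mult_right_mono) auto
      ultimately show ?thesis by (intro holder_mono[of \<gamma> _ "\<lambda>x. V x $ i $ j" "?S0 + s / 2"]) auto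
    qed
    have S00: "?S0 \<ge> 0" using c \<eta> G0 P(2) \<epsilon> K0 N0 W0 by (intro mult_nonneg_nonneg add_nonneg_nonneg) auto
    have hV: "holder \<gamma> (2 * ?S0) (\<lambda>x. V x $ i $ j)" for i j
      unfolding holder_def
    proof (intro allI)
      fix x y :: "real^2"
      show "\<bar>V x $ i $ j - V y $ i $ j\<bar> \<le> 2 * ?S0 * norm (x - y) powr \<gamma>"
      proof (cases "x = y")
        case False
        then have n: "norm (x - y) powr \<gamma> > 0" by simp
        have "\<bar>V x $ i $ j - V y $ i $ j\<bar> / norm (x - y) powr \<gamma> \<le> 2 * ?S0"
        proof (rule half_absorb[where P="\<lambda>s. \<forall>i j. holder \<gamma> s (\<lambda>x. V x $ i $ j)" and B="2 * N"])
          have "holder \<gamma> (N + \<bar>-1\<bar> * N) (\<lambda>x. H (x + h) $ i $ j + (-1) * H x $ i $ j)" for i j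
          proof (intro holder_add holder_cmult Nb)
            show "holder \<gamma> N (\<lambda>x. H (x + h) $ i $ j)"
              using Nb[of i j] unfolding holder_def by (metis add_diff_cancel_right)
          qed
          then show "\<forall>i j. holder \<gamma> (2 * N) (\<lambda>x. V x $ i $ j)" by (simp add: V_def)
          fix W assume "\<forall>i j. holder \<gamma> W (\<lambda>x. V x $ i $ j)"
          then show "\<bar>V x $ i $ j - V y $ i $ j\<bar> / norm (x - y) powr \<gamma> \<le> W"
            using n by (simp add: holder_def divide_le_eq)
        qed (use step S00 N0 in auto)
        then show ?thesis using n by (simp add: divide_le_eq)
      qed simp
    qed
    have "\<bar>V x $ i $ j\<bar> \<le> 48 * E / r + 1440 * (2 * ?S0) * r powr \<gamma>"
      by (rule sup_interpolation[OF pot_entry_periodic[OF pV] pot_entry_cont[OF pV] hV _ L2 E0 \<gamma> rr(1,2)]) (use S00 in simp)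
    also have "\<dots> = 48 * E / r + 2880 * ?c * (?\<eta> * (G + 1 + P)) * r powr \<gamma> + (11520 * ?c * \<epsilon> * (K + N) * r powr \<gamma>) * W"
      by (simp add: algebra_simps)
    also have "\<dots> \<le> 96 / r * (?\<eta> * (G + 1 + P)) + 2880 * ?c * (?\<eta> * (G + 1 + P)) * 1 + (1/2) * W"
    proof (intro add_mono mult_right_mono mult_left_mono rr(3) W0)
      have "48 * E / r = 96 / r * (?\<eta> * (G + 1))" by (simp add: E_def)
      also have "\<dots> \<le> 96 / r * (?\<eta> * (G + 1 + P))" using rr(1) P(2) \<eta> by (intro mult_left_mono) auto
      finally show "48 * E / r \<le> 96 / r * (?\<eta> * (G + 1 + P))" .
      show "r powr \<gamma> \<le> 1" using rr \<gamma> by (intro powr_le1) auto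
    qed (use c \<eta> G0 P(2) in auto)
    also have "\<dots> = A + W / 2" by (simp add: A_def algebra_simps add_divide_distrib)
    finally show ?thesis .
  qed
  have A0: "A \<ge> 0" unfolding A_def using c rr G0 P(2) \<eta> by (intro mult_nonneg_nonneg add_nonneg_nonneg) auto
  \<comment> \<open>Outer absorption, of the sup norm of V, which starts from the trivial bound 2
    K.\<close>
  have "\<bar>V x $ i $ j\<bar> \<le> 2 * A"
  proof (rule half_absorb[where P="\<lambda>W. \<forall>x i j. \<bar>V x $ i $ j\<bar> \<le> W" and B="2 * K"])
    show "\<forall>x i j. \<bar>V x $ i $ j\<bar> \<le> 2 * K"
    proof (intro allI)
      fix x i j show "\<bar>V x $ i $ j\<bar> \<le> 2 * K" unfolding V_def using Kb[of "x + h" i j] Kb[of x i j] by simp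
    qed
  qed (use absorb A0 K0 in auto)
  then show ?thesis by (simp only: V_def A_def mult.assoc vector_minus_component)
qed

section \<open>Transport estimates\<close>

lemma norm_powr_eq: "norm (w::real^2) powr \<beta> = (w \<bullet> w) powr (\<beta> / 2)"
proof (cases "w = 0")
  case False
  then show ?thesis by (simp add: norm_eq_sqrt_inner powr_half_sqrt[symmetric] powr_powr mult.commute)
qed simp

lemma norm_powr_derivative:
  assumes "w \<noteq> (0::real^2)"
  shows "((\<lambda>w. norm w powr \<beta>) has_derivative (\<lambda>h. (\<beta> * (w \<bullet> w) powr (\<beta> / 2 - 1)) * (w \<bullet> h))) (at w)"
proof -
  have i: "((\<lambda>w::real^2. w \<bullet> w) has_derivative (\<lambda>h. 2 * (w \<bullet> h))) (at w)"
    by (auto intro!: derivative_eq_intros simp: inner_commute)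
  have "((\<lambda>s. s powr (\<beta> / 2)) has_real_derivative (\<beta> / 2) * (w \<bullet> w) powr (\<beta> / 2 - 1)) (at (w \<bullet> w))"
    using assms by (auto intro!: derivative_eq_intros)
  then have "((\<lambda>s. s powr (\<beta> / 2)) has_derivative (\<lambda>s. ((\<beta> / 2) * (w \<bullet> w) powr (\<beta> / 2 - 1)) * s)) (at (w \<bullet> w))"
    unfolding has_field_derivative_def .
  from has_derivative_compose[OF i this] show ?thesis
    unfolding norm_powr_eq by (simp add: mult_ac)
qed

lemma periodic_family_bounded:
  fixes g :: "real \<Rightarrow> real^2 \<Rightarrow> 'b::real_normed_vector"
  assumes "continuous_on ({0..\<tau>} \<times> UNIV) (\<lambda>(t, x). g t x)" "\<And>t. t \<in> {0..\<tau>} \<Longrightarrow> periodic (g t)"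
  obtains m where "m > 0" "\<And>t x. t \<in> {0..\<tau>} \<Longrightarrow> norm (g t x) \<le> m"
proof -
  have "compact ((\<lambda>(t, x). g t x) ` ({0..\<tau>} \<times> cbox 0 1))"
    by (intro compact_continuous_image continuous_on_subset[OF assms(1)] compact_Times) auto
  then obtain m where m: "m > 0" "\<And>y. y \<in> (\<lambda>(t, x). g t x) ` ({0..\<tau>} \<times> cbox 0 1) \<Longrightarrow> norm y \<le> m"
    by (metis bounded_pos compact_imp_bounded)
  have "norm (g t x) \<le> m" if t: "t \<in> {0..\<tau>}" for t x
  proof -
    obtain w where "lattice_vec w" "x + w \<in> cbox 0 1" using lattice_rep by blast
    then have "(\<lambda>(t, x). g t x) (t, x + w) \<in> (\<lambda>(t, x). g t x) ` ({0..\<tau>} \<times> cbox 0 1)"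
      using t by (intro imageI) auto
    from m(2)[OF this] show ?thesis using periodic_lattice[OF assms(2)[OF t] \<open>lattice_vec w\<close>] by simp
  qed
  with m(1) that show ?thesis by blast
qed

lemma global_max_gradient:
  assumes "(f has_derivative (\<lambda>h. p \<bullet> h)) (at x)" "\<And>y. f y \<le> f x"
  shows "p = (0::real^2)"
proof -
  have "(\<lambda>h. p \<bullet> h) = (\<lambda>v. 0)"
    by (rule differential_zero_maxmin[where S=UNIV and x=x and f=f]) (use assms in auto)
  then have "p \<bullet> p = 0" by metis
  then show ?thesis by simp
qed

text \<open>Maximum principle with the penalty \<kappa> t. At a maximum over the closed cylinder the
  spatial gradient vanishes, so the penalised function decreases in time at rate \<kappa> and was
  larger a moment earlier.\<close>

lemma transport_le:
  fixes g :: "real \<Rightarrow> real^2 \<Rightarrow> real"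
  assumes cont: "continuous_on ({0..\<tau>} \<times> UNIV) (\<lambda>(t, x). g t x)"
    and per: "\<And>t. t \<in> {0..\<tau>} \<Longrightarrow> periodic (g t)"
    and c1: "\<And>t. t \<in> {0..\<tau>} \<Longrightarrow> c1 (g t) (Dg t)"
    and eq: "\<And>t x. t \<in> {0..\<tau>} \<Longrightarrow> ((\<lambda>s. g s x) has_real_derivative - (u t x \<bullet> Dg t x)) (at t within {0..\<tau>})"
    and init: "\<And>x. g 0 x \<le> m" and t: "t \<in> {0..\<tau>}"
  shows "g t x \<le> m"
proof (rule ccontr)
  assume "\<not> g t x \<le> m"
  then have gt: "g t x > m" by simp
  \<comment> \<open>With this choice \<kappa> t stays below the excess over \<open>m\<close>, so the
    penalised maximum exceeds \<open>m\<close> and is not attained at time 0.\<close>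
  define \<kappa> where "\<kappa> = (g t x - m) / (2 * (\<tau> + 1))"
  have \<kappa>: "\<kappa> > 0" using gt t by (simp add: \<kappa>_def)
  let ?C = "{0..\<tau>} \<times> cbox 0 (1::real^2)"
  have "continuous_on ?C (\<lambda>z. (\<lambda>(t, x). g t x) z - \<kappa> * fst z)"
    by (intro continuous_intros continuous_on_subset[OF cont]) auto
  moreover have "compact ?C" by (intro compact_Times) auto
  moreover have "?C \<noteq> {}"
    using t lattice_rep[of x] by auto
  ultimately obtain z where z: "z \<in> ?C" "\<And>y. y \<in> ?C \<Longrightarrow> (\<lambda>(t, x). g t x) y - \<kappa> * fst y \<le> (\<lambda>(t, x). g t x) z - \<kappa> * fst z"
    by (metis (no_types, lifting) continuous_attains_sup)
  obtain s y where zs: "z = (s, y)" by (cases z)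
  have s: "s \<in> {0..\<tau>}" using z(1) zs by simp
  have mx: "g r v - \<kappa> * r \<le> g s y - \<kappa> * s" if "r \<in> {0..\<tau>}" for r v
  proof -
    obtain w where w: "lattice_vec w" "v + w \<in> cbox 0 1" using lattice_rep by blast
    then have "g r v = g r (v + w)" using periodic_lattice[OF per[OF that]] by simp
    then show ?thesis using z(2)[of "(r, v + w)"] w that zs by simp
  qed
  have "\<kappa> * (2 * (\<tau> + 1)) = g t x - m" proof -
    have "2 * (\<tau> + 1) \<noteq> 0" using t by auto
    then show ?thesis unfolding \<kappa>_def by (metis nonzero_mult_div_cancel_right times_divide_eq_left)
  qed
  then have "g t x - m = 2 * \<kappa> * (\<tau> + 1)" by (simp add: mult_ac)
  moreover have "\<kappa> * t < 2 * \<kappa> * (\<tau> + 1)"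
  proof -
    have "\<kappa> * t < \<kappa> * (2 * (\<tau> + 1))" using \<kappa> t by (intro mult_strict_left_mono) auto
    then show ?thesis by (simp add: mult_ac)
  qed
  ultimately have "g t x - \<kappa> * t > m" by linarith
  with mx[OF t, of x] have "g s y - \<kappa> * s > m" by linarith
  with init[of y] have "s \<noteq> 0" by auto
  then have s0: "s > 0" using s by simp
  have "Dg s y = 0"
  proof (rule global_max_gradient[where f="g s"])
    show "(g s has_derivative (\<lambda>h. Dg s y \<bullet> h)) (at y)" using c1[OF s] by (simp add: c1_def)
    show "g s v \<le> g s y" for v using mx[OF s, of v] by simp
  qed
  then have "((\<lambda>r. g r y) has_real_derivative 0) (at s within {0..\<tau>})" using eq[OF s, of y] by simp
  then have "((\<lambda>r. g r y - \<kappa> * r) has_real_derivative - \<kappa>) (at s within {0..\<tau>})"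
    by (auto intro!: derivative_eq_intros)
  from has_real_derivative_neg_dec_left[OF this] \<kappa> obtain d where
    d: "d > 0" "\<And>h. 0 < h \<Longrightarrow> s - h \<in> {0..\<tau>} \<Longrightarrow> h < d \<Longrightarrow> g s y - \<kappa> * s < g (s - h) y - \<kappa> * (s - h)" by auto
  define h where "h = min (d / 2) s"
  have h: "0 < h" "h < d" "s - h \<in> {0..\<tau>}" using d s s0 by (auto simp: h_def)
  from d(2)[OF h(1,3,2)] mx[OF h(3), of y] show False by simp
qed

text \<open>
  Doubling of variables: at a positive maximum of \<open>g t x - g t y - B t |x - y|^\<beta>\<close> both spatial gradients
  are those of the last term, so no flow map is needed.
\<close>

lemma transport_holder:
  fixes g :: "real \<Rightarrow> real^2 \<Rightarrow> real"
  assumes cont: "continuous_on ({0..\<tau>} \<times> UNIV) (\<lambda>(t, x). g t x)"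
    and per: "\<And>t. t \<in> {0..\<tau>} \<Longrightarrow> periodic (g t)"
    and c1: "\<And>t. t \<in> {0..\<tau>} \<Longrightarrow> c1 (g t) (Dg t)"
    and eq: "\<And>t x. t \<in> {0..\<tau>} \<Longrightarrow> ((\<lambda>s. g s x) has_real_derivative (R t x - u t x \<bullet> Dg t x)) (at t within {0..\<tau>})"
    and u: "\<And>t x y. t \<in> {0..\<tau>} \<Longrightarrow> norm (u t x - u t y) \<le> k t * norm (x - y)"
    and R: "\<And>t x y. t \<in> {0..\<tau>} \<Longrightarrow> \<bar>R t x - R t y\<bar> \<le> q t * norm (x - y) powr \<beta>"
    and B: "\<And>t. t \<in> {0..\<tau>} \<Longrightarrow> (B has_real_derivative B' t) (at t within {0..\<tau>})"
    and B0: "\<And>t. t \<in> {0..\<tau>} \<Longrightarrow> B t > 0" and B': "\<And>t. t \<in> {0..\<tau>} \<Longrightarrow> B' t > \<beta> * k t * B t + q t"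
    and \<beta>: "\<beta> > 0"
    and init: "\<And>x y. g 0 x - g 0 y \<le> B 0 * norm (x - y) powr \<beta>" and t: "t \<in> {0..\<tau>}"
  shows "g t x - g t y \<le> B t * norm (x - y) powr \<beta>"
proof (rule ccontr)
  assume "\<not> ?thesis"
  then have bad: "g t x - g t y - B t * norm (x - y) powr \<beta> > 0" by simp
  \<comment> \<open>Base point and difference as variables: \<open>v\<close> can be reduced to the
    unit cell by periodicity, and \<open>w\<close> is confined to a ball because Z is nonpositive
    for large |w|.\<close>
  define Z where "Z s v w = g s (v + w) - g s v - B s * norm w powr \<beta>" for s v w
  have badZ: "Z t y (x - y) > 0" using bad by (simp add: Z_def)
  obtain m where m: "m > 0" "\<And>s v. s \<in> {0..\<tau>} \<Longrightarrow> norm (g s v) \<le> m"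
    using periodic_family_bounded[OF cont per] by blast
  have cB: "continuous_on {0..\<tau>} B" using B by (meson DERIV_continuous continuous_on_eq_continuous_within)
  obtain b where b: "b > 0" "\<And>s. s \<in> {0..\<tau>} \<Longrightarrow> b \<le> B s"
  proof -
    have "\<exists>s\<in>{0..\<tau>}. \<forall>r\<in>{0..\<tau>}. B s \<le> B r"
      by (rule continuous_attains_inf[OF _ _ cB]) (use t in auto)
    with B0 that show ?thesis by blast
  qed
  \<comment> \<open>Beyond this distance the barrier exceeds the oscillation 2 m.\<close>
  define D where "D = ((2 * m + 1) / b) powr (1 / \<beta>)"
  have Zfar: "Z s v w \<le> 0" if s: "s \<in> {0..\<tau>}" and w: "norm w > D" for s v w
  proof -
    have "(2 * m + 1) / b = D powr \<beta>" unfolding D_def using m b \<beta> by (simp add: powr_powr)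
    also have "\<dots> \<le> norm w powr \<beta>" using w \<beta> by (intro powr_mono2) (auto simp: D_def)
    finally have "2 * m + 1 \<le> b * norm w powr \<beta>" using b by (simp add: divide_le_eq mult.commute)
    also have "\<dots> \<le> B s * norm w powr \<beta>" using b(2)[OF s] by (intro mult_right_mono) auto
    finally show ?thesis using m(2)[OF s, of v] m(2)[OF s, of "v + w"] by (simp add: Z_def abs_le_iff)
  qed
  let ?C = "{0..\<tau>} \<times> (cbox 0 (1::real^2) \<times> cball (0::real^2) D)"
  have red: "\<exists>v'. v' \<in> cbox 0 1 \<and> (\<forall>w. Z s v w = Z s v' w)" if s: "s \<in> {0..\<tau>}" for s v
  proof -
    obtain l where l: "lattice_vec l" "v + l \<in> cbox 0 1" using lattice_rep by blast
    have "g s (v + l + w) = g s (v + w)" for w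
      using periodic_lattice[OF per[OF s] l(1), of "v + w"] by (simp add: add_ac)
    moreover from this[of 0] have "g s (v + l) = g s v" by simp
    ultimately show ?thesis using l(2) by (intro exI[of _ "v + l"]) (simp add: Z_def)
  qed
  obtain y' where y': "y' \<in> cbox 0 1" "\<And>w. Z t y w = Z t y' w" using red[OF t, of y] by blast
  have nD: "norm (x - y) \<le> D" using Zfar[OF t, of "x - y" y] badZ by force
  have "continuous_on ?C (\<lambda>z. Z (fst z) (fst (snd z)) (snd (snd z)))"
  proof -
    have a: "continuous_on ?C (\<lambda>z. (\<lambda>(t, x). g t x) (fst z, fst (snd z) + snd (snd z)))"
      by (rule continuous_on_compose2[OF cont]) (auto intro!: continuous_intros)
    have b: "continuous_on ?C (\<lambda>z. (\<lambda>(t, x). g t x) (fst z, fst (snd z)))"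
      by (rule continuous_on_compose2[OF cont]) (auto intro!: continuous_intros)
    have c: "continuous_on ?C (\<lambda>z. B (fst z))"
      by (rule continuous_on_compose2[OF cB]) (auto intro!: continuous_intros)
    have d: "continuous_on ?C (\<lambda>z. norm (snd (snd z)) powr \<beta>)"
      using \<beta> by (intro continuous_on_powr' continuous_intros) auto
    from a b c d show ?thesis unfolding Z_def by (auto intro!: continuous_on_diff continuous_on_mult)
  qed
  moreover have "compact ?C" by (intro compact_Times compact_Icc compact_cbox compact_cball)
  moreover have "(t, y', x - y) \<in> ?C" using t y' nD by (simp add: dist_norm norm_minus_commute)
  ultimately obtain z where z: "z \<in> ?C" "\<And>y. y \<in> ?C \<Longrightarrow> Z (fst y) (fst (snd y)) (snd (snd y)) \<le> Z (fst z) (fst (snd z)) (snd (snd z))"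
    using continuous_attains_sup[of ?C "\<lambda>z. Z (fst z) (fst (snd z)) (snd (snd z))"] by blast
  obtain s v w where zs: "z = (s, v, w)" by (cases z) auto
  have s: "s \<in> {0..\<tau>}" using z(1) zs by simp
  have Zpos: "Z s v w > 0"
    using z(2)[OF \<open>(t, y', x - y) \<in> ?C\<close>] badZ y'(2) zs by simp
  have mx: "Z r v' w' \<le> Z s v w" if r: "r \<in> {0..\<tau>}" for r v' w'
  proof (cases "norm w' \<le> D")
    case True
    obtain v'' where v'': "v'' \<in> cbox 0 1" "\<And>w. Z r v' w = Z r v'' w" using red[OF r, of v'] by blast
    then show ?thesis using z(2)[of "(r, v'', w')"] True r zs by simp
  next
    case False
    then show ?thesis using Zfar[OF r, of w' v'] Zpos by linarith
  qed
  have w0: "w \<noteq> 0" using Zpos by (auto simp: Z_def)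
  have "Z 0 v w \<le> 0" using init[of "v + w" v] by (simp add: Z_def)
  then have s0: "s > 0" using Zpos s by (cases "s = 0") auto
  define c0 where "c0 = \<beta> * (w \<bullet> w) powr (\<beta> / 2 - 1)"
  have c0w: "c0 * (w \<bullet> w) = \<beta> * norm w powr \<beta>"
  proof -
    have "(w \<bullet> w) powr (\<beta> / 2 - 1) * (w \<bullet> w) = (w \<bullet> w) powr (\<beta> / 2)"
      using w0 by (simp add: powr_diff)
    then show ?thesis by (simp add: c0_def norm_powr_eq mult.assoc)
  qed
  have c00: "c0 > 0" using w0 \<beta> by (simp add: c0_def)
  \<comment> \<open>The gradient of B |w|^\<beta>, shared by \<open>g s\<close> at both points of
    the maximum; the transport terms then combine into one increment of \<open>u\<close> against
    \<open>p\<close>.\<close>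
  define p where "p = (B s * c0) *\<^sub>R w"
  have "Dg s (v + w) - p = 0"
  proof (rule global_max_gradient[where f="\<lambda>X. g s X - g s v - B s * norm (X - v) powr \<beta>"])
    show "((\<lambda>X. g s X - g s v - B s * norm (X - v) powr \<beta>) has_derivative (\<bullet>) (Dg s (v + w) - p)) (at (v + w))"
    proof -
      have 1: "(g s has_derivative (\<lambda>h. Dg s (v + w) \<bullet> h)) (at (v + w))" using c1[OF s] by (simp add: c1_def)
      have "((\<lambda>X. X - v) has_derivative (\<lambda>h. h)) (at (v + w))" by (auto intro!: derivative_eq_intros)
      from has_derivative_compose[OF this, of "\<lambda>w. norm w powr \<beta>" "\<lambda>h. c0 * (w \<bullet> h)"]
      have 2: "((\<lambda>X. norm (X - v) powr \<beta>) has_derivative (\<lambda>h. c0 * (w \<bullet> h))) (at (v + w))"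
        using norm_powr_derivative[OF w0, of \<beta>] by (simp add: c0_def)
      have "((\<lambda>X. g s X - g s v - B s * norm (X - v) powr \<beta>) has_derivative (\<lambda>h. Dg s (v + w) \<bullet> h - 0 - B s * (c0 * (w \<bullet> h)))) (at (v + w))"
        by (intro has_derivative_diff 1 has_derivative_mult_right 2 has_derivative_const)
      moreover have "(\<lambda>h. Dg s (v + w) \<bullet> h - 0 - B s * (c0 * (w \<bullet> h))) = (\<bullet>) (Dg s (v + w) - p)"
        by (rule ext) (simp add: p_def inner_diff_left)
      ultimately show ?thesis by simp
    qed
    show "g s X - g s v - B s * norm (X - v) powr \<beta> \<le> g s (v + w) - g s v - B s * norm (v + w - v) powr \<beta>" for X
      using mx[OF s, of v "X - v"] by (simp add: Z_def)
  qed
  then have p1: "Dg s (v + w) = p" by simp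
  have "p - Dg s v = 0"
  proof (rule global_max_gradient[where f="\<lambda>Y. g s (v + w) - g s Y - B s * norm (v + w - Y) powr \<beta>"])
    show "((\<lambda>Y. g s (v + w) - g s Y - B s * norm (v + w - Y) powr \<beta>) has_derivative (\<bullet>) (p - Dg s v)) (at v)"
    proof -
      have 1: "(g s has_derivative (\<lambda>h. Dg s v \<bullet> h)) (at v)" using c1[OF s] by (simp add: c1_def)
      have "((\<lambda>Y. v + w - Y) has_derivative (\<lambda>h. - h)) (at v)" by (auto intro!: derivative_eq_intros)
      from has_derivative_compose[OF this, of "\<lambda>w. norm w powr \<beta>" "\<lambda>h. c0 * (w \<bullet> h)"]
      have 2: "((\<lambda>Y. norm (v + w - Y) powr \<beta>) has_derivative (\<lambda>h. c0 * (w \<bullet> (- h)))) (at v)"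
        using norm_powr_derivative[OF w0, of \<beta>] by (simp add: c0_def)
      have "((\<lambda>Y. g s (v + w) - g s Y - B s * norm (v + w - Y) powr \<beta>) has_derivative (\<lambda>h. 0 - Dg s v \<bullet> h - B s * (c0 * (w \<bullet> (- h))))) (at v)"
        by (intro has_derivative_diff 1 has_derivative_mult_right 2 has_derivative_const)
      moreover have "(\<lambda>h. 0 - Dg s v \<bullet> h - B s * (c0 * (w \<bullet> (- h)))) = (\<bullet>) (p - Dg s v)"
        by (rule ext) (simp add: p_def inner_diff_left)
      ultimately show ?thesis by simp
    qed
    show "g s (v + w) - g s Y - B s * norm (v + w - Y) powr \<beta> \<le> g s (v + w) - g s v - B s * norm (v + w - v) powr \<beta>" for Y
      using mx[OF s, of Y "v + w - Y"] by (simp add: Z_def)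
  qed
  then have p2: "Dg s v = p" by simp
  let ?n = "norm w powr \<beta>"
  define d where "d = (R s (v + w) - u s (v + w) \<bullet> p) - (R s v - u s v \<bullet> p) - B' s * ?n"
  have dZ: "((\<lambda>r. Z r v w) has_real_derivative d) (at s within {0..\<tau>})"
    unfolding Z_def d_def
    using DERIV_diff[OF DERIV_diff[OF eq[OF s, of "v + w"] eq[OF s, of v]] DERIV_cmult_right[OF B[OF s], of ?n]]
    by (simp add: p1 p2)
  \<comment> \<open>As \<open>p\<close> is parallel to \<open>w\<close>, |w| |p| = \<beta> B
    |w|^\<beta>. The drift thus costs \<beta> k B and the source q, both per |w|^\<beta>, and B
    grows faster than their sum.\<close>
  have "d < 0"
  proof -
    have n0: "?n > 0" using w0 by simp
    have "R s (v + w) - R s v \<le> q s * ?n" using R[OF s, of "v + w" v] by simp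
    moreover have "- ((u s (v + w) - u s v) \<bullet> p) \<le> \<beta> * k s * B s * ?n"
    proof -
      have "- ((u s (v + w) - u s v) \<bullet> p) \<le> norm (u s (v + w) - u s v) * norm p"
        using Cauchy_Schwarz_ineq2[of "u s (v + w) - u s v" p] by linarith
      also have "\<dots> \<le> (k s * norm w) * norm p" using u[OF s, of "v + w" v] by (intro mult_right_mono) auto
      also have "norm p = B s * c0 * norm w" using B0[OF s] c00 by (simp add: p_def)
      also have "(k s * norm w) * (B s * c0 * norm w) = k s * B s * (c0 * (w \<bullet> w))"
        by (simp add: power2_norm_eq_inner[symmetric] power2_eq_square)
      also have "\<dots> = \<beta> * k s * B s * ?n" unfolding c0w by simp
      finally show ?thesis .
    qed
    moreover have "(\<beta> * k s * B s + q s) * ?n < B' s * ?n" by (intro mult_strict_right_mono B' s n0)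
    ultimately show ?thesis unfolding d_def by (simp add: inner_diff_left algebra_simps)
  qed
  from has_real_derivative_neg_dec_left[OF dZ this] obtain e where
    e: "e > 0" "\<And>h. 0 < h \<Longrightarrow> s - h \<in> {0..\<tau>} \<Longrightarrow> h < e \<Longrightarrow> Z s v w < Z (s - h) v w" by auto
  define h where "h = min (e / 2) s"
  have h: "0 < h" "h < e" "s - h \<in> {0..\<tau>}" using e s s0 by (auto simp: h_def)
  from e(2)[OF h(1,3,2)] mx[OF h(3), of v w] show False by simp
qed

text \<open>The increments are taken in the direction R x - R y and their length is sent to
  0.\<close>

lemma gradient_holder_of_increments:
  assumes r: "c1 \<rho> R" and b: "\<And>h. h \<noteq> 0 \<Longrightarrow> (\<rho> (x + h) - \<rho> x) - (\<rho> (y + h) - \<rho> y) \<le> b * norm h"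
    and b0: "0 \<le> b"
  shows "norm (R x - R y) \<le> b"
proof (rule ccontr)
  assume "\<not> norm (R x - R y) \<le> b"
  then have n: "norm (R x - R y) > b" by simp
  define v where "v = R x - R y"
  have v0: "norm v > 0" using n b0 unfolding v_def by linarith
  have "((\<lambda>s. \<rho> (x + s *\<^sub>R v) - \<rho> (y + s *\<^sub>R v) - b * norm v * s) has_real_derivative
     R (x + 0 *\<^sub>R v) \<bullet> v - R (y + 0 *\<^sub>R v) \<bullet> v - b * norm v * 1) (at 0 within UNIV)"
    by (intro DERIV_diff c1_line[OF r] DERIV_cmult DERIV_ident)
  moreover have "R (x + 0 *\<^sub>R v) \<bullet> v - R (y + 0 *\<^sub>R v) \<bullet> v - b * norm v * 1 = (norm v - b) * norm v"
  proof -
    have "R x \<bullet> v - R y \<bullet> v = norm v * norm v"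
      by (simp add: v_def inner_diff_left[symmetric] power2_norm_eq_inner[symmetric] power2_eq_square[symmetric])
    then show ?thesis by (simp add: left_diff_distrib)
  qed
  ultimately have "((\<lambda>s. \<rho> (x + s *\<^sub>R v) - \<rho> (y + s *\<^sub>R v) - b * norm v * s) has_real_derivative (norm v - b) * norm v) (at 0 within UNIV)"
    by simp
  from has_real_derivative_pos_inc_right[OF this] n v0 obtain d where
    d: "d > 0" "\<And>h. 0 < h \<Longrightarrow> h < d \<Longrightarrow> \<rho> x - \<rho> y < \<rho> (x + h *\<^sub>R v) - \<rho> (y + h *\<^sub>R v) - b * norm v * h"
    by (auto simp: v_def)
  from d(2)[of "d / 2"] d(1) have "\<rho> x - \<rho> y < \<rho> (x + (d/2) *\<^sub>R v) - \<rho> (y + (d/2) *\<^sub>R v) - b * norm v * (d / 2)" by simp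
  moreover have "(\<rho> (x + (d/2) *\<^sub>R v) - \<rho> x) - (\<rho> (y + (d/2) *\<^sub>R v) - \<rho> y) \<le> b * norm ((d/2) *\<^sub>R v)"
    by (rule b) (use d(1) v0 in auto)
  ultimately show False using d(1) by (simp add: mult_ac)
qed

text \<open>The gradient need not be differentiable, so its evolution is replaced by that of
  difference quotients, uniformly in \<open>h\<close>. Their source contains increments of
  \<open>u\<close>, which \<open>inc\<close> bounds by the very seminorm to be estimated;
  \<open>fin\<close> makes it finite, so \<open>half_absorb\<close> applies.\<close>

lemma transport_gradient_holder:
  fixes \<rho> :: "real \<Rightarrow> real^2 \<Rightarrow> real"
  assumes cont: "continuous_on ({0..\<tau>} \<times> UNIV) (\<lambda>(t, x). \<rho> t x)"
    and per: "\<And>t. t \<in> {0..\<tau>} \<Longrightarrow> periodic (\<rho> t)"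
    and c1: "\<And>t. t \<in> {0..\<tau>} \<Longrightarrow> c1 (\<rho> t) (R t)"
    and eq: "\<And>t x. t \<in> {0..\<tau>} \<Longrightarrow> ((\<lambda>s. \<rho> s x) has_real_derivative - (u t x \<bullet> R t x)) (at t within {0..\<tau>})"
    and u: "\<And>t x y. t \<in> {0..\<tau>} \<Longrightarrow> norm (u t x - u t y) \<le> k * norm (x - y)"
    and G: "\<And>t x. t \<in> {0..\<tau>} \<Longrightarrow> norm (R t x) \<le> G"
    and inc: "\<And>t P x y h. t \<in> {0..\<tau>} \<Longrightarrow> P \<ge> 0 \<Longrightarrow> (\<And>x y. norm (R t x - R t y) \<le> P * norm (x - y) powr \<alpha>) \<Longrightarrow>
        norm ((u t (x + h) - u t x) - (u t (y + h) - u t y)) \<le> c * (1 + P) * norm h * norm (x - y) powr \<alpha>"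
    and fin: "\<And>t x y. t \<in> {0..\<tau>} \<Longrightarrow> norm (R t x - R t y) \<le> P0 * norm (x - y) powr \<alpha>" "P0 \<ge> 0"
    and init: "\<And>x y. norm (R 0 x - R 0 y) \<le> N0 * norm (x - y) powr \<alpha>" "N0 \<ge> 0"
    and \<alpha>: "0 < \<alpha>" "\<alpha> \<le> 1" and k: "k \<ge> 0" and c: "c \<ge> 0" and t: "t \<in> {0..\<tau>}"
  shows "norm (R t x - R t y) \<le> 2 * (N0 + 1) * exp ((3 * k + 2 * c * G + 1) * t) * norm (x - y) powr \<alpha>"
proof -
  \<comment> \<open>One \<open>k\<close> covers the drift, 2 k the increments of R, 2 c G the
    increments of \<open>u\<close>; the final 1 makes the differential inequality strict.\<close>
  define \<mu> where "\<mu> = 3 * k + 2 * c * G + 1"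
  have G0: "G \<ge> 0" using G[OF t, of 0] norm_ge_zero order_trans by blast
  have \<mu>: "\<mu> > 0" using k c G0 by (simp add: \<mu>_def add_nonneg_pos)
  \<comment> \<open>The extra 1 lets the barrier dominate the inhomogeneous term in 1 + P.\<close>
  define A where "A = N0 + 1"
  have step: "norm (R t x - R t y) \<le> ((A + q / 2) * exp (\<mu> * t)) * norm (x - y) powr \<alpha>"
    if q0: "q \<ge> 0" and q: "\<And>t x y. t \<in> {0..\<tau>} \<Longrightarrow> norm (R t x - R t y) \<le> (q * exp (\<mu> * t)) * norm (x - y) powr \<alpha>"
      and t: "t \<in> {0..\<tau>}" for q t x y
  proof (rule gradient_holder_of_increments[OF c1[OF t]])
    define B where "B t = (A + q / 2) * exp (\<mu> * t)" for t
    have A0: "A + q / 2 \<ge> 1" using init q0 by (simp add: A_def)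
    have B0: "B t > 0" for t using A0 by (simp add: B_def)
    show "0 \<le> (A + q / 2) * exp (\<mu> * t) * norm (x - y) powr \<alpha>" using A0 by simp
    fix h :: "real^2" assume h: "h \<noteq> 0"
    then have n: "norm h > 0" by simp
    \<comment> \<open>Division by |h| makes the barrier independent of \<open>h\<close>.\<close>
    let ?g = "\<lambda>t x. (1 / norm h) * (\<rho> t (x + h) - \<rho> t x)"
    let ?D = "\<lambda>t x. (1 / norm h) *\<^sub>R (R t (x + h) - R t x)"
    let ?S = "\<lambda>t x. - ((1 / norm h) * ((u t (x + h) - u t x) \<bullet> R t (x + h)))"
    let ?q = "\<lambda>t. c * (1 + q * exp (\<mu> * t)) * G + k * (q * exp (\<mu> * t))"
    have "?g t x - ?g t y \<le> B t * norm (x - y) powr \<alpha>"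
    proof (rule transport_holder[where g="?g" and Dg="?D" and R="?S" and u=u and k="\<lambda>t. k" and q="?q" and B'="\<lambda>t. \<mu> * B t"])
      have a: "continuous_on ({0..\<tau>} \<times> UNIV) (\<lambda>z. (\<lambda>(t, x). \<rho> t x) (fst z, snd z + h))"
        by (rule continuous_on_compose2[OF cont]) (auto intro!: continuous_intros)
      have b: "continuous_on ({0..\<tau>} \<times> UNIV) (\<lambda>z. (\<lambda>(t, x). \<rho> t x) (fst z, snd z))"
        by (rule continuous_on_compose2[OF cont]) (auto intro!: continuous_intros)
      show "continuous_on ({0..\<tau>} \<times> UNIV) (\<lambda>(t, x). ?g t x)"
        using continuous_on_mult[OF continuous_on_const continuous_on_diff[OF a b], of "1 / norm h"] by (simp add: split_beta)
      fix s assume s: "s \<in> {0..\<tau>}"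
      show "periodic (?g s)"
      proof -
        have "\<rho> s (x + axis i 1 + h) = \<rho> s (x + h)" "\<rho> s (x + axis i 1) = \<rho> s x" for x i
          using periodic_shift[OF per[OF s], of h] per[OF s] by (auto simp: periodic_def)
        then show ?thesis by (simp add: periodic_def)
      qed
      show "c1 (?g s) (?D s)" by (intro c1_cmult c1_diff c1_shift c1[OF s])
      show "((\<lambda>s. ?g s x) has_real_derivative (?S s x - u s x \<bullet> ?D s x)) (at s within {0..\<tau>})" for x
      proof -
        have "((\<lambda>s. ?g s x) has_real_derivative (1 / norm h) * (- (u s (x + h) \<bullet> R s (x + h)) - - (u s x \<bullet> R s x))) (at s within {0..\<tau>})"
          by (intro DERIV_cmult DERIV_diff eq[OF s])
        also have "(1 / norm h) * (- (u s (x + h) \<bullet> R s (x + h)) - - (u s x \<bullet> R s x)) = ?S s x - u s x \<bullet> ?D s x"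
          by (simp add: inner_diff_left inner_diff_right right_diff_distrib diff_divide_distrib)
        finally show ?thesis .
      qed
      show "norm (u s x - u s y) \<le> k * norm (x - y)" for x y by (rule u[OF s])
      show "\<bar>?S s x - ?S s y\<bar> \<le> ?q s * norm (x - y) powr \<alpha>" for x y
      proof -
        let ?U = "\<lambda>x. u s (x + h) - u s x"
        have qs: "q * exp (\<mu> * s) \<ge> 0" using q0 by simp
        have "?S s x - ?S s y = - ((1 / norm h) * ((?U x - ?U y) \<bullet> R s (x + h) + ?U y \<bullet> (R s (x + h) - R s (y + h))))"
          by (simp add: inner_diff_left inner_diff_right algebra_simps add_divide_distrib diff_divide_distrib)
        then have "\<bar>?S s x - ?S s y\<bar> = (1 / norm h) * \<bar>(?U x - ?U y) \<bullet> R s (x + h) + ?U y \<bullet> (R s (x + h) - R s (y + h))\<bar>"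
          by (simp add: abs_mult)
        also have "\<dots> \<le> (1 / norm h) * ((c * (1 + q * exp (\<mu> * s)) * norm h * norm (x - y) powr \<alpha>) * G
            + (k * norm h) * (q * exp (\<mu> * s) * norm (x - y) powr \<alpha>))"
        proof (intro mult_left_mono)
          have "\<bar>(?U x - ?U y) \<bullet> R s (x + h)\<bar> \<le> norm (?U x - ?U y) * norm (R s (x + h))" by (rule Cauchy_Schwarz_ineq2)
          also have "\<dots> \<le> (c * (1 + q * exp (\<mu> * s)) * norm h * norm (x - y) powr \<alpha>) * G"
            using inc[OF s qs q[OF s], of x h y] c qs by (intro mult_mono G s) auto
          finally have 1: "\<bar>(?U x - ?U y) \<bullet> R s (x + h)\<bar> \<le> (c * (1 + q * exp (\<mu> * s)) * norm h * norm (x - y) powr \<alpha>) * G" .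
          have "\<bar>?U y \<bullet> (R s (x + h) - R s (y + h))\<bar> \<le> norm (?U y) * norm (R s (x + h) - R s (y + h))" by (rule Cauchy_Schwarz_ineq2)
          also have "\<dots> \<le> (k * norm h) * (q * exp (\<mu> * s) * norm (x - y) powr \<alpha>)"
            using u[OF s, of "y + h" y] q[OF s, of "x + h" "y + h"] k by (intro mult_mono) auto
          finally show "\<bar>(?U x - ?U y) \<bullet> R s (x + h) + ?U y \<bullet> (R s (x + h) - R s (y + h))\<bar>
            \<le> (c * (1 + q * exp (\<mu> * s)) * norm h * norm (x - y) powr \<alpha>) * G + (k * norm h) * (q * exp (\<mu> * s) * norm (x - y) powr \<alpha>)"
            using 1 by linarith
        qed simp
        also have "\<dots> = ?q s * norm (x - y) powr \<alpha>" using n by (simp add: field_simps)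
        finally show ?thesis .
      qed
      show "(B has_real_derivative \<mu> * B s) (at s within {0..\<tau>})"
        unfolding B_def by (auto intro!: derivative_eq_intros)
      show "B s > 0" by (rule B0)
      show "\<alpha> * k * B s + ?q s < \<mu> * B s"
      proof -
        let ?e = "exp (\<mu> * s)"
        have e1: "1 \<le> ?e" using \<mu> s by simp
        have "\<alpha> * k * B s \<le> 1 * k * B s" using \<alpha> k B0[of s] by (intro mult_right_mono) auto
        moreover have "c * (1 + q * ?e) * G \<le> 2 * c * G * B s"
        proof -
          have "1 \<le> (A + q / 2) * ?e" using mult_mono[OF A0 e1] A0 by simp
          moreover have "q * ?e \<le> (2 * (A + q / 2) - 1) * ?e" using A0 init by (intro mult_right_mono) (auto simp: A_def)
          moreover have "(2 * (A + q / 2) - 1) * ?e = 2 * ((A + q / 2) * ?e) - ?e" by (simp add: algebra_simps)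
          ultimately have "1 + q * ?e \<le> 2 * B s" unfolding B_def using e1 by linarith
          then have "(c * G) * (1 + q * ?e) \<le> (c * G) * (2 * B s)" using c G0 by (intro mult_left_mono) auto
          then show ?thesis by (simp add: mult_ac)
        qed
        moreover have "k * (q * ?e) \<le> 2 * k * B s"
        proof -
          have "q * ?e \<le> (2 * (A + q / 2)) * ?e" using init by (intro mult_right_mono) (auto simp: A_def)
          then have "k * (q * ?e) \<le> k * (2 * (A + q / 2) * ?e)" using k by (intro mult_left_mono) auto
          then show ?thesis by (simp add: B_def mult_ac)
        qed
        moreover have "\<mu> * B s = 3 * (k * B s) + 2 * c * G * B s + B s" by (simp add: \<mu>_def algebra_simps)
        ultimately show ?thesis using B0[of s] by linarith
      qed
    next
      show "0 < \<alpha>" by (rule \<alpha>)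
      show "t \<in> {0..\<tau>}" by (rule t)
      have z: "0 \<in> {0..\<tau>}" using t by auto
      show "?g 0 x - ?g 0 y \<le> B 0 * norm (x - y) powr \<alpha>" for x y
      proof -
        have "(\<rho> 0 (x + h) - \<rho> 0 x) - (\<rho> 0 (y + h) - \<rho> 0 y) \<le> N0 * norm h * norm (x - y) powr \<alpha>"
          using holder_increment[OF c1[OF z] init(1), of h] unfolding holder_def by (meson abs_le_iff)
        then have "(1 / norm h) * ((\<rho> 0 (x + h) - \<rho> 0 x) - (\<rho> 0 (y + h) - \<rho> 0 y)) \<le> (1 / norm h) * (N0 * norm h * norm (x - y) powr \<alpha>)"
          using n by (intro mult_left_mono) auto
        also have "\<dots> = N0 * norm (x - y) powr \<alpha>" using n by simp
        also have "\<dots> \<le> B 0 * norm (x - y) powr \<alpha>" using q0 by (intro mult_right_mono) (auto simp: B_def A_def)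
        finally show ?thesis by (simp only: right_diff_distrib)
      qed
    qed
    then have "(1 / norm h) * ((\<rho> t (x + h) - \<rho> t x) - (\<rho> t (y + h) - \<rho> t y)) \<le> B t * norm (x - y) powr \<alpha>"
      by (simp only: right_diff_distrib)
    then have "norm h * ((1 / norm h) * ((\<rho> t (x + h) - \<rho> t x) - (\<rho> t (y + h) - \<rho> t y))) \<le> norm h * (B t * norm (x - y) powr \<alpha>)"
      using n by (intro mult_left_mono) auto
    then show "(\<rho> t (x + h) - \<rho> t x) - (\<rho> t (y + h) - \<rho> t y) \<le> ((A + q / 2) * exp (\<mu> * t) * norm (x - y) powr \<alpha>) * norm h"
      using n by (simp add: B_def mult_ac)
  qed
  show ?thesis
  proof (cases "x = y")
    case False
    then have n: "exp (\<mu> * t) * norm (x - y) powr \<alpha> > 0" by simp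
    have "norm (R t x - R t y) / (exp (\<mu> * t) * norm (x - y) powr \<alpha>) \<le> 2 * A"
    proof (rule half_absorb[where P="\<lambda>q. \<forall>t\<in>{0..\<tau>}. \<forall>x y. norm (R t x - R t y) \<le> (q * exp (\<mu> * t)) * norm (x - y) powr \<alpha>" and B=P0])
      show "\<forall>t\<in>{0..\<tau>}. \<forall>x y. norm (R t x - R t y) \<le> P0 * exp (\<mu> * t) * norm (x - y) powr \<alpha>"
      proof (intro ballI allI)
        fix s and x y :: "real^2" assume s: "s \<in> {0..\<tau>}"
        have "P0 * 1 \<le> P0 * exp (\<mu> * s)" using fin(2) \<mu> s by (intro mult_left_mono) auto
        then have "P0 * norm (x - y) powr \<alpha> \<le> P0 * exp (\<mu> * s) * norm (x - y) powr \<alpha>" by (intro mult_right_mono) auto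
        then show "norm (R s x - R s y) \<le> P0 * exp (\<mu> * s) * norm (x - y) powr \<alpha>" using fin(1)[OF s, of x y] by linarith
      qed
      fix W assume "\<forall>t\<in>{0..\<tau>}. \<forall>x y. norm (R t x - R t y) \<le> W * exp (\<mu> * t) * norm (x - y) powr \<alpha>"
      with t n show "norm (R t x - R t y) / (exp (\<mu> * t) * norm (x - y) powr \<alpha>) \<le> W"
        by (simp add: divide_le_eq mult.assoc)
    qed (use step fin init in \<open>auto simp: A_def\<close>)
    then show ?thesis using n by (simp add: divide_le_eq mult.assoc A_def \<mu>_def)
  qed simp
qed

section \<open>Lifespan of the classical branch\<close>

lemma norm_matvec_le: "norm ((A::real^2^2) *v w) \<le> norm A * norm w"
proof (rule power2_le_imp_le)
  have c: "(A $ i \<bullet> w)\<^sup>2 \<le> (A $ i \<bullet> A $ i) * (w \<bullet> w)" for i by (rule Cauchy_Schwarz_ineq)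
  have e: "norm (A *v w) ^ 2 = (A $ 1 \<bullet> w)\<^sup>2 + (A $ 2 \<bullet> w)\<^sup>2"
    unfolding power2_norm_eq_inner inner2 matrix_vector_mul_component by (simp add: power2_eq_square)
  have a: "norm A ^ 2 = A $ 1 \<bullet> A $ 1 + A $ 2 \<bullet> A $ 2"
    by (simp add: power2_norm_eq_inner inner_vec_def[of A A] sum_2)
  show "(norm (A *v w))\<^sup>2 \<le> (norm A * norm w)\<^sup>2"
    unfolding e power_mult_distrib a using c[of 1] c[of 2]
    by (simp add: power2_norm_eq_inner distrib_right)
qed simp

text \<open>The mean value theorem has no equality form for vector-valued maps; testing with g x - g
  y reduces it to a scalar function.\<close>

lemma pot_lipschitz_bound:
  assumes p: "pot g H" and k: "\<And>x. norm (H x) \<le> k"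
  shows "norm (g x - g y) \<le> k * norm (x - y)"
proof -
  define v where "v = g x - g y"
  have c: "c1 (\<lambda>z. v $ 1 * g z $ 1 + v $ 2 * g z $ 2) (\<lambda>z. v $ 1 *\<^sub>R H z $ 1 + v $ 2 *\<^sub>R H z $ 2)"
    by (intro c1_add c1_cmult pot_c1[OF p])
  obtain s where s: "(v $ 1 * g (y + (x - y)) $ 1 + v $ 2 * g (y + (x - y)) $ 2) - (v $ 1 * g y $ 1 + v $ 2 * g y $ 2)
      = (v $ 1 *\<^sub>R H (y + s *\<^sub>R (x - y)) $ 1 + v $ 2 *\<^sub>R H (y + s *\<^sub>R (x - y)) $ 2) \<bullet> (x - y)"
    using c1_mean_value[OF c, of y "x - y"] by blast
  let ?A = "H (y + s *\<^sub>R (x - y))"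
  have "v \<bullet> v = (v $ 1 * g x $ 1 + v $ 2 * g x $ 2) - (v $ 1 * g y $ 1 + v $ 2 * g y $ 2)"
    by (simp add: inner2 v_def algebra_simps)
  also have "\<dots> = v \<bullet> (?A *v (x - y))"
    using s by (simp add: inner2[of v] matrix_vector_mul_component inner_add_left)
  also have "\<dots> \<le> norm v * norm (?A *v (x - y))" by (rule norm_cauchy_schwarz)
  also have "\<dots> \<le> norm v * (k * norm (x - y))"
    by (intro mult_left_mono order_trans[OF norm_matvec_le] mult_right_mono k) auto
  finally have "norm v * norm v \<le> norm v * (k * norm (x - y))" by (simp add: power2_norm_eq_inner[symmetric] power2_eq_square)
  then show ?thesis
  proof (cases "norm v = 0")
    case True
    have "0 \<le> k" using order_trans[OF norm_ge_zero k] .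
    then show ?thesis using True by (simp add: v_def[symmetric])
  qed (simp add: v_def)
qed

lemma norm_mat_le_entries: "(\<And>i j. \<bar>(A::real^2^2) $ i $ j\<bar> \<le> c) \<Longrightarrow> norm A \<le> 4 * c"
proof -
  assume a: "\<And>i j. \<bar>A $ i $ j\<bar> \<le> c"
  show ?thesis using norm_mat_le[of A] a[of 1 1] a[of 1 2] a[of 2 1] a[of 2 2] by linarith
qed

lemma entry_le_norm: "\<bar>(A::real^2^2) $ i $ j\<bar> \<le> norm A"
  using component_le_norm_cart[of "A $ i" j] Finite_Cartesian_Product.norm_nth_le[of A i] by simp

lemma perp_grad_diff_norm: "norm (perp_grad f x - perp_grad f y) = norm (grad f x - grad f y)"
proof -
  have "norm (perp_grad f x - perp_grad f y) ^ 2 = norm (grad f x - grad f y) ^ 2"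
    unfolding power2_norm_eq_inner by (simp add: inner2 perp_grad_def algebra_simps)
  then show ?thesis by simp
qed

lemma perp_grad_increment_norm:
  "norm ((perp_grad f a - perp_grad f b) - (perp_grad f c - perp_grad f d))
    = norm ((grad f a - grad f b) - (grad f c - grad f d))"
proof -
  have "norm ((perp_grad f a - perp_grad f b) - (perp_grad f c - perp_grad f d)) ^ 2
    = norm ((grad f a - grad f b) - (grad f c - grad f d)) ^ 2"
    unfolding power2_norm_eq_inner by (simp add: inner2 perp_grad_def algebra_simps)
  then show ?thesis by simp
qed

lemma det_ma: "det (mat 1 + \<epsilon> *\<^sub>R (A::real^2^2)) = 1 + \<epsilon> * (tr2 A + \<epsilon> * det2 A)"
  by (simp add: det_2 mat_def tr2_def det2_def algebra_simps)

lemma time_interval_sub: "t \<in> time_interval T \<Longrightarrow> {0..t} \<subseteq> time_interval T"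
proof
  fix s assume "t \<in> time_interval T" "s \<in> {0..t}"
  then have "0 \<le> s" "ereal s \<le> ereal t" "ereal t < T" by (auto simp: time_interval_def)
  then show "s \<in> time_interval T" unfolding time_interval_def using le_less_trans by blast
qed

lemma sol_facts:
  assumes sol: "sg_classical_solution \<alpha> \<epsilon> \<rho>0 T \<rho> \<psi>" and \<epsilon>: "\<epsilon> > 0" and t: "t \<in> time_interval T"
  shows sol_pot: "pot (grad (\<psi> t)) (hess (\<psi> t))" and sol_c1: "c1 (\<rho> t) (grad (\<rho> t))"
    and sol_per: "periodic (\<rho> t)"
    and sol_eq: "tr2 (hess (\<psi> t) x) + \<epsilon> * det2 (hess (\<psi> t) x) = \<rho> t x"
    and sol_pos: "0 < 1 + \<epsilon> * hess (\<psi> t) x $ 1 $ 1"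
    and sol_mean: "torus_integral (\<rho> t) = 0"
    and sol_transport: "((\<lambda>s. \<rho> s x) has_real_derivative - (perp_grad (\<psi> t) x \<bullet> grad (\<rho> t) x)) (at t within time_interval T)"
proof -
  note s = sol[unfolded sg_classical_solution_def]
  show "pot (grad (\<psi> t)) (hess (\<psi> t))" using s t by (intro C2_pot) blast+
  show "c1 (\<rho> t) (grad (\<rho> t))" using s t by (intro C1_c1) blast
  show "periodic (\<rho> t)" using s t by blast
  have "det (mat 1 + \<epsilon> *\<^sub>R hess (\<psi> t) x) = 1 + \<epsilon> * \<rho> t x" using s t by blast
  then show "tr2 (hess (\<psi> t) x) + \<epsilon> * det2 (hess (\<psi> t) x) = \<rho> t x" using \<epsilon> by (simp add: det_ma)
  have "\<forall>v. v \<noteq> 0 \<longrightarrow> 0 < v \<bullet> ((mat 1 + \<epsilon> *\<^sub>R hess (\<psi> t) x) *v v)" using s t by blast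
  moreover have "(axis 1 1 :: real^2) \<noteq> 0" by (metis axis2_nth(1) zero_index zero_neq_one)
  ultimately have "0 < axis 1 1 \<bullet> ((mat 1 + \<epsilon> *\<^sub>R hess (\<psi> t) x) *v axis 1 1)" by blast
  then show "0 < 1 + \<epsilon> * hess (\<psi> t) x $ 1 $ 1"
    by (simp add: inner_axis' matrix_vector_mul_component inner_axis mat_def)
  show "torus_integral (\<rho> t) = 0" using s t by blast
  have "\<exists>\<rho>\<^sub>t. ((\<lambda>s. \<rho> s x) has_real_derivative \<rho>\<^sub>t) (at t within time_interval T) \<and>
        \<rho>\<^sub>t + perp_grad (\<psi> t) x \<bullet> grad (\<rho> t) x = 0" using s t by blast
  then show "((\<lambda>s. \<rho> s x) has_real_derivative - (perp_grad (\<psi> t) x \<bullet> grad (\<rho> t) x)) (at t within time_interval T)"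
    by (metis add_eq_0_iff2 add.commute minus_unique)
qed

lemma sol_cont:
  assumes sol: "sg_classical_solution \<alpha> \<epsilon> \<rho>0 T \<rho> \<psi>" and t: "t \<in> time_interval T"
  shows sol_cont_rho: "continuous_on ({0..t} \<times> UNIV) (\<lambda>(t, x). \<rho> t x)"
    and sol_cont_hess: "continuous_on ({0..t} \<times> UNIV) (\<lambda>(t, x). hess (\<psi> t) x)"
proof -
  have sub: "{0..t} \<times> (UNIV::(real^2) set) \<subseteq> time_interval T \<times> UNIV" using time_interval_sub[OF t] by auto
  show "continuous_on ({0..t} \<times> UNIV) (\<lambda>(t, x). \<rho> t x)" "continuous_on ({0..t} \<times> UNIV) (\<lambda>(t, x). hess (\<psi> t) x)"
    using sol unfolding sg_classical_solution_def by (auto intro: continuous_on_subset[OF _ sub])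
qed

lemma sol_sup:
  assumes sol: "sg_classical_solution \<alpha> \<epsilon> \<rho>0 T \<rho> \<psi>" and \<epsilon>: "\<epsilon> > 0" and t: "t \<in> time_interval T"
    and m: "\<And>x. \<bar>\<rho>0 x\<bar> \<le> m"
  shows "\<bar>\<rho> t x\<bar> \<le> m"
proof -
  have r0: "\<rho> 0 = \<rho>0" using sol by (simp add: sg_classical_solution_def)
  have tt: "t \<in> {0..t}" using t by (simp add: time_interval_def)
  note sub = time_interval_sub[OF t]
  have d: "((\<lambda>s. \<rho> s x) has_real_derivative - (perp_grad (\<psi> s) x \<bullet> grad (\<rho> s) x)) (at s within {0..t})" if "s \<in> {0..t}" for s x
    using has_field_derivative_subset[OF sol_transport[OF sol \<epsilon>] sub] that sub by blast
  have m': "\<rho>0 x \<le> m" "- \<rho>0 x \<le> m" for x using m[of x] by auto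
  have "\<rho> t x \<le> m"
    by (rule transport_le[OF sol_cont_rho[OF sol t] sol_per[OF sol \<epsilon>] sol_c1[OF sol \<epsilon>] d _ tt])
      (use sub m' in \<open>auto simp: r0\<close>)
  moreover have "- \<rho> t x \<le> m"
  proof (rule transport_le[where g="\<lambda>t x. - \<rho> t x" and Dg="\<lambda>t x. - grad (\<rho> t) x" and u="\<lambda>t. perp_grad (\<psi> t)" and \<tau>=t])
    show "continuous_on ({0..t} \<times> UNIV) (\<lambda>(t, x). - \<rho> t x)"
      using continuous_on_minus[OF sol_cont_rho[OF sol t]] by (simp add: split_beta)
    fix s assume s: "s \<in> {0..t}"
    then have s': "s \<in> time_interval T" using sub by blast
    show "periodic (\<lambda>x. - \<rho> s x)" by (rule periodic_compose[OF sol_per[OF sol \<epsilon> s']])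
    show "c1 (\<lambda>x. - \<rho> s x) (\<lambda>x. - grad (\<rho> s) x)" using c1_cmult[OF sol_c1[OF sol \<epsilon> s'], of "-1"] by simp
    show "((\<lambda>s. - \<rho> s x) has_real_derivative - (perp_grad (\<psi> s) x \<bullet> - grad (\<rho> s) x)) (at s within {0..t})" for x
      using DERIV_minus[OF d[OF s, of x]] by simp
  qed (use m' tt in \<open>auto simp: r0\<close>)
  ultimately show ?thesis by simp
qed

lemma holder_of_lipschitz:
  assumes m: "\<And>x. \<bar>p x\<bar> \<le> m" and l: "\<And>x y. \<bar>p x - p y\<bar> \<le> b * norm (x - y)" and b: "b \<ge> 0" and \<gamma>: "0 < \<gamma>" "\<gamma> < 1"
  shows "holder \<gamma> (2 * m + b) p"
  unfolding holder_def
proof (intro allI)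
  fix x y :: "real^2"
  have m0: "m \<ge> 0" using m[of x] by linarith
  let ?d = "norm (x - y)"
  consider "?d = 0" | "0 < ?d" "?d \<le> 1" | "?d > 1" using norm_ge_zero[of "x - y"] by linarith
  then show "\<bar>p x - p y\<bar> \<le> (2 * m + b) * ?d powr \<gamma>"
  proof cases
    case 1 then show ?thesis by simp
  next
    case 2
    have "\<bar>p x - p y\<bar> \<le> b * ?d" by (rule l)
    also have "\<dots> \<le> (2 * m + b) * ?d powr \<gamma>"
      using powr_ge_self[OF 2 \<gamma>] b m0 by (intro mult_mono) auto
    finally show ?thesis .
  next
    case 3
    have "1 \<le> ?d powr \<gamma>" using 3 \<gamma> by (simp add: ge_one_powr_ge_zero)
    then have "2 * m * 1 \<le> (2 * m + b) * ?d powr \<gamma>" using b m0 by (intro mult_mono) auto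
    then show ?thesis using m[of x] m[of y] by linarith
  qed
qed

section \<open>Bootstrap for the Lipschitz constant of the density\<close>

lemma limit_le:
  fixes f :: "real \<Rightarrow> real"
  assumes f: "continuous_on {0..t} f" and t: "t > 0" and le: "\<And>s. 0 \<le> s \<Longrightarrow> s < t \<Longrightarrow> f s \<le> 0"
  shows "f t \<le> 0"
proof (rule ccontr)
  assume n: "\<not> f t \<le> 0"
  then obtain d where d: "d > 0" "\<And>s. s \<in> {0..t} \<Longrightarrow> dist s t < d \<Longrightarrow> dist (f s) (f t) < f t"
    using f t unfolding continuous_on_iff by (metis atLeastAtMost_iff less_eq_real_def not_le)
  define s where "s = max 0 (t - d / 2)"
  have s: "0 \<le> s" "s < t" "dist s t < d" using d(1) t by (auto simp: s_def dist_real_def)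
  have "dist (f s) (f t) < f t" by (rule d(2)) (use s in auto)
  then have "f s > 0" by (simp add: dist_real_def abs_if split: if_splits)
  then show False using le[OF s(1,2)] by simp
qed

text \<open>The property delivered by \<open>ma_estimate\<close>, named so that one constant per
  exponent can be fixed before the datum and \<epsilon>.\<close>

definition ma_const :: "real \<Rightarrow> real \<Rightarrow> bool" where
  "ma_const \<gamma> D \<longleftrightarrow> D \<ge> 1 \<and> (\<forall>\<epsilon> M S \<rho> g H. 0 < \<epsilon> \<and> 0 < M \<and> 0 \<le> S \<and> periodic \<rho> \<and> continuous_on UNIV \<rho> \<and> torus_integral \<rho> = 0
     \<and> (\<forall>x. \<bar>\<rho> x\<bar> \<le> M) \<and> holder \<gamma> S \<rho> \<and> D * \<epsilon> * M * (lamb M S)\<^sup>2 \<le> 1 \<and> pot g H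
     \<and> (\<forall>x. 0 < 1 + \<epsilon> * H x $ 1 $ 1) \<and> (\<forall>x. tr2 (H x) + \<epsilon> * det2 (H x) = \<rho> x)
     \<longrightarrow> (\<forall>x i j. \<bar>H x $ i $ j\<bar> \<le> D * M * lamb M S) \<and> (\<forall>i j. holder \<gamma> (D * (S + M)) (\<lambda>x. H x $ i $ j)))"

text \<open>For Lipschitz constant M e^Y the logarithmic loss is linear in Y, which is why Y grows
  only exponentially in time. The argument 2 M + M e^Y is the seminorm bound from
  \<open>holder_of_lipschitz\<close>; 5 comes from 1 + ln 4 \<le> 4 and Y \<ge> 1.\<close>

lemma lamb_exp_bound:
  assumes "M > 0" "Y \<ge> 1"
  shows "lamb M (2 * M + M * exp Y) \<le> 5 * Y" "1 \<le> lamb M (2 * M + M * exp Y)"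
proof -
  have "(2 * M + M * exp Y + M) / M = 3 + exp Y" using assms by (simp add: field_simps)
  then have l: "lamb M (2 * M + M * exp Y) = 1 + ln (3 + exp Y)" by (simp add: lamb_def)
  have "1 \<le> exp Y" using assms by simp
  then have "ln (3 + exp Y) \<le> ln (4 * exp Y)" by (intro ln_mono) (auto intro: add_pos_pos)
  also have "\<dots> = ln 4 + Y" by (simp add: ln_mult)
  also have "ln (4::real) \<le> 3" using ln_le_minus_one[of 4] by simp
  finally show "lamb M (2 * M + M * exp Y) \<le> 5 * Y" using l assms by simp
  show "1 \<le> lamb M (2 * M + M * exp Y)" by (rule lamb_ge) (use assms in auto)
qed

text \<open>25 is the square of the 5 in \<open>lamb_exp_bound\<close>, and 20 = 4 * 5, the 4
  passing from entries to the Frobenius norm.\<close>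

lemma sol_hess_estimate:
  assumes sol: "sg_classical_solution \<alpha> \<epsilon> \<rho>0 T \<rho> \<psi>" and \<epsilon>: "\<epsilon> > 0" and t: "t \<in> time_interval T"
    and D: "ma_const \<gamma> D" and \<gamma>: "0 < \<gamma>" "\<gamma> < 1" and M: "M > 0" "\<And>x. \<bar>\<rho>0 x\<bar> \<le> M" and Y: "Y \<ge> 1"
    and lip: "\<And>x y. \<bar>\<rho> t x - \<rho> t y\<bar> \<le> M * exp Y * norm (x - y)" and small: "25 * D * \<epsilon> * M * Y\<^sup>2 \<le> 1"
  shows "norm (hess (\<psi> t) x) \<le> 20 * D * M * Y" "holder \<gamma> (D * (3 * M + M * exp Y)) (\<lambda>x. hess (\<psi> t) x $ i $ j)"
proof -
  define S where "S = 2 * M + M * exp Y"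
  have L: "lamb M S \<le> 5 * Y" "1 \<le> lamb M S" unfolding S_def by (rule lamb_exp_bound[OF M(1) Y])+
  have rb: "\<bar>\<rho> t x\<bar> \<le> M" for x by (rule sol_sup[OF sol \<epsilon> t M(2)])
  have h: "holder \<gamma> S (\<rho> t)" unfolding S_def by (rule holder_of_lipschitz[OF rb lip _ \<gamma>]) (use M in simp)
  have D1: "D \<ge> 1" using D by (simp add: ma_const_def)
  have "(lamb M S)\<^sup>2 \<le> (5 * Y)\<^sup>2" using L by (intro power_mono) auto
  then have "D * \<epsilon> * M * (lamb M S)\<^sup>2 \<le> D * \<epsilon> * M * (5 * Y)\<^sup>2"
    using D1 \<epsilon> M by (intro mult_left_mono) auto
  also have "\<dots> \<le> 1" using small by (simp add: power_mult_distrib mult_ac)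
  finally have sm: "D * \<epsilon> * M * (lamb M S)\<^sup>2 \<le> 1" .
  have S0: "0 \<le> S" using M by (simp add: S_def)
  have "0 < \<epsilon> \<and> 0 < M \<and> 0 \<le> S \<and> periodic (\<rho> t) \<and> continuous_on UNIV (\<rho> t) \<and> torus_integral (\<rho> t) = 0
     \<and> (\<forall>x. \<bar>\<rho> t x\<bar> \<le> M) \<and> holder \<gamma> S (\<rho> t) \<and> D * \<epsilon> * M * (lamb M S)\<^sup>2 \<le> 1 \<and> pot (grad (\<psi> t)) (hess (\<psi> t))
     \<and> (\<forall>x. 0 < 1 + \<epsilon> * hess (\<psi> t) x $ 1 $ 1) \<and> (\<forall>x. tr2 (hess (\<psi> t) x) + \<epsilon> * det2 (hess (\<psi> t) x) = \<rho> t x)"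
    using \<epsilon> M(1) S0 sol_facts[OF sol \<epsilon> t] c1_cont[OF sol_c1[OF sol \<epsilon> t]] rb h sm by simp
  with D have *: "\<And>x i j. \<bar>hess (\<psi> t) x $ i $ j\<bar> \<le> D * M * lamb M S" "\<And>i j. holder \<gamma> (D * (S + M)) (\<lambda>x. hess (\<psi> t) x $ i $ j)"
    unfolding ma_const_def by blast+
  have "norm (hess (\<psi> t) x) \<le> 4 * (D * M * lamb M S)" by (rule norm_mat_le_entries[OF *(1)])
  also have "\<dots> \<le> 4 * (D * M * (5 * Y))" using L D1 M by (intro mult_left_mono) auto
  finally show "norm (hess (\<psi> t) x) \<le> 20 * D * M * Y" by simp
  show "holder \<gamma> (D * (3 * M + M * exp Y)) (\<lambda>x. hess (\<psi> t) x $ i $ j)"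
    using *(2)[of i j] by (simp add: S_def algebra_simps)
qed

text \<open>
  The three constants \<open>20 < 21 < 22\<close> separate the estimate, the bootstrap threshold and the growth rate of \<open>Y\<close>:
  up to the first time at which \<open>|D^2\<psi>|\<close> reaches \<open>21 D M Y\<close>, the Lipschitz constant stays below
  \<open>M e^Y\<close>, and then \<open>|D^2\<psi>| \<le> 20 D M Y\<close>.
\<close>

lemma sol_bootstrap:
  assumes sol: "sg_classical_solution \<alpha> \<epsilon> \<rho>0 T \<rho> \<psi>" and \<epsilon>: "\<epsilon> > 0" and \<tau>: "\<tau> \<in> time_interval T"
    and D: "ma_const \<gamma> D" and \<gamma>: "0 < \<gamma>" "\<gamma> < 1" and M: "M > 0" "\<And>x. \<bar>\<rho>0 x\<bar> \<le> M"
    and Y0: "Y0 \<ge> 1" "\<And>x. norm (grad \<rho>0 x) \<le> M * exp Y0"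
    and Y: "Y = (\<lambda>t. Y0 * exp (22 * D * M * t))"
    and small: "25 * D * \<epsilon> * M * (Y \<tau>)\<^sup>2 \<le> 1" and t: "t \<in> {0..\<tau>}"
  shows "norm (hess (\<psi> t) x) \<le> 20 * D * M * Y t" "\<bar>\<rho> t x - \<rho> t y\<bar> \<le> M * exp (Y t) * norm (x - y)"
    "holder \<gamma> (D * (3 * M + M * exp (Y t))) (\<lambda>x. hess (\<psi> t) x $ i $ j)"
proof -
  have D1: "D \<ge> 1" using D by (simp add: ma_const_def)
  have r0: "\<rho> 0 = \<rho>0" using sol by (simp add: sg_classical_solution_def)
  have Yge: "Y t \<ge> 1" if "t \<ge> 0" for t
  proof -
    have "1 \<le> exp (22 * D * M * t)" using D1 M that by simp
    then have "1 * 1 \<le> Y0 * exp (22 * D * M * t)" using Y0 by (intro mult_mono) auto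
    then show ?thesis by (simp add: Y)
  qed
  have Ymono: "Y s \<le> Y t" if "s \<le> t" for s t
    unfolding Y using that D1 M Y0 by (auto intro!: mult_left_mono)
  have sm: "25 * D * \<epsilon> * M * (Y t)\<^sup>2 \<le> 1" if "t \<in> {0..\<tau>}" for t
  proof -
    have "(Y t)\<^sup>2 \<le> (Y \<tau>)\<^sup>2" using Ymono[of t \<tau>] Yge[of t] that by (intro power_mono) auto
    then have "25 * D * \<epsilon> * M * (Y t)\<^sup>2 \<le> 25 * D * \<epsilon> * M * (Y \<tau>)\<^sup>2" using D1 \<epsilon> M by (intro mult_left_mono) auto
    with small show ?thesis by linarith
  qed
  have inI: "t \<in> time_interval T" if "t \<in> {0..\<tau>}" for t using time_interval_sub[OF \<tau>] that by blast
  have lip0: "\<bar>\<rho> 0 x - \<rho> 0 y\<bar> \<le> M * exp (Y 0) * norm (x - y)" for x y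
    unfolding r0 using c1_lipschitz[OF _ Y0(2)] sol_c1[OF sol \<epsilon> inI, of 0] \<tau> by (simp add: r0 Y time_interval_def)
  have lip: "\<bar>\<rho> t x - \<rho> t y\<bar> \<le> M * exp (Y t) * norm (x - y)"
    if t: "t \<in> {0..\<tau>}" and b: "\<And>s x. s \<in> {0..t} \<Longrightarrow> norm (hess (\<psi> s) x) \<le> 21 * D * M * Y s" for t x y
  proof -
    note tI = inI[OF t] and sub = time_interval_sub[OF inI[OF t]]
    have "\<rho> t x - \<rho> t y \<le> (M * exp (Y t)) * norm (x - y) powr 1" for x y
    proof (rule transport_holder[where R="\<lambda>t x. 0" and q="\<lambda>t. 0" and k="\<lambda>t. 21 * D * M * Y t" and u="\<lambda>t. perp_grad (\<psi> t)"
        and Dg="\<lambda>t. grad (\<rho> t)" and \<tau>=t and B="\<lambda>t. M * exp (Y t)" and B'="\<lambda>t. M * (exp (Y t) * (22 * D * M * Y t))"])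
      show "continuous_on ({0..t} \<times> UNIV) (\<lambda>(t, x). \<rho> t x)" by (rule sol_cont_rho[OF sol tI])
      show "t \<in> {0..t}" using t by simp
      show "\<rho> 0 x - \<rho> 0 y \<le> M * exp (Y 0) * norm (x - y) powr 1" for x y using lip0[of x y] by simp
      fix s assume s: "s \<in> {0..t}"
      then have sI: "s \<in> time_interval T" using sub by blast
      show "periodic (\<rho> s)" "c1 (\<rho> s) (grad (\<rho> s))" using sol_facts[OF sol \<epsilon> sI] by auto
      show "((\<lambda>s. \<rho> s x) has_real_derivative 0 - perp_grad (\<psi> s) x \<bullet> grad (\<rho> s) x) (at s within {0..t})" for x
        using has_field_derivative_subset[OF sol_transport[OF sol \<epsilon> sI] sub] by simp
      show "norm (perp_grad (\<psi> s) x - perp_grad (\<psi> s) y) \<le> 21 * D * M * Y s * norm (x - y)" for x y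
        unfolding perp_grad_diff_norm by (rule pot_lipschitz_bound[OF sol_pot[OF sol \<epsilon> sI] b[OF s]])
      show "((\<lambda>t. M * exp (Y t)) has_real_derivative M * (exp (Y s) * (22 * D * M * Y s))) (at s within {0..t})"
        unfolding Y by (auto intro!: derivative_eq_intros)
      show "0 < M * exp (Y s)" using M by simp
      have "0 < D * M * Y s" using D1 M Yge[of s] s by simp
      then have "21 * D * M * Y s < 22 * D * M * Y s" by simp
      then have "(M * exp (Y s)) * (21 * D * M * Y s) < (M * exp (Y s)) * (22 * D * M * Y s)"
        using M by (intro mult_strict_left_mono) auto
      then show "1 * (21 * D * M * Y s) * (M * exp (Y s)) + 0 < M * (exp (Y s) * (22 * D * M * Y s))" by (simp add: mult_ac)
    qed auto
    from this[of x y] this[of y x] show ?thesis by (simp add: norm_minus_commute abs_le_iff)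
  qed
  have b: "norm (hess (\<psi> t) x) < 21 * D * M * Y t" if t: "t \<in> {0..\<tau>}" for t x
  proof (rule ccontr)
    assume bad: "\<not> ?thesis"
    let ?f = "\<lambda>z. norm ((\<lambda>(t, x). hess (\<psi> t) x) z) - 21 * D * M * Y (fst z)"
    let ?C = "{0..\<tau>} \<times> cbox 0 (1::real^2)"
    have cY: "continuous_on S Y" for S unfolding Y by (intro continuous_intros)
    have cf: "continuous_on ?C ?f"
    proof (intro continuous_intros)
      show "continuous_on ?C (\<lambda>(t, x). hess (\<psi> t) x)"
        by (rule continuous_on_subset[OF sol_cont_hess[OF sol \<tau>]]) auto
      show "continuous_on ?C (\<lambda>z. Y (fst z))"
        by (rule continuous_on_compose2[OF cY[of UNIV]]) (auto intro!: continuous_intros)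
    qed
    have cC: "compact ?C" by (intro compact_Times) auto
    then have "closed (?C \<inter> ?f -` {0..})"
      by (intro continuous_closed_preimage[OF cf compact_imp_closed[OF cC]] closed_atLeast)
    then have cX: "compact (?C \<inter> (?C \<inter> ?f -` {0..}))" by (rule compact_Int_closed[OF cC])
    \<comment> \<open>The times at which the threshold is reached somewhere in the unit cell. They
      form a compact set, so there is a first one.\<close>
    define X where "X = fst ` (?C \<inter> (?C \<inter> ?f -` {0..}))"
    have X: "compact X" unfolding X_def by (intro compact_continuous_image cX continuous_intros)
    have Xmem: "s \<in> X" if s: "s \<in> {0..\<tau>}" and "norm (hess (\<psi> s) y) \<ge> 21 * D * M * Y s" for s y
    proof -
      obtain w where w: "lattice_vec w" "y + w \<in> cbox 0 1" using lattice_rep by blast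
      have "hess (\<psi> s) (y + w) = hess (\<psi> s) y"
        using periodic_lattice[OF pot_periodic[OF sol_pot[OF sol \<epsilon> inI[OF s]]] w(1)] .
      then have "(s, y + w) \<in> ?C \<inter> (?C \<inter> ?f -` {0..})" using w s that by simp
      then show ?thesis unfolding X_def by force
    qed
    have "t \<in> X" by (rule Xmem[OF t, of x]) (use bad in simp)
    then obtain s where s: "s \<in> X" "\<And>r. r \<in> X \<Longrightarrow> s \<le> r" using compact_attains_inf[OF X] by blast
    then obtain y where y: "s \<in> {0..\<tau>}" "norm (hess (\<psi> s) y) \<ge> 21 * D * M * Y s" unfolding X_def by auto
    have before: "norm (hess (\<psi> r) z) < 21 * D * M * Y r" if "0 \<le> r" "r < s" for r z
    proof (rule ccontr)
      assume "\<not> ?thesis"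
      then have "r \<in> X" using that y by (intro Xmem[of r z]) auto
      with s(2) that show False by force
    qed
    have "\<bar>\<rho> s x - \<rho> s y\<bar> \<le> M * exp (Y s) * norm (x - y)" for x y
    proof (cases "s = 0")
      case True
      then show ?thesis using lip0 by simp
    next
      case False
      then have s0: "s > 0" using y by simp
      show ?thesis
      proof (rule lip[OF y(1)])
        fix r z assume r: "r \<in> {0..s}"
        \<comment> \<open>Before the first bad time the inequality is strict; at that time itself
          the weak form follows by continuity.\<close>
        have "norm (hess (\<psi> s) z) - 21 * D * M * Y s \<le> 0"
        proof (rule limit_le[OF _ s0, where f="\<lambda>r. norm (hess (\<psi> r) z) - 21 * D * M * Y r"])
          have "continuous_on {0..s} (\<lambda>r. (\<lambda>(t, x). hess (\<psi> t) x) (r, z))"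
            by (rule continuous_on_compose2[OF sol_cont_hess[OF sol \<tau>]]) (use y in \<open>auto intro!: continuous_intros\<close>)
          then show "continuous_on {0..s} (\<lambda>r. norm (hess (\<psi> r) z) - 21 * D * M * Y r)"
            by (intro continuous_intros cY) simp
        qed (use before in \<open>force simp: less_imp_le\<close>)
        then show "norm (hess (\<psi> r) z) \<le> 21 * D * M * Y r" using before[of r z] r by (cases "r = s") auto
      qed
    qed
    from sol_hess_estimate(1)[OF sol \<epsilon> inI[OF y(1)] D \<gamma> M Yge this sm[OF y(1)], of y] y(1)
    have "norm (hess (\<psi> s) y) \<le> 20 * D * M * Y s" by simp
    moreover have "0 < D * M * Y s" using D1 M Yge[of s] y by simp
    ultimately show False using y(2) by simp
  qed
  have l: "\<bar>\<rho> t x - \<rho> t y\<bar> \<le> M * exp (Y t) * norm (x - y)" for x y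
    by (rule lip[OF t]) (use b t in \<open>auto intro!: less_imp_le\<close>)
  then show "\<bar>\<rho> t x - \<rho> t y\<bar> \<le> M * exp (Y t) * norm (x - y)" .
  have Yt: "Y t \<ge> 1" using Yge t by simp
  show "norm (hess (\<psi> t) x) \<le> 20 * D * M * Y t" "holder \<gamma> (D * (3 * M + M * exp (Y t))) (\<lambda>x. hess (\<psi> t) x $ i $ j)"
    using sol_hess_estimate[OF sol \<epsilon> inI[OF t] D \<gamma> M Yt l sm[OF t]] by auto
qed

section \<open>Continuation of the branch\<close>

lemma exists_small_radius:
  assumes "Z \<ge> 0" "0 < \<gamma>"
  shows "\<exists>r>0. r \<le> 1/6 \<and> Z * r powr \<gamma> \<le> (1/2::real)"
proof -
  define r where "r = min (1/6) ((1 / (2 * Z + 1)) powr (1 / \<gamma>))"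
  have r: "0 < r" "r \<le> 1/6" using assms by (auto simp: r_def)
  have p: "(u powr (1 / \<gamma>)) powr \<gamma> = u" if "0 < u" for u using that assms by (simp add: powr_powr)
  have "r powr \<gamma> \<le> ((1 / (2 * Z + 1)) powr (1 / \<gamma>)) powr \<gamma>"
    using r assms by (intro powr_mono2) (auto simp: r_def)
  also have "\<dots> = 1 / (2 * Z + 1)" by (rule p) (use assms in simp)
  finally have "Z * r powr \<gamma> \<le> Z * (1 / (2 * Z + 1))" using assms by (intro mult_left_mono) auto
  also have "\<dots> \<le> 1/2" using assms by (simp add: field_simps)
  finally show ?thesis using r by blast
qed

lemma gradient_le_lipschitz:
  assumes r: "c1 p P" and b: "\<And>x y. \<bar>p x - p y\<bar> \<le> b * norm (x - y)" and b0: "0 \<le> b"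
  shows "norm (P x) \<le> b"
proof (rule ccontr)
  assume "\<not> ?thesis"
  then have n: "norm (P x) > b" by simp
  define v where "v = P x"
  have v0: "norm v > 0" using n b0 unfolding v_def by linarith
  have "((\<lambda>s. p (x + s *\<^sub>R v) - b * norm v * s) has_real_derivative P (x + 0 *\<^sub>R v) \<bullet> v - b * norm v * 1) (at 0 within UNIV)"
    by (intro DERIV_diff c1_line[OF r] DERIV_cmult DERIV_ident)
  moreover have "P (x + 0 *\<^sub>R v) \<bullet> v - b * norm v * 1 = (norm v - b) * norm v"
    by (simp add: v_def left_diff_distrib power2_norm_eq_inner[symmetric] power2_eq_square)
  ultimately have "((\<lambda>s. p (x + s *\<^sub>R v) - b * norm v * s) has_real_derivative (norm v - b) * norm v) (at 0 within UNIV)"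
    by simp
  from has_real_derivative_pos_inc_right[OF this] n v0 obtain d where
    d: "d > 0" "\<And>h. 0 < h \<Longrightarrow> h < d \<Longrightarrow> p x < p (x + h *\<^sub>R v) - b * norm v * h" by (auto simp: v_def)
  from d(2)[of "d / 2"] d(1) have "p x < p (x + (d/2) *\<^sub>R v) - b * norm v * (d / 2)" by simp
  moreover have "\<bar>p (x + (d/2) *\<^sub>R v) - p x\<bar> \<le> b * norm ((d/2) *\<^sub>R v)" using b[of "x + (d/2) *\<^sub>R v" x] by simp
  moreover have "b * norm ((d/2) *\<^sub>R v) = b * norm v * (d / 2)" using d(1) by simp
  ultimately show False by linarith
qed

lemma holder_exponent_mono:
  fixes R :: "real^2 \<Rightarrow> 'b::real_normed_vector"
  assumes P: "\<And>x y. norm (R x - R y) \<le> P * norm (x - y) powr \<alpha>" "P \<ge> 0" and G: "\<And>x. norm (R x) \<le> G"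
    and \<gamma>: "0 < \<gamma>" "\<gamma> \<le> \<alpha>"
  shows "norm (R x - R y) \<le> (P + 2 * G) * norm (x - y) powr \<gamma>"
proof -
  let ?d = "norm (x - y)"
  have G0: "G \<ge> 0" using order_trans[OF norm_ge_zero G] .
  consider "?d = 0" | "0 < ?d" "?d \<le> 1" | "?d > 1" using norm_ge_zero[of "x - y"] by linarith
  then show ?thesis
  proof cases
    case 1 then show ?thesis by simp
  next
    case 2
    have "norm (R x - R y) \<le> P * ?d powr \<alpha>" by (rule P)
    also have "\<dots> \<le> (P + 2 * G) * ?d powr \<gamma>" using 2 G0 P(2) \<gamma> by (intro mult_mono powr_mono') auto
    finally show ?thesis .
  next
    case 3
    have "1 \<le> ?d powr \<gamma>" using 3 \<gamma> by (simp add: ge_one_powr_ge_zero)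
    then have "2 * G * 1 \<le> (P + 2 * G) * ?d powr \<gamma>" using G0 P(2) by (intro mult_mono) auto
    then show ?thesis using norm_triangle_ineq4[of "R x" "R y"] G[of x] G[of y] by linarith
  qed
qed

text \<open>The increments by \<open>h\<close> and by y - x are interchanged, so that the Lipschitz
  bound on H acts on the latter. At distances above 1 the sup bound takes over, which makes every
  exponent \<alpha> \<le> 1 admissible.\<close>

lemma pot_second_increment:
  assumes p: "pot g H" and k: "\<And>x. norm (H x) \<le> k" and l: "\<And>x h. norm (H (x + h) - H x) \<le> l * norm h" "l \<ge> 0"
    and \<alpha>: "0 < \<alpha>" "\<alpha> \<le> 1"
  shows "norm ((g (x + h) - g x) - (g (y + h) - g y)) \<le> (l + 2 * k) * norm h * norm (x - y) powr \<alpha>"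
proof -
  let ?d = "norm (x - y)"
  have k0: "k \<ge> 0" using order_trans[OF norm_ge_zero k] .
  have b: "norm (H z - H (z + (y - x))) \<le> (l + 2 * k) * ?d powr \<alpha>" for z
  proof -
    consider "?d = 0" | "0 < ?d" "?d \<le> 1" | "?d > 1" using norm_ge_zero[of "x - y"] by linarith
    then show ?thesis
    proof cases
      case 1 then show ?thesis by simp
    next
      case 2
      have "norm (H z - H (z + (y - x))) \<le> l * ?d" using l(1)[of z "y - x"] by (simp add: norm_minus_commute)
      also have "\<dots> \<le> (l + 2 * k) * ?d powr \<alpha>"
        using powr_mono'[of \<alpha> 1 ?d] 2 \<alpha> k0 l(2) by (intro mult_mono) auto
      finally show ?thesis .
    next
      case 3
      have "1 \<le> ?d powr \<alpha>" using 3 \<alpha> by (simp add: ge_one_powr_ge_zero)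
      then have "2 * k * 1 \<le> (l + 2 * k) * ?d powr \<alpha>" using k0 l(2) by (intro mult_mono) auto
      then show ?thesis using norm_triangle_ineq4[of "H z" "H (z + (y - x))"] k[of z] k[of "z + (y - x)"] by linarith
    qed
  qed
  have "pot (\<lambda>z. g z - g (z + (y - x))) (\<lambda>z. H z - H (z + (y - x)))" by (rule pot_diff[OF p pot_shift[OF p]])
  from pot_lipschitz_bound[OF this b, of "x + h" x]
  have "norm ((g (x + h) - g (x + h + (y - x))) - (g x - g (x + (y - x)))) \<le> (l + 2 * k) * ?d powr \<alpha> * norm h" by simp
  moreover have "x + h + (y - x) = y + h" "x + (y - x) = y" by simp_all
  ultimately have "norm ((g (x + h) - g (y + h)) - (g x - g y)) \<le> (l + 2 * k) * ?d powr \<alpha> * norm h" by (simp only:)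
  moreover have "(g (x + h) - g x) - (g (y + h) - g y) = (g (x + h) - g (y + h)) - (g x - g y)" by simp
  ultimately show ?thesis by (simp only: mult_ac)
qed

lemma uniformly_elliptic_small:
  assumes "norm (\<epsilon> *\<^sub>R H) \<le> 1/2"
  shows "uniformly_elliptic (1/2) (mat 1 + \<epsilon> *\<^sub>R H)"
  unfolding uniformly_elliptic_def
proof (intro allI)
  fix v :: "real^2"
  have "v \<bullet> ((mat 1 + \<epsilon> *\<^sub>R H) *v v) = v \<bullet> v + v \<bullet> ((\<epsilon> *\<^sub>R H) *v v)"
    by (simp add: matrix_vector_mult_add_rdistrib inner_add_right)
  moreover have "\<bar>v \<bullet> ((\<epsilon> *\<^sub>R H) *v v)\<bar> \<le> (1/2) * (v \<bullet> v)"
  proof -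
    have "\<bar>v \<bullet> ((\<epsilon> *\<^sub>R H) *v v)\<bar> \<le> norm v * norm ((\<epsilon> *\<^sub>R H) *v v)" by (rule Cauchy_Schwarz_ineq2)
    also have "\<dots> \<le> norm v * (1/2 * norm v)"
      by (intro mult_left_mono order_trans[OF norm_matvec_le] mult_right_mono assms) auto
    finally show ?thesis by (simp add: power2_norm_eq_inner[symmetric] power2_eq_square)
  qed
  moreover have "0 \<le> v \<bullet> v" "1 / (1 / 2) * (v \<bullet> v) = 2 * (v \<bullet> v)" by simp_all
  moreover have "1 / 2 * q \<le> a \<and> a \<le> b" if "a = q + w" "\<bar>w\<bar> \<le> 1 / 2 * q" "0 \<le> q" "b = 2 * q" for a b q w :: real
    using that by auto
  ultimately show "1 / 2 * (v \<bullet> v) \<le> v \<bullet> ((mat 1 + \<epsilon> *\<^sub>R H) *v v) \<and> v \<bullet> ((mat 1 + \<epsilon> *\<^sub>R H) *v v) \<le> 1 / (1 / 2) * (v \<bullet> v)"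
    by blast
qed

text \<open>For finite T the continuation clause of \<open>sg_local_theory\<close> contradicts the
  maximality of the branch.\<close>

lemma branch_continuation:
  assumes loc: sg_local_theory and \<alpha>: "0 < \<alpha>" "\<alpha> \<le> 1" and \<epsilon>: "\<epsilon> > 0" and dat: "torus_C1_holder \<alpha> \<rho>0" "torus_integral \<rho>0 = 0"
    and br: "sg_branch \<alpha> \<epsilon> \<rho>0 T \<rho> \<psi>" and pos: "\<And>x. 0 < 1 + \<epsilon> * \<rho>0 x"
    and \<delta>: "\<delta> > 0" "\<And>t x. t \<in> time_interval T \<Longrightarrow> \<delta> \<le> 1 + \<epsilon> * \<rho> t x"
    and K: "\<And>t. t \<in> time_interval T \<Longrightarrow> C1_holder_bound \<alpha> K (\<rho> t)"
    and el: "\<And>t x. t \<in> time_interval T \<Longrightarrow> uniformly_elliptic (1/2) (mat 1 + \<epsilon> *\<^sub>R hess (\<psi> t) x)"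
  shows "T = \<infinity>"
proof (rule ccontr)
  assume "T \<noteq> \<infinity>"
  then have T: "T < \<infinity>" by simp
  have half: "(0::real) < 1/2" by simp
  have sol: "sg_classical_solution \<alpha> \<epsilon> \<rho>0 T \<rho> \<psi>" using br by (simp add: sg_branch_def)
  have "\<forall>T \<rho> \<psi>. sg_classical_solution \<alpha> \<epsilon> \<rho>0 T \<rho> \<psi> \<and> T < \<infinity> \<and>
           (\<exists>\<delta>>0. \<forall>t\<in>time_interval T. \<forall>x. \<delta> \<le> 1 + \<epsilon> * \<rho> t x) \<and>
           (\<exists>K. \<forall>t\<in>time_interval T. C1_holder_bound \<alpha> K (\<rho> t)) \<and>
           (\<exists>\<kappa>>0. \<forall>t\<in>time_interval T. \<forall>x. uniformly_elliptic \<kappa> (mat 1 + \<epsilon> *\<^sub>R hess (\<psi> t) x)) \<longrightarrow>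
           (\<exists>T' \<rho>' \<psi>'. T < T' \<and> sg_classical_solution \<alpha> \<epsilon> \<rho>0 T' \<rho>' \<psi>' \<and>
              (\<forall>t\<in>time_interval T. \<rho>' t = \<rho> t \<and> \<psi>' t = \<psi> t))"
    by (rule loc[unfolded sg_local_theory_def, THEN spec[of _ \<alpha>], THEN spec[of _ \<epsilon>], THEN spec[of _ \<rho>0], THEN mp, THEN conjunct2, THEN conjunct2])
      (use \<alpha> \<epsilon> dat pos in blast)
  then have "\<exists>T' \<rho>' \<psi>'. T < T' \<and> sg_classical_solution \<alpha> \<epsilon> \<rho>0 T' \<rho>' \<psi>' \<and>
              (\<forall>t\<in>time_interval T. \<rho>' t = \<rho> t \<and> \<psi>' t = \<psi> t)"
    using sol T \<delta> K el half by blast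
  then show False using br by (simp add: sg_branch_def)
qed

text \<open>If T \<le> \<tau>, the bootstrap holds on all of [0,T), and the only remaining
  obstruction is the Hoelder seminorm of the gradient. Its growth rate is bounded on [0,T) in terms
  of quantities at time \<tau>, so it stays finite.\<close>

lemma branch_survives:
  assumes loc: sg_local_theory and \<alpha>: "0 < \<alpha>" "\<alpha> \<le> 1" and \<epsilon>: "\<epsilon> > 0" and dat: "torus_C1_holder \<alpha> \<rho>0" "torus_integral \<rho>0 = 0"
    and br: "sg_branch \<alpha> \<epsilon> \<rho>0 T \<rho> \<psi>"
    and D: "ma_const (\<alpha> / 2) D" and M: "M > 0" "\<And>x. \<bar>\<rho>0 x\<bar> \<le> M"
    and Y0: "Y0 \<ge> 1" "\<And>x. norm (grad \<rho>0 x) \<le> M * exp Y0"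
    and Y: "Y = (\<lambda>t. Y0 * exp (22 * D * M * t))"
    and s1: "25 * D * \<epsilon> * M * (Y \<tau>)\<^sup>2 \<le> 1" and s2: "8 * sch (\<alpha> / 2) * \<epsilon> * (20 * D * M * Y \<tau>) \<le> 1"
    and s3: "\<epsilon> * (20 * D * M * Y \<tau>) \<le> 1/2" and s4: "\<epsilon> * M \<le> 1/2" and \<tau>: "\<tau> \<ge> 0"
  shows "ereal \<tau> < T"
proof (rule ccontr)
  assume "\<not> ?thesis"
  then have T: "T \<le> ereal \<tau>" by simp
  \<comment> \<open>The elliptic estimates require an exponent strictly below 1, while \<alpha> = 1
    is allowed.\<close>
  define \<gamma> where "\<gamma> = \<alpha> / 2"
  have \<gamma>: "0 < \<gamma>" "\<gamma> < 1" "\<gamma> \<le> \<alpha>" using \<alpha> by (auto simp: \<gamma>_def)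
  have D': "ma_const \<gamma> D" using D by (simp add: \<gamma>_def)
  have D1: "D \<ge> 1" using D by (simp add: ma_const_def)
  have sol: "sg_classical_solution \<alpha> \<epsilon> \<rho>0 T \<rho> \<psi>" using br by (simp add: sg_branch_def)
  have r0: "\<rho> 0 = \<rho>0" using sol by (simp add: sg_classical_solution_def)
  have tle: "0 \<le> t \<and> t \<le> \<tau>" if "t \<in> time_interval T" for t
  proof -
    have "0 \<le> t" "ereal t < T" using that by (auto simp: time_interval_def)
    then have "ereal t < ereal \<tau>" using T less_le_trans by blast
    with \<open>0 \<le> t\<close> show ?thesis by simp
  qed
  have Ymono: "Y s \<le> Y t" if "s \<le> t" for s t
    unfolding Y using that D1 M Y0 by (auto intro!: mult_left_mono)
  have Y1: "Y t \<ge> 1" if "t \<ge> 0" for t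
  proof -
    have "Y t \<ge> Y 0" using that by (rule Ymono)
    moreover have "Y 0 = Y0" by (simp add: Y)
    ultimately show ?thesis using Y0 by linarith
  qed
  define Km where "Km = 20 * D * M * Y \<tau>"
  define G where "G = M * exp (Y \<tau>)"
  define N where "N = D * (3 * M + M * exp (Y \<tau>))"
  have G0: "G \<ge> 0" and N0: "N \<ge> 0" using M D1 by (auto simp: G_def N_def)
  have Km0: "Km \<ge> 0" using D1 M Y1[OF \<tau>] by (simp add: Km_def)
  have bnd: "norm (hess (\<psi> t) x) \<le> Km" "\<bar>\<rho> t x - \<rho> t y\<bar> \<le> G * norm (x - y)" "holder \<gamma> N (\<lambda>x. hess (\<psi> t) x $ i $ j)"
    if t: "t \<in> time_interval T" for t x y i j
  proof -
    have tt: "0 \<le> t" "t \<le> \<tau>" using tle[OF t] by auto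
    have Yt: "Y t \<le> Y \<tau>" using tt by (intro Ymono)
    have "(Y t)\<^sup>2 \<le> (Y \<tau>)\<^sup>2" using Yt Y1[OF tt(1)] by (intro power_mono) auto
    then have "25 * D * \<epsilon> * M * (Y t)\<^sup>2 \<le> 25 * D * \<epsilon> * M * (Y \<tau>)\<^sup>2" using D1 \<epsilon> M by (intro mult_left_mono) auto
    then have s: "25 * D * \<epsilon> * M * (Y t)\<^sup>2 \<le> 1" using s1 by linarith
    have tm: "t \<in> {0..t}" using tt by simp
    note bs = sol_bootstrap[OF sol \<epsilon> t D' \<gamma>(1,2) M Y0 Y s tm]
    have "20 * D * M * Y t \<le> Km" unfolding Km_def using Yt D1 M by (intro mult_left_mono) auto
    then show "norm (hess (\<psi> t) x) \<le> Km" using bs(1)[of x] by linarith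
    have e: "M * exp (Y t) \<le> G" unfolding G_def using Yt M by simp
    then have "M * exp (Y t) * norm (x - y) \<le> G * norm (x - y)" by (intro mult_right_mono) auto
    then show "\<bar>\<rho> t x - \<rho> t y\<bar> \<le> G * norm (x - y)" using bs(2)[of x y] by linarith
    have "D * (3 * M + M * exp (Y t)) \<le> N" unfolding N_def using e D1 by (intro mult_left_mono) (auto simp: G_def)
    then show "holder \<gamma> N (\<lambda>x. hess (\<psi> t) x $ i $ j)" by (rule holder_mono[OF bs(3)])
  qed
  have gr: "norm (grad (\<rho> t) x) \<le> G" if t: "t \<in> time_interval T" for t x
    by (rule gradient_le_lipschitz[OF sol_c1[OF sol \<epsilon> t] bnd(2)[OF t] G0])
  have c: "sch \<gamma> \<ge> 1000000" by (rule sch_ge[OF \<gamma>(1,2)])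
  have "0 \<le> 11520 * sch \<gamma> * \<epsilon> * (Km + N)" using c \<epsilon> Km0 N0 by simp
  \<comment> \<open>The scale at which \<open>pot_increment_estimate\<close> can absorb. It may be
    tiny, which is harmless because only finiteness of the C^{1,\<alpha>} norm is at stake.\<close>
  from exists_small_radius[OF this \<gamma>(1)] obtain r where
    r: "0 < r" "r \<le> 1/6" "11520 * sch \<gamma> * \<epsilon> * (Km + N) * r powr \<gamma> \<le> 1/2" by blast
  define C1 where "C1 = 4 * (2 * (96 / r + 2880 * sch \<gamma>))"
  have C10: "C1 \<ge> 0" using r c by (simp add: C1_def)
  \<comment> \<open>With P + 2 G as seminorm at exponent \<gamma>, the Lipschitz constant of the
    Hessian is C1 (3 G + 1 + P); adding 2 Km still gives at most \<open>cc\<close> (1 + P).\<close>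
  define cc where "cc = C1 * (3 * G + 1) + 2 * Km"
  have cc0: "cc \<ge> 0" using C10 G0 Km0 by (simp add: cc_def)
  have inc: "norm ((perp_grad (\<psi> t) (x + h) - perp_grad (\<psi> t) x) - (perp_grad (\<psi> t) (y + h) - perp_grad (\<psi> t) y))
      \<le> cc * (1 + P) * norm h * norm (x - y) powr \<alpha>"
    if t: "t \<in> time_interval T" and P0: "P \<ge> 0" and P: "\<And>x y. norm (grad (\<rho> t) x - grad (\<rho> t) y) \<le> P * norm (x - y) powr \<alpha>"
    for t P x y h
  proof -
    have P': "norm (grad (\<rho> t) x - grad (\<rho> t) y) \<le> (P + 2 * G) * norm (x - y) powr \<gamma>" for x y
      by (rule holder_exponent_mono[OF P P0 gr[OF t] \<gamma>(1,3)])
    have PG: "P + 2 * G \<ge> 0" using P0 G0 by simp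
    have kb: "\<bar>hess (\<psi> t) x $ i $ j\<bar> \<le> Km" for x i j using entry_le_norm[of "hess (\<psi> t) x" i j] bnd(1)[OF t, of x] by linarith
    have sm: "8 * sch \<gamma> * \<epsilon> * Km \<le> 1" using s2 by (simp add: Km_def \<gamma>_def)
    have l: "norm (hess (\<psi> t) (x + h) - hess (\<psi> t) x) \<le> (C1 * (G + 1 + (P + 2 * G))) * norm h" for x h
    proof (cases "h = 0")
      case False
      have "\<bar>(hess (\<psi> t) (x + h) - hess (\<psi> t) x) $ i $ j\<bar> \<le> 2 * (96 / r + 2880 * sch \<gamma>) * (G + 1 + (P + 2 * G)) * norm h" for i j
        using pot_increment_estimate[OF \<gamma>(1,2) \<epsilon> sol_pot[OF sol \<epsilon> t] sol_eq[OF sol \<epsilon> t] sol_c1[OF sol \<epsilon> t] kb bnd(3)[OF t] N0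
            gr[OF t] P' PG sm r False, of x i j] by simp
      from norm_mat_le_entries[OF this] show ?thesis by (simp only: C1_def mult.assoc)
    qed simp
    have l0: "C1 * (G + 1 + (P + 2 * G)) \<ge> 0" using C10 G0 P0 by (intro mult_nonneg_nonneg) auto
    have "norm ((grad (\<psi> t) (x + h) - grad (\<psi> t) x) - (grad (\<psi> t) (y + h) - grad (\<psi> t) y))
      \<le> (C1 * (G + 1 + (P + 2 * G)) + 2 * Km) * norm h * norm (x - y) powr \<alpha>"
      by (rule pot_second_increment[OF sol_pot[OF sol \<epsilon> t] bnd(1)[OF t] l l0 \<alpha>])
    also have "\<dots> \<le> (cc * (1 + P)) * norm h * norm (x - y) powr \<alpha>"
    proof (intro mult_right_mono)
      have "0 \<le> C1 * (3 * G * P)" "0 \<le> Km * P" using C10 G0 P0 Km0 by auto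
      then show "C1 * (G + 1 + (P + 2 * G)) + 2 * Km \<le> cc * (1 + P)" by (simp add: cc_def algebra_simps)
    qed auto
    finally show ?thesis unfolding perp_grad_increment_norm .
  qed
  obtain K0 where K0: "C1_holder_bound \<alpha> K0 \<rho>0" using dat by (auto simp: torus_C1_holder_def)
  have K00: "K0 \<ge> 0" using K0 unfolding C1_holder_bound_def by (metis abs_ge_zero order_trans)
  define \<mu> where "\<mu> = 3 * Km + 2 * cc * G + 1"
  have \<mu>0: "\<mu> \<ge> 0" using Km0 cc0 G0 by (simp add: \<mu>_def)
  have hold: "norm (grad (\<rho> t) x - grad (\<rho> t) y) \<le> 2 * (K0 + 1) * exp (\<mu> * \<tau>) * norm (x - y) powr \<alpha>"
    if t: "t \<in> time_interval T" for t x y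
  proof -
    note sub = time_interval_sub[OF t]
    \<comment> \<open>This bound may depend on \<open>t\<close>; it only starts the absorption,
      whose outcome is uniform on [0,T).\<close>
    obtain P0 where P0: "\<forall>s\<in>{0..t}. C1_holder_bound \<alpha> P0 (\<rho> s)"
      using sol t unfolding sg_classical_solution_def by blast
    have tt: "t \<in> {0..t}" using tle[OF t] by simp
    have P00: "P0 \<ge> 0" using P0 tt unfolding C1_holder_bound_def by (metis abs_ge_zero order_trans)
    have "norm (grad (\<rho> t) x - grad (\<rho> t) y) \<le> 2 * (K0 + 1) * exp ((3 * Km + 2 * cc * G + 1) * t) * norm (x - y) powr \<alpha>"
    proof (rule transport_gradient_holder[where u="\<lambda>t. perp_grad (\<psi> t)" and \<tau>=t and \<rho>=\<rho> and R="\<lambda>t. grad (\<rho> t)"])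
      show "continuous_on ({0..t} \<times> UNIV) (\<lambda>(t, x). \<rho> t x)" by (rule sol_cont_rho[OF sol t])
      show "norm (grad (\<rho> 0) x - grad (\<rho> 0) y) \<le> K0 * norm (x - y) powr \<alpha>" for x y
        using K0 by (simp add: r0 C1_holder_bound_def dist_norm)
      fix s assume s: "s \<in> {0..t}"
      then have sI: "s \<in> time_interval T" using sub by blast
      show "periodic (\<rho> s)" "c1 (\<rho> s) (grad (\<rho> s))" using sol_facts[OF sol \<epsilon> sI] by auto
      show "((\<lambda>s. \<rho> s x) has_real_derivative - (perp_grad (\<psi> s) x \<bullet> grad (\<rho> s) x)) (at s within {0..t})" for x
        using has_field_derivative_subset[OF sol_transport[OF sol \<epsilon> sI] sub] .
      show "norm (perp_grad (\<psi> s) x - perp_grad (\<psi> s) y) \<le> Km * norm (x - y)" for x y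
        unfolding perp_grad_diff_norm by (rule pot_lipschitz_bound[OF sol_pot[OF sol \<epsilon> sI] bnd(1)[OF sI]])
      show "norm (grad (\<rho> s) x) \<le> G" for x by (rule gr[OF sI])
      show "norm (grad (\<rho> s) x - grad (\<rho> s) y) \<le> P0 * norm (x - y) powr \<alpha>" for x y
        using P0 s by (simp add: C1_holder_bound_def dist_norm)
      show "norm ((perp_grad (\<psi> s) (x + h) - perp_grad (\<psi> s) x) - (perp_grad (\<psi> s) (y + h) - perp_grad (\<psi> s) y))
        \<le> cc * (1 + P) * norm h * norm (x - y) powr \<alpha>"
        if "P \<ge> 0" "\<And>x y. norm (grad (\<rho> s) x - grad (\<rho> s) y) \<le> P * norm (x - y) powr \<alpha>" for P x y h
        by (rule inc[OF sI that])
    qed (use P00 K00 \<alpha> Km0 cc0 tt in auto)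
    also have "\<dots> \<le> 2 * (K0 + 1) * exp (\<mu> * \<tau>) * norm (x - y) powr \<alpha>"
    proof (intro mult_right_mono mult_left_mono)
      have "\<mu> * t \<le> \<mu> * \<tau>" using \<mu>0 tle[OF t] by (intro mult_left_mono) auto
      then show "exp ((3 * Km + 2 * cc * G + 1) * t) \<le> exp (\<mu> * \<tau>)" by (simp add: \<mu>_def)
    qed (use K00 in auto)
    finally show ?thesis .
  qed
  define K where "K = M + G + 2 * (K0 + 1) * exp (\<mu> * \<tau>)"
  have rb: "\<bar>\<rho> t x\<bar> \<le> M" if "t \<in> time_interval T" for t x by (rule sol_sup[OF sol \<epsilon> that M(2)])
  have Kp: "0 \<le> 2 * (K0 + 1) * exp (\<mu> * \<tau>)" using K00 by simp
  have eb: "1/2 \<le> 1 + \<epsilon> * q" if "\<bar>q\<bar> \<le> M" for q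
  proof -
    have "\<epsilon> * \<bar>q\<bar> \<le> 1/2" using mult_left_mono[OF that, of \<epsilon>] \<epsilon> s4 by linarith
    then have "\<bar>\<epsilon> * q\<bar> \<le> 1/2" using \<epsilon> by (simp only: abs_mult abs_of_pos)
    then show ?thesis by linarith
  qed
  have "T = \<infinity>"
  proof (rule branch_continuation[OF loc \<alpha> \<epsilon> dat br, where \<delta>="1/2" and K=K])
    show "0 < 1 + \<epsilon> * \<rho>0 x" for x using eb[OF M(2)[of x]] by linarith
    fix t assume t: "t \<in> time_interval T"
    show "1/2 \<le> 1 + \<epsilon> * \<rho> t x" for x by (rule eb[OF rb[OF t]])
    show "C1_holder_bound \<alpha> K (\<rho> t)"
      unfolding C1_holder_bound_def
    proof (intro conjI allI)
      fix x y
      show "\<bar>\<rho> t x\<bar> \<le> K" using rb[OF t, of x] G0 Kp by (simp add: K_def)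
      show "norm (grad (\<rho> t) x) \<le> K" using gr[OF t, of x] M Kp by (simp add: K_def)
      have "2 * (K0 + 1) * exp (\<mu> * \<tau>) * norm (x - y) powr \<alpha> \<le> K * norm (x - y) powr \<alpha>"
        using G0 M by (intro mult_right_mono) (auto simp: K_def)
      then show "norm (grad (\<rho> t) x - grad (\<rho> t) y) \<le> K * dist x y powr \<alpha>"
        using hold[OF t, of x y] by (simp add: dist_norm)
    qed
    show "uniformly_elliptic (1/2) (mat 1 + \<epsilon> *\<^sub>R hess (\<psi> t) x)" for x
    proof (rule uniformly_elliptic_small)
      have "\<epsilon> * norm (hess (\<psi> t) x) \<le> \<epsilon> * Km" using bnd(1)[OF t] \<epsilon> by (intro mult_left_mono) auto
      then have "\<epsilon> * norm (hess (\<psi> t) x) \<le> 1/2" using s3 unfolding Km_def by linarith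
      then show "norm (\<epsilon> *\<^sub>R hess (\<psi> t) x) \<le> 1/2" using \<epsilon> by simp
    qed
  qed simp
  with T show False by simp
qed

section \<open>Lower bound for the lifespan\<close>

lemma sup_norm_upper:
  assumes "\<And>x. norm (f x) \<le> K"
  shows "norm (f x) \<le> sup_norm f"
  unfolding sup_norm_def by (rule cSUP_upper) (use assms in \<open>auto intro!: bdd_aboveI2\<close>)

lemma sup_norm_least: "(\<And>x. norm (f x) \<le> K) \<Longrightarrow> sup_norm f \<le> K"
  unfolding sup_norm_def by (rule cSUP_least) auto

text \<open>Up to the chosen time Y grows by the factor \<epsilon>^(-1/4). Every smallness condition
  then reduces to a constant times sqrt \<epsilon>, and the dependence of these constants on the
  datum is paid for by \<epsilon>0.\<close>

lemma lifespan_bound: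
  assumes loc: sg_local_theory and \<alpha>: "0 < \<alpha>" "\<alpha> \<le> 1" and D: "ma_const (\<alpha> / 2) D"
    and dat: "torus_C1_holder \<alpha> \<rho>0" "torus_integral \<rho>0 = 0" and M: "sup_norm \<rho>0 > 0" and \<eta>: "\<eta> > 0"
  shows "\<exists>\<epsilon>0>0. \<forall>\<epsilon>. 0 < \<epsilon> \<and> \<epsilon> < \<epsilon>0 \<longrightarrow> (\<forall>T \<rho> \<psi>. sg_branch \<alpha> \<epsilon> \<rho>0 T \<rho> \<psi> \<longrightarrow>
     perturbative_lifespan \<eta> \<epsilon> T \<psi> \<ge> ereal (1 / (88 * D) / sup_norm \<rho>0 * ln (1 / \<epsilon>)))"
proof -
  define M where "M = sup_norm \<rho>0"
  define G0 where "G0 = sup_norm (grad \<rho>0)"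
  \<comment> \<open>Makes the initial Lipschitz constant at most M e^Y0 while keeping Y0 \<ge>
    1.\<close>
  define Y0 where "Y0 = 1 + log_plus (G0 / M)"
  obtain K0 where K0: "C1_holder_bound \<alpha> K0 \<rho>0" using dat by (auto simp: torus_C1_holder_def)
  have M0: "M > 0" using M by (simp add: M_def)
  have Mb: "\<bar>\<rho>0 x\<bar> \<le> M" for x
    using sup_norm_upper[of \<rho>0 K0 x] K0 by (simp add: C1_holder_bound_def M_def)
  have Gb: "norm (grad \<rho>0 x) \<le> G0" for x
    using sup_norm_upper[of "grad \<rho>0" K0 x] K0 by (simp add: C1_holder_bound_def G0_def)
  have Y1: "Y0 \<ge> 1" by (simp add: Y0_def log_plus_def)
  have GY: "norm (grad \<rho>0 x) \<le> M * exp Y0" for x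
  proof (cases "G0 > 0")
    case True
    have "ln (G0 / M) \<le> Y0" by (simp add: Y0_def log_plus_def)
    then have "exp (ln (G0 / M)) \<le> exp Y0" by simp
    then have "G0 \<le> M * exp Y0" using True M0 by (simp add: divide_le_eq mult.commute)
    then show ?thesis using Gb[of x] by linarith
  next
    case False
    have "0 \<le> M * exp Y0" using M0 by simp
    then show ?thesis using Gb[of x] False by linarith
  qed
  have D1: "D \<ge> 1" using D by (simp add: ma_const_def)
  have c: "sch (\<alpha> / 2) \<ge> 1000000" by (rule sch_ge) (use \<alpha> in auto)
  define A where "A = 20 * D * M * Y0"
  have A0: "A \<ge> 0" using D1 M0 Y1 by (simp add: A_def)
  \<comment> \<open>The sum of all constants that must not exceed 1 / sqrt \<epsilon>: bootstrap,
    Schauder smallness, ellipticity, the bound \<eta>, and positivity of the density. The condition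
    \<epsilon> < 1 / Q^2 then yields all of them.\<close>
  define Q where "Q = 25 * D * M * Y0\<^sup>2 + 8 * sch (\<alpha> / 2) * A + 2 * A + A / \<eta> + 2 * M + 1"
  have nn: "0 \<le> 25 * D * M * Y0\<^sup>2" "0 \<le> 8 * sch (\<alpha> / 2) * A" "0 \<le> A / \<eta>" using D1 M0 A0 c \<eta> by auto
  have Q: "Q \<ge> 1" "25 * D * M * Y0\<^sup>2 \<le> Q" "8 * sch (\<alpha> / 2) * A \<le> Q" "2 * A \<le> Q" "A / \<eta> \<le> Q" "2 * M \<le> Q"
    using nn A0 M0 unfolding Q_def by linarith+
  show ?thesis
  proof (intro exI[of _ "1 / Q\<^sup>2"] conjI allI impI)
    show "0 < 1 / Q\<^sup>2" using Q(1) by simp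
    fix \<epsilon> T \<rho> \<psi> assume e: "0 < \<epsilon> \<and> \<epsilon> < 1 / Q\<^sup>2" and br: "sg_branch \<alpha> \<epsilon> \<rho>0 T \<rho> \<psi>"
    then have \<epsilon>: "\<epsilon> > 0" by simp
    define s where "s = sqrt \<epsilon>"
    have s0: "s > 0" and ss: "\<epsilon> = s * s" using \<epsilon> by (auto simp: s_def)
    have sQ: "Q * s \<le> 1"
    proof -
      have "s \<le> sqrt (1 / Q\<^sup>2)" unfolding s_def using e by (intro real_sqrt_le_mono) simp
      also have "\<dots> = 1 / Q" using Q(1) by (simp add: real_sqrt_divide)
      finally show ?thesis using Q(1) by (simp add: field_simps)
    qed
    have s1: "s \<le> 1" using sQ mult_right_mono[OF Q(1), of s] s0 by linarith
    have use: "q * s \<le> 1" if "q \<le> Q" for q using mult_right_mono[OF that, of s] s0 sQ by linarith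
    have \<epsilon>1: "\<epsilon> \<le> 1" unfolding ss using s1 s0 by (intro mult_le_one) auto
    \<comment> \<open>88 = 4 * 22, so exp (22 D M \<tau>) = \<epsilon>^(-1/4), and \<epsilon> times
      its square is sqrt \<epsilon>.\<close>
    define \<tau> where "\<tau> = 1 / (88 * D) / M * ln (1 / \<epsilon>)"
    have \<tau>0: "\<tau> \<ge> 0" unfolding \<tau>_def using \<epsilon> \<epsilon>1 D1 M0 by (intro mult_nonneg_nonneg) auto
    define E where "E = exp (22 * D * M * \<tau>)"
    have E1: "E \<ge> 1" unfolding E_def using D1 M0 \<tau>0 by simp
    have EE: "E * E = 1 / s"
    proof -
      have "22 * D * M * \<tau> + 22 * D * M * \<tau> = (1/2) * ln (1 / \<epsilon>)" unfolding \<tau>_def using D1 M0 by (simp add: field_simps)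
      then have "E * E = exp ((1/2) * ln (1 / \<epsilon>))" unfolding E_def by (simp add: exp_add[symmetric])
      also have "ln (1 / \<epsilon>) = 2 * ln (1 / s)" unfolding ss using s0 by (simp add: ln_div ln_mult)
      finally show ?thesis using s0 by simp
    qed
    have \<epsilon>EE: "\<epsilon> * (E * E) = s" unfolding EE ss using s0 by simp
    have \<epsilon>E: "\<epsilon> * E \<le> s"
    proof -
      have "\<epsilon> * (E * 1) \<le> \<epsilon> * (E * E)" using E1 \<epsilon> by (intro mult_left_mono) auto
      then show ?thesis using \<epsilon>EE by simp
    qed
    define Y where "Y = (\<lambda>t. Y0 * exp (22 * D * M * t))"
    have Y\<tau>: "Y \<tau> = Y0 * E" by (simp add: Y_def E_def)
    have b1: "25 * D * \<epsilon> * M * (Y \<tau>)\<^sup>2 \<le> 1"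
    proof -
      have "25 * D * \<epsilon> * M * (Y \<tau>)\<^sup>2 = 25 * D * M * Y0\<^sup>2 * (\<epsilon> * (E * E))" by (simp add: Y\<tau> power2_eq_square mult_ac)
      then show ?thesis using use[OF Q(2)] by (simp only: \<epsilon>EE)
    qed
    have eA: "\<epsilon> * (20 * D * M * Y \<tau>) \<le> A * s"
    proof -
      have "\<epsilon> * (20 * D * M * Y \<tau>) = A * (\<epsilon> * E)" by (simp add: Y\<tau> A_def mult_ac)
      also have "\<dots> \<le> A * s" by (rule mult_left_mono[OF \<epsilon>E A0])
      finally show ?thesis .
    qed
    have b2: "8 * sch (\<alpha> / 2) * \<epsilon> * (20 * D * M * Y \<tau>) \<le> 1"
    proof -
      have "8 * sch (\<alpha> / 2) * (\<epsilon> * (20 * D * M * Y \<tau>)) \<le> 8 * sch (\<alpha> / 2) * (A * s)" using c by (intro mult_left_mono eA) auto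
      also have "\<dots> = 8 * sch (\<alpha> / 2) * A * s" by (simp only: mult.assoc)
      also have "\<dots> \<le> 1" by (rule use[OF Q(3)])
      finally show ?thesis by (simp only: mult.assoc)
    qed
    have b3: "\<epsilon> * (20 * D * M * Y \<tau>) \<le> 1/2" using eA use[OF Q(4)] by simp
    have b5: "\<epsilon> * (20 * D * M * Y \<tau>) \<le> \<eta>"
    proof -
      have "A * s \<le> \<eta>" using use[OF Q(5)] \<eta> by (simp add: divide_le_eq)
      then show ?thesis using eA by linarith
    qed
    have b4: "\<epsilon> * M \<le> 1/2"
    proof -
      have "\<epsilon> * M \<le> s * M" unfolding ss using s0 s1 M0 by (intro mult_right_mono) (auto simp: mult_left_le)
      then show ?thesis using use[OF Q(6)] by (simp add: mult_ac)
    qed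
    have surv: "ereal \<tau> < T"
      by (rule branch_survives[OF loc \<alpha> \<epsilon> dat br D M0 Mb Y1 GY Y_def b1 b2 b3 b4 \<tau>0])
    then have \<tau>I: "\<tau> \<in> time_interval T" using \<tau>0 by (simp add: time_interval_def)
    have sol: "sg_classical_solution \<alpha> \<epsilon> \<rho>0 T \<rho> \<psi>" using br by (simp add: sg_branch_def)
    have g2: "0 < \<alpha> / 2" "\<alpha> / 2 < 1" using \<alpha> by auto
    have "\<epsilon> * sup_norm (hess (\<psi> t)) \<le> \<eta>" if t: "t \<in> {0..\<tau>}" for t
    proof -
      have "sup_norm (hess (\<psi> t)) \<le> 20 * D * M * Y \<tau>"
      proof (rule sup_norm_least)
        fix x
        have "norm (hess (\<psi> t) x) \<le> 20 * D * M * Y t"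
          by (rule sol_bootstrap(1)[OF sol \<epsilon> \<tau>I D g2 M0 Mb Y1 GY Y_def b1 t])
        also have "\<dots> \<le> 20 * D * M * Y \<tau>"
        proof (rule mult_left_mono)
          show "Y t \<le> Y \<tau>" unfolding Y_def using t D1 M0 Y1 by (intro mult_left_mono) auto
        qed (use D1 M0 in simp)
        finally show "norm (hess (\<psi> t) x) \<le> 20 * D * M * Y \<tau>" .
      qed
      then have "\<epsilon> * sup_norm (hess (\<psi> t)) \<le> \<epsilon> * (20 * D * M * Y \<tau>)" using \<epsilon> by (intro mult_left_mono) auto
      with b5 show ?thesis by linarith
    qed
    then have "ereal \<tau> \<le> perturbative_lifespan \<eta> \<epsilon> T \<psi>"
      unfolding perturbative_lifespan_def using \<tau>I by (intro Sup_upper) blast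
    then show "ereal (1 / (88 * D) / sup_norm \<rho>0 * ln (1 / \<epsilon>)) \<le> perturbative_lifespan \<eta> \<epsilon> T \<psi>"
      by (simp add: \<tau>_def M_def)
  qed
qed

text \<open>The density stays 0, and \<open>ma_unique\<close> compares the branch with the zero
  potential, so the Hessian vanishes; the continuation criterion then gives infinite existence
  time.\<close>

lemma zero_datum:
  assumes loc: sg_local_theory and \<alpha>: "0 < \<alpha>" "\<alpha> \<le> 1" and dat: "torus_C1_holder \<alpha> \<rho>0" "torus_integral \<rho>0 = 0"
    and M: "sup_norm \<rho>0 = 0" and \<eta>: "\<eta> > 0" and \<epsilon>: "\<epsilon> > 0" and br: "sg_branch \<alpha> \<epsilon> \<rho>0 T \<rho> \<psi>"
  shows "\<forall>t\<in>time_interval T. \<forall>x. \<rho> t x = 0" "perturbative_lifespan \<eta> \<epsilon> T \<psi> = \<infinity>"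
proof -
  obtain K0 where K0: "C1_holder_bound \<alpha> K0 \<rho>0" using dat by (auto simp: torus_C1_holder_def)
  have z: "\<bar>\<rho>0 x\<bar> \<le> 0" for x using sup_norm_upper[of \<rho>0 K0 x] K0 M by (simp add: C1_holder_bound_def)
  have sol: "sg_classical_solution \<alpha> \<epsilon> \<rho>0 T \<rho> \<psi>" using br by (simp add: sg_branch_def)
  have rz: "\<rho> t x = 0" if "t \<in> time_interval T" for t x using sol_sup[OF sol \<epsilon> that z] by simp
  then show "\<forall>t\<in>time_interval T. \<forall>x. \<rho> t x = 0" by blast
  have hz: "hess (\<psi> t) x = 0" if t: "t \<in> time_interval T" for t x
  proof -
    have "hess (\<psi> t) = (\<lambda>x. 0)"
      by (rule ma_unique[OF sol_pot[OF sol \<epsilon> t] pot_zero \<epsilon> sol_pos[OF sol \<epsilon> t]])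
        (use sol_eq[OF sol \<epsilon> t] rz[OF t] in \<open>auto simp: tr2_def det2_def\<close>)
    then show ?thesis by simp
  qed
  have gz: "grad (\<rho> t) x = 0" if t: "t \<in> time_interval T" for t x
  proof -
    have "norm (grad (\<rho> t) x) \<le> 0"
      by (rule gradient_le_lipschitz[OF sol_c1[OF sol \<epsilon> t]]) (auto simp: rz[OF t])
    then show ?thesis by simp
  qed
  have T: "T = \<infinity>"
  proof (rule branch_continuation[OF loc \<alpha> \<epsilon> dat br, where \<delta>=1 and K=0])
    show "0 < 1 + \<epsilon> * \<rho>0 x" for x using z[of x] by simp
    fix t assume t: "t \<in> time_interval T"
    show "1 \<le> 1 + \<epsilon> * \<rho> t x" for x by (simp add: rz[OF t])
    show "C1_holder_bound \<alpha> 0 (\<rho> t)" by (simp add: C1_holder_bound_def rz[OF t] gz[OF t])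
    show "uniformly_elliptic (1/2) (mat 1 + \<epsilon> *\<^sub>R hess (\<psi> t) x)" for x
      by (rule uniformly_elliptic_small) (simp add: hz[OF t])
  qed simp
  have sn: "sup_norm (hess (\<psi> t)) \<le> 0" if "t \<ge> 0" for t
    by (rule sup_norm_least) (use hz[of t] that T in \<open>simp add: time_interval_def\<close>)
  have "ereal t \<le> perturbative_lifespan \<eta> \<epsilon> T \<psi>" if t: "t \<ge> 0" for t
  proof -
    have "\<epsilon> * sup_norm (hess (\<psi> s)) \<le> \<eta>" if "s \<in> {0..t}" for s
      using mult_nonneg_nonpos[of \<epsilon> "sup_norm (hess (\<psi> s))"] sn[of s] that \<epsilon> \<eta> by simp
    then show ?thesis unfolding perturbative_lifespan_def
      using t T by (intro Sup_upper) (auto simp: time_interval_def)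
  qed
  then show "perturbative_lifespan \<eta> \<epsilon> T \<psi> = \<infinity>"
  proof (intro ereal_top)
    fix B assume *: "\<And>t. 0 \<le> t \<Longrightarrow> ereal t \<le> perturbative_lifespan \<eta> \<epsilon> T \<psi>"
    have "ereal B \<le> ereal (max 0 B)" by simp
    also have "\<dots> \<le> perturbative_lifespan \<eta> \<epsilon> T \<psi>" by (rule *) simp
    finally show "ereal B \<le> perturbative_lifespan \<eta> \<epsilon> T \<psi>" .
  qed
qed

theorem theorem5p6:
  assumes "sg_local_theory"
  shows "\<exists>\<eta>1>0. \<forall>\<eta>0::real. 0 < \<eta>0 \<and> \<eta>0 \<le> \<eta>1 \<longrightarrow>
    (\<exists>c C :: real \<Rightarrow> real \<Rightarrow> real. (\<forall>\<alpha> L. 0 < c \<alpha> L \<and> 0 < C \<alpha> L) \<and>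
      (\<forall>\<alpha> \<rho>0. 0 < \<alpha> \<and> \<alpha> \<le> 1 \<and> torus_C1_holder \<alpha> \<rho>0 \<and> torus_integral \<rho>0 = 0 \<longrightarrow>
        (let M0 = sup_norm \<rho>0; G0 = sup_norm (grad \<rho>0); L = 1 + log_plus (G0 / M0) in
          (M0 = 0 \<longrightarrow>
            (\<forall>\<epsilon>>0. \<forall>T \<rho> \<psi>. sg_branch \<alpha> \<epsilon> \<rho>0 T \<rho> \<psi> \<longrightarrow>
              (\<forall>t\<in>time_interval T. \<forall>x. \<rho> t x = 0) \<and>
              perturbative_lifespan \<eta>0 \<epsilon> T \<psi> = \<infinity>)) \<and>
          (M0 > 0 \<longrightarrow>
            (\<exists>\<epsilon>0>0. \<forall>\<epsilon>. 0 < \<epsilon> \<and> \<epsilon> < \<epsilon>0 \<longrightarrow>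
              (\<forall>T \<rho> \<psi>. sg_branch \<alpha> \<epsilon> \<rho>0 T \<rho> \<psi> \<longrightarrow>
                perturbative_lifespan \<eta>0 \<epsilon> T \<psi> \<ge>
                  ereal (c \<alpha> L / M0 * ln (1 / \<epsilon>) - C \<alpha> L) \<and>
                perturbative_lifespan \<eta>0 \<epsilon> T \<psi> / ereal \<epsilon> \<ge>
                  ereal (c \<alpha> L / (\<epsilon> * M0) * ln (1 / \<epsilon>) - C \<alpha> L / \<epsilon>)))))))"
proof -
  have "\<exists>D. 0 < \<alpha> \<and> \<alpha> \<le> 1 \<longrightarrow> ma_const (\<alpha> / 2) D" for \<alpha>
    using ma_estimate[of "\<alpha> / 2"] unfolding ma_const_def by (cases "0 < \<alpha> \<and> \<alpha> \<le> 1") auto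
  then obtain D where D: "\<And>\<alpha>. 0 < \<alpha> \<Longrightarrow> \<alpha> \<le> 1 \<Longrightarrow> ma_const (\<alpha> / 2) (D \<alpha>)" by metis
  \<comment> \<open>The constant \<open>D\<close> is fixed per \<alpha>, before the datum. Outside
    (0, 1] the value 1 keeps \<open>c\<close> positive, as is demanded for all arguments.\<close>
  define c where "c = (\<lambda>(\<alpha>::real) (L::real). if 0 < \<alpha> \<and> \<alpha> \<le> 1 then 1 / (88 * D \<alpha>) else 1)"
  \<comment> \<open>The bound of \<open>lifespan_bound\<close> holds without subtraction, so any
    positive value serves.\<close>
  define C where "C = (\<lambda>(\<alpha>::real) (L::real). 1 :: real)"
  have cpos: "0 < c \<alpha> L \<and> 0 < C \<alpha> L" for \<alpha> L :: real
    using D[of \<alpha>] by (auto simp: c_def C_def ma_const_def)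
  \<comment> \<open>\<open>lifespan_bound\<close> accepts every positive \<eta>, with \<epsilon>0
    chosen after it, so 1 is a convenient threshold for \<eta>0.\<close>
  show ?thesis
    unfolding Let_def
  proof (rule exI[of _ 1], rule conjI, simp, rule allI, rule impI, rule exI[of _ c], rule exI[of _ C], rule conjI,
      use cpos in blast, intro allI impI conjI)
    fix \<eta>0 :: real assume \<eta>: "0 < \<eta>0 \<and> \<eta>0 \<le> 1"
    fix \<alpha> \<rho>0 assume d: "0 < \<alpha> \<and> \<alpha> \<le> 1 \<and> torus_C1_holder \<alpha> \<rho>0 \<and> torus_integral \<rho>0 = 0"
    {
      fix \<epsilon> T \<rho> \<psi> assume "sup_norm \<rho>0 = 0" "0 < \<epsilon>" "sg_branch \<alpha> \<epsilon> \<rho>0 T \<rho> \<psi>"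
      then show "\<forall>t\<in>time_interval T. \<forall>x. \<rho> t x = 0" "perturbative_lifespan \<eta>0 \<epsilon> T \<psi> = \<infinity>"
        using zero_datum[OF assms, of \<alpha> \<rho>0 \<eta>0 \<epsilon> T \<rho> \<psi>] d \<eta> by auto
    }
    let ?L = "1 + log_plus (sup_norm (grad \<rho>0) / sup_norm \<rho>0)"
    assume M: "0 < sup_norm \<rho>0"
    obtain \<epsilon>0 where e0: "\<epsilon>0 > 0" and e: "\<And>\<epsilon> T \<rho> \<psi>. 0 < \<epsilon> \<Longrightarrow> \<epsilon> < \<epsilon>0 \<Longrightarrow> sg_branch \<alpha> \<epsilon> \<rho>0 T \<rho> \<psi> \<Longrightarrow>
       perturbative_lifespan \<eta>0 \<epsilon> T \<psi> \<ge> ereal (1 / (88 * D \<alpha>) / sup_norm \<rho>0 * ln (1 / \<epsilon>))"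
    proof -
      have "\<exists>\<epsilon>0>0. \<forall>\<epsilon>. 0 < \<epsilon> \<and> \<epsilon> < \<epsilon>0 \<longrightarrow> (\<forall>T \<rho> \<psi>. sg_branch \<alpha> \<epsilon> \<rho>0 T \<rho> \<psi> \<longrightarrow>
         perturbative_lifespan \<eta>0 \<epsilon> T \<psi> \<ge> ereal (1 / (88 * D \<alpha>) / sup_norm \<rho>0 * ln (1 / \<epsilon>)))"
        by (rule lifespan_bound[OF assms]) (use D d M \<eta> in auto)
      then show thesis by (elim exE conjE) (rule that, assumption, simp)
    qed
    show "\<exists>\<epsilon>0>0. \<forall>\<epsilon>. 0 < \<epsilon> \<and> \<epsilon> < \<epsilon>0 \<longrightarrow>
              (\<forall>T \<rho> \<psi>. sg_branch \<alpha> \<epsilon> \<rho>0 T \<rho> \<psi> \<longrightarrow>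
                perturbative_lifespan \<eta>0 \<epsilon> T \<psi> \<ge>
                  ereal (c \<alpha> ?L / sup_norm \<rho>0 * ln (1 / \<epsilon>) - C \<alpha> ?L) \<and>
                perturbative_lifespan \<eta>0 \<epsilon> T \<psi> / ereal \<epsilon> \<ge>
                  ereal (c \<alpha> ?L / (\<epsilon> * sup_norm \<rho>0) * ln (1 / \<epsilon>) - C \<alpha> ?L / \<epsilon>))"
    proof (intro exI[of _ \<epsilon>0] conjI allI impI e0)
      fix \<epsilon> T \<rho> \<psi> assume a: "0 < \<epsilon> \<and> \<epsilon> < \<epsilon>0" "sg_branch \<alpha> \<epsilon> \<rho>0 T \<rho> \<psi>"
      define t where "t = c \<alpha> ?L / sup_norm \<rho>0 * ln (1 / \<epsilon>)"
      have t: "ereal t \<le> perturbative_lifespan \<eta>0 \<epsilon> T \<psi>"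
        using e[OF _ _ a(2)] a(1) d by (simp add: t_def c_def)
      have "ereal (t - C \<alpha> ?L) \<le> ereal t" by (simp add: C_def)
      then show "ereal (c \<alpha> ?L / sup_norm \<rho>0 * ln (1 / \<epsilon>) - C \<alpha> ?L) \<le> perturbative_lifespan \<eta>0 \<epsilon> T \<psi>"
        using t unfolding t_def by (rule order_trans)
      have "c \<alpha> ?L / (\<epsilon> * sup_norm \<rho>0) * ln (1 / \<epsilon>) - C \<alpha> ?L / \<epsilon> = (t - 1) / \<epsilon>"
        using a(1) M by (simp add: t_def C_def field_simps)
      also have "\<dots> \<le> t / \<epsilon>" using a(1) by (intro divide_right_mono) auto
      finally have "ereal (c \<alpha> ?L / (\<epsilon> * sup_norm \<rho>0) * ln (1 / \<epsilon>) - C \<alpha> ?L / \<epsilon>) \<le> ereal t / ereal \<epsilon>"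
        using a(1) by simp
      also have "\<dots> \<le> perturbative_lifespan \<eta>0 \<epsilon> T \<psi> / ereal \<epsilon>"
        using a(1) by (intro ereal_divide_right_mono t) auto
      finally show "ereal (c \<alpha> ?L / (\<epsilon> * sup_norm \<rho>0) * ln (1 / \<epsilon>) - C \<alpha> ?L / \<epsilon>) \<le> perturbative_lifespan \<eta>0 \<epsilon> T \<psi> / ereal \<epsilon>" .
    qed
  qed
qed

end
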